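(* Let $p$ be an odd prime, $n$ a positive integer, and $V_n$ the elementary abelian $p$-group of order $p^n$. There is an isomorphism of $GL_n(\mathbb{F}_p)$-modules $$H^3(V_n,k^\times)\cong{\bigwedge}^3(V_n^* )\oplus\mathsf{S}^2(V_n^* ).$$
   Context: $k$ is an algebraically closed field of characteristic $0$. $V_n$ is also viewed as an $n$-dimensional vector space over $\mathbb{F}_p$, so $\mathsf{Aut}(V_n)=GL_n(\mathbb{F}_p)$, and $V_n^*=\mathrm{Hom}(V_n,\mathbb{F}_p)$ is the dual vector space. $H^3(V_n,k^\times)$ is group cohomology with trivial action on $k^\times$, with $GL_n(\mathbb{F}_p)$ acting through its action on $V_n$. $\bigwedge^i(W)$ and $\mathsf{S}^i(W)$ denote the $i$-th graded components of the alternating (exterior) and symmetric algebras of an $\mathbb{F}_p$-vector space $W$. *)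

theory Defs
  imports
    "HOL-Algebra.QuotRing"
    "HOL-Algebra.Product_Groups"
    "HOL-Analysis.Cartesian_Space"
    "HOL-Computational_Algebra.Polynomial"
    "HOL-Library.Poly_Mapping"
    "Berlekamp_Zassenhaus.Finite_Field"
begin

section \<open>Modules over a group\<close>

text \<open>A (left) module over a group \<open>G\<close> is an abelian group \<open>M\<close>, written multiplicatively as usual
  in HOL-Algebra, on which \<open>G\<close> acts by endomorphisms.\<close>

definition group_module ::
  "('g, 'x) monoid_scheme \<Rightarrow> ('m, 'y) monoid_scheme \<Rightarrow> ('g \<Rightarrow> 'm \<Rightarrow> 'm) \<Rightarrow> bool" where
  "group_module G M act \<longleftrightarrow>
     Group.group G \<and> comm_group M \<and>
     (\<forall>g\<in>carrier G. act g \<in> hom M M) \<and>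
     (\<forall>x\<in>carrier M. act \<one>\<^bsub>G\<^esub> x = x) \<and>
     (\<forall>g\<in>carrier G. \<forall>h\<in>carrier G. \<forall>x\<in>carrier M. act (g \<otimes>\<^bsub>G\<^esub> h) x = act g (act h x))"

definition group_module_isomorphic ::
  "('g, 'x) monoid_scheme \<Rightarrow> ('m, 'y) monoid_scheme \<Rightarrow> ('g \<Rightarrow> 'm \<Rightarrow> 'm) \<Rightarrow>
     ('n, 'z) monoid_scheme \<Rightarrow> ('g \<Rightarrow> 'n \<Rightarrow> 'n) \<Rightarrow> bool" where
  "group_module_isomorphic G M actM N actN \<longleftrightarrow>
     group_module G M actM \<and> group_module G N actN \<and>
     (\<exists>\<phi>\<in>iso M N. \<forall>g\<in>carrier G. \<forall>x\<in>carrier M. \<phi> (actM g x) = actN g (\<phi> x))"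


section \<open>Group cohomology with trivial action\<close>

definition tuples :: "('g, 'x) monoid_scheme \<Rightarrow> nat \<Rightarrow> 'g list set" where
  "tuples G n = {xs. length xs = n \<and> set xs \<subseteq> carrier G}"

text \<open>Inhomogeneous \<open>n\<close>-cochains: all functions from \<open>n\<close>-tuples over \<open>G\<close> to \<open>A\<close>, with pointwise multiplication.\<close>

definition cochain_group ::
  "('g, 'x) monoid_scheme \<Rightarrow> ('a, 'y) monoid_scheme \<Rightarrow> nat \<Rightarrow> ('g list \<Rightarrow> 'a) monoid" where
  "cochain_group G A n = product_group (tuples G n) (\<lambda>_. A)"

text \<open>The faces of \<open>(x\<^sub>1, \<dots>, x\<^sub>m)\<close>: face \<open>0\<close> drops \<open>x\<^sub>1\<close>, face \<open>m\<close> drops \<open>x\<^sub>m\<close>, and face \<open>i\<close> with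
  \<open>0 < i < m\<close> replaces the entries \<open>x\<^sub>i, x\<^sub>i\<^sub>+\<^sub>1\<close> (which have list indices \<open>i - 1\<close> and \<open>i\<close>) by their
  product.\<close>

definition tuple_face :: "('g, 'x) monoid_scheme \<Rightarrow> nat \<Rightarrow> 'g list \<Rightarrow> 'g list" where
  "tuple_face G i xs =
     (if i = 0 then tl xs
      else if i = length xs then butlast xs
      else take (i - 1) xs @ (xs ! (i - 1) \<otimes>\<^bsub>G\<^esub> xs ! i) # drop (Suc i) xs)"

text \<open>The differential from \<open>n\<close>-cochains to \<open>(n + 1)\<close>-cochains. As \<open>G\<close> acts trivially on \<open>A\<close>, the
  \<open>0\<close>-th face contributes without a twist.\<close>

definition cobound ::
  "('g, 'x) monoid_scheme \<Rightarrow> ('a, 'y) monoid_scheme \<Rightarrow> nat \<Rightarrow> ('g list \<Rightarrow> 'a) \<Rightarrow> 'g list \<Rightarrow> 'a" where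
  "cobound G A n f =
     (\<lambda>xs\<in>tuples G (Suc n).
        \<Otimes>\<^bsub>A\<^esub>i\<in>{..Suc n}. f (tuple_face G i xs) [^]\<^bsub>A\<^esub> ((-1) ^ i :: int))"

definition cocycles ::
  "('g, 'x) monoid_scheme \<Rightarrow> ('a, 'y) monoid_scheme \<Rightarrow> nat \<Rightarrow> ('g list \<Rightarrow> 'a) set" where
  "cocycles G A n = kernel (cochain_group G A n) (cochain_group G A (Suc n)) (cobound G A n)"

definition coboundaries ::
  "('g, 'x) monoid_scheme \<Rightarrow> ('a, 'y) monoid_scheme \<Rightarrow> nat \<Rightarrow> ('g list \<Rightarrow> 'a) set" where
  "coboundaries G A n =
     (case n of 0 \<Rightarrow> {\<one>\<^bsub>cochain_group G A 0\<^esub>}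
      | Suc m \<Rightarrow> cobound G A m ` carrier (cochain_group G A m))"

definition cohomology_group ::
  "nat \<Rightarrow> ('g, 'x) monoid_scheme \<Rightarrow> ('a, 'y) monoid_scheme \<Rightarrow> ('g list \<Rightarrow> 'a) set monoid" where
  "cohomology_group n G A =
     (cochain_group G A n)\<lparr>carrier := cocycles G A n\<rparr> Mod coboundaries G A n"

text \<open>The pullback of a cohomology class, which is a set of cocycles, along an automorphism \<open>\<alpha>\<close> of
  \<open>G\<close>. Since \<open>\<alpha>\<close> is bijective, pulling back all members of a class again gives a full class.\<close>

definition cohomology_pullback ::
  "nat \<Rightarrow> ('g, 'x) monoid_scheme \<Rightarrow> ('g \<Rightarrow> 'g) \<Rightarrow> ('g list \<Rightarrow> 'a) set \<Rightarrow> ('g list \<Rightarrow> 'a) set" where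
  "cohomology_pullback n G \<alpha> X = (\<lambda>f. \<lambda>xs\<in>tuples G n. f (map \<alpha> xs)) ` X"


section \<open>Exterior and symmetric algebras\<close>

text \<open>Words form a monoid under concatenation. Hence the type \<^typ>\<open>'w list \<Rightarrow>\<^sub>0 'f\<close> of finitely
  supported functions on words, with the convolution product of \<^theory>\<open>HOL-Library.Poly_Mapping\<close>, is
  the free associative unital \<open>'f\<close>-algebra on \<open>'w\<close>.\<close>

instantiation list :: (type) monoid_add
begin

definition zero_list :: "'a list" where "zero_list = []"

definition plus_list :: "'a list \<Rightarrow> 'a list \<Rightarrow> 'a list" where "plus_list xs ys = xs @ ys"

instance by standard (simp_all add: zero_list_def plus_list_def)

end

definition free_algebra :: "'w set \<Rightarrow> ('w list \<Rightarrow>\<^sub>0 'f::field) ring" where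
  "free_algebra B =
     \<lparr>carrier = {x. Poly_Mapping.keys x \<subseteq> lists B}, monoid.mult = (*), one = 1,
      ring.zero = 0, add = (+)\<rparr>"

definition free_gen :: "'w \<Rightarrow> 'w list \<Rightarrow>\<^sub>0 'f::field" where
  "free_gen w = Poly_Mapping.single [w] 1"

definition free_scalar :: "'f \<Rightarrow> 'w list \<Rightarrow>\<^sub>0 'f::field" where
  "free_scalar c = Poly_Mapping.single [] c"

text \<open>Dividing the free algebra on the set of all vectors of \<open>W\<close> by the following relations gives the
  tensor algebra of \<open>W\<close>. Vector spaces are records of type \<^typ>\<open>('f, 'w) module\<close>; only their fields
  \<^const>\<open>carrier\<close>, \<^const>\<open>add\<close>, \<^const>\<open>ring.zero\<close> and \<^const>\<open>module.smult\<close> are meaningful.\<close>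

definition tensor_relations :: "('f::field, 'w) module \<Rightarrow> ('w list \<Rightarrow>\<^sub>0 'f) set" where
  "tensor_relations W =
     {free_gen (a \<oplus>\<^bsub>W\<^esub> b) - free_gen a - free_gen b | a b. a \<in> carrier W \<and> b \<in> carrier W} \<union>
     {free_gen (c \<odot>\<^bsub>W\<^esub> a) - free_scalar c * free_gen a | c a. a \<in> carrier W}"

definition exterior_relations :: "('f::field, 'w) module \<Rightarrow> ('w list \<Rightarrow>\<^sub>0 'f) set" where
  "exterior_relations W =
     tensor_relations W \<union> {free_gen a * free_gen a | a. a \<in> carrier W}"

definition symmetric_relations :: "('f::field, 'w) module \<Rightarrow> ('w list \<Rightarrow>\<^sub>0 'f) set" where
  "symmetric_relations W =
     tensor_relations W \<union>
     {free_gen a * free_gen b - free_gen b * free_gen a | a b. a \<in> carrier W \<and> b \<in> carrier W}"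

definition exterior_algebra :: "('f::field, 'w) module \<Rightarrow> ('w list \<Rightarrow>\<^sub>0 'f) set ring" where
  "exterior_algebra W =
     free_algebra (carrier W) Quot Idl\<^bsub>free_algebra (carrier W)\<^esub> (exterior_relations W)"

definition symmetric_algebra :: "('f::field, 'w) module \<Rightarrow> ('w list \<Rightarrow>\<^sub>0 'f) set ring" where
  "symmetric_algebra W =
     free_algebra (carrier W) Quot Idl\<^bsub>free_algebra (carrier W)\<^esub> (symmetric_relations W)"

text \<open>The degree \<open>i\<close> part of such a quotient, as an additive group: the cosets represented by linear
  combinations of words of length \<open>i\<close>.\<close>

definition graded_component ::
  "nat \<Rightarrow> ('w list \<Rightarrow>\<^sub>0 'f::field) set ring \<Rightarrow> ('w list \<Rightarrow>\<^sub>0 'f) set monoid" where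
  "graded_component i R =
     (add_monoid R)\<lparr>carrier :=
        {X \<in> carrier R. \<exists>x\<in>X. \<forall>u\<in>Poly_Mapping.keys x. length u = i}\<rparr>"

definition exterior_power ::
  "nat \<Rightarrow> ('f::field, 'w) module \<Rightarrow> ('w list \<Rightarrow>\<^sub>0 'f) set monoid" where
  "exterior_power i W = graded_component i (exterior_algebra W)"

definition symmetric_power ::
  "nat \<Rightarrow> ('f::field, 'w) module \<Rightarrow> ('w list \<Rightarrow>\<^sub>0 'f) set monoid" where
  "symmetric_power i W = graded_component i (symmetric_algebra W)"

text \<open>The endomorphism of the free algebra induced by a map \<open>h\<close> of the generators, and the map it
  induces on cosets when \<open>h\<close> is a linear automorphism (so that the image of a coset is a full coset).\<close>

definition free_algebra_map :: "('w \<Rightarrow> 'w) \<Rightarrow> ('w list \<Rightarrow>\<^sub>0 'f::field) \<Rightarrow> ('w list \<Rightarrow>\<^sub>0 'f)" where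
  "free_algebra_map h x =
     (\<Sum>u\<in>Poly_Mapping.keys x. Poly_Mapping.single (map h u) (Poly_Mapping.lookup x u))"

definition coset_map ::
  "('w \<Rightarrow> 'w) \<Rightarrow> ('w list \<Rightarrow>\<^sub>0 'f::field) set \<Rightarrow> ('w list \<Rightarrow>\<^sub>0 'f) set" where
  "coset_map h X = free_algebra_map h ` X"


section \<open>Vector spaces over the prime field and their general linear groups\<close>

definition general_linear_group :: "('f::field ^ 'n ^ 'n) monoid" where
  "general_linear_group = \<lparr>carrier = {A. invertible A}, monoid.mult = (**), one = mat 1\<rparr>"

definition additive_group :: "'v::ab_group_add monoid" where
  "additive_group = \<lparr>carrier = UNIV, monoid.mult = (+), one = 0\<rparr>"

definition multiplicative_group :: "'k::field monoid" where
  "multiplicative_group = \<lparr>carrier = UNIV - {0}, monoid.mult = (*), one = 1\<rparr>"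

definition dual_space :: "('f::field, 'f ^ 'n \<Rightarrow> 'f) module" where
  "dual_space =
     \<lparr>carrier = {\<phi>. Vector_Spaces.linear (*s) (*) \<phi>}, monoid.mult = undefined, one = undefined,
      ring.zero = (\<lambda>_. 0), add = (\<lambda>\<phi> \<psi> v. \<phi> v + \<psi> v), module.smult = (\<lambda>c \<phi> v. c * \<phi> v)\<rparr>"

text \<open>In a type \<^typ>\<open>'p mod_ring ^ 'n\<close> with \<^term>\<open>CARD('p)\<close> prime, the type variables stand for the prime \<open>p\<close>
  and the dimension \<open>n\<close> (positive, as types are nonempty): it is the space of \<open>n\<close>-vectors over the
  field with \<open>p\<close> elements, and its additive group is elementary abelian of order \<open>p\<^sup>n\<close>.\<close>

text \<open>The left actions of a matrix \<open>g\<close> on functionals, on cohomology and on the two powers of the dual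
  space are all given by transport along \<open>g\<close>, that is, by pulling back along the inverse of \<open>g\<close>.\<close>

definition dual_action :: "'f::field ^ 'n ^ 'n \<Rightarrow> ('f ^ 'n \<Rightarrow> 'f) \<Rightarrow> ('f ^ 'n \<Rightarrow> 'f)" where
  "dual_action g \<phi> = (\<lambda>v. \<phi> (matrix_inv g *v v))"

definition cohomology_action ::
  "nat \<Rightarrow> 'f::field ^ 'n ^ 'n \<Rightarrow> (('f ^ 'n) list \<Rightarrow> 'a) set \<Rightarrow> (('f ^ 'n) list \<Rightarrow> 'a) set" where
  "cohomology_action n g = cohomology_pullback n additive_group ((*v) (matrix_inv g))"

definition dual_power_action ::
  "'f::field ^ 'n ^ 'n \<Rightarrow> (('f ^ 'n \<Rightarrow> 'f) list \<Rightarrow>\<^sub>0 'f) set \<Rightarrow> (('f ^ 'n \<Rightarrow> 'f) list \<Rightarrow>\<^sub>0 'f) set" where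
  "dual_power_action g = coset_map (dual_action g)"

end

theory Submission
  imports Defs
begin

text \<open>Fix a primitive \<open>p\<close>-th root of unity, that is, an embedding \<open>e\<close> of the prime field into the
  multiplicative group of \<open>k\<close>, and let \<open>\<beta>(b)(x, y)\<close> be the carry in the addition of the residues of
  \<open>b(x)\<close> and \<open>b(y)\<close> (the Bockstein of \<open>b\<close>). The isomorphism sends \<open>a \<and> b \<and> c\<close> to the class of
  \<open>e(a(x) b(y) c(z))\<close> and \<open>a b\<close> to the class of \<open>e(\<beta>(a)(x, y) b(z))\<close>. Both assignments are natural in
  the vector space; they respect the relations because \<open>a(x) a(y)\<close> is the coboundary of
  \<open>- a(x)\<^sup>2 / 2\<close> and because \<open>\<beta>(a) b\<close> and \<open>a \<beta>(b)\<close> become cohomologous over \<open>k\<close>, as \<open>e\<close> extends to the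
  roots of unity of order \<open>p\<^sup>2\<close>.

  Injectivity follows from two invariants of the class of \<open>f\<close>: the alternating sum of \<open>f\<close> over the
  permutations of its arguments, which detects the exterior part and kills the symmetric one, and
  \<open>\<Sum>\<^sub>t f(v, t v, v)\<close> (the restriction to the cyclic group generated by \<open>v\<close>), a quadratic form in \<open>v\<close>
  which detects the symmetric part and kills the exterior one. Surjectivity is proved by splitting off
  one coordinate at a time with an explicit Eilenberg-Zilber homotopy; this reduces everything to
  cocycles of the cyclic group and to 2-cocycles with values in the prime field.\<close>

section \<open>Cocycles in additive notation\<close>

text \<open>The coefficient group stays arbitrary as long as possible, since the analysis of the
  cyclic group is applied both to the prime field and to the units of \<open>k\<close>. Algebraic
  closedness supplies the root of unity behind \<open>e\<close> and divisibility by
  \<open>p\<close>; divisibility turns 2-cocycles of the cyclic group with values in the units into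
  coboundaries and yields the extension of \<open>e\<close>. Oddness enters twice: through the
  factor 1/2, and through the vanishing of the sum of all elements of the prime field, which makes
  the quadratic form kill the exterior part.

  The map runs from the algebras to cohomology because there it can be defined on free words and
  tested on the generating relations. No basis of the two powers is presupposed: sorted words in the
  coordinates only have to span modulo the ideals, and the invariants, evaluated at unit vectors and
  sums of two of them, force the coefficients to vanish. The choice of \<open>e\<close> does no harm
  to equivariance, as matrices act on the arguments only.\<close>

definition delta1 :: "('v::ab_group_add \<Rightarrow> 'a::ab_group_add) \<Rightarrow> 'v \<Rightarrow> 'v \<Rightarrow> 'a" where
  "delta1 w x y = w y - w (x + y) + w x"

definition delta2 :: "('v::ab_group_add \<Rightarrow> 'v \<Rightarrow> 'a::ab_group_add) \<Rightarrow> 'v \<Rightarrow> 'v \<Rightarrow> 'v \<Rightarrow> 'a" where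
  "delta2 h x y z = h y z - h (x + y) z + h x (y + z) - h x y"

definition delta3 ::
  "('v::ab_group_add \<Rightarrow> 'v \<Rightarrow> 'v \<Rightarrow> 'a::ab_group_add) \<Rightarrow> 'v \<Rightarrow> 'v \<Rightarrow> 'v \<Rightarrow> 'v \<Rightarrow> 'a" where
  "delta3 f x y z t = f y z t - f (x + y) z t + f x (y + z) t - f x y (z + t) + f x y z"

definition cocycle2 :: "('v::ab_group_add \<Rightarrow> 'v \<Rightarrow> 'a::ab_group_add) \<Rightarrow> bool" where
  "cocycle2 c \<longleftrightarrow> (\<forall>x y z. delta2 c x y z = 0)"

definition cocycle3 :: "('v::ab_group_add \<Rightarrow> 'v \<Rightarrow> 'v \<Rightarrow> 'a::ab_group_add) \<Rightarrow> bool" where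
  "cocycle3 f \<longleftrightarrow> (\<forall>x y z t. delta3 f x y z t = 0)"

lemma cocycle2D: "cocycle2 c \<Longrightarrow> delta2 c x y z = 0"
  by (simp add: cocycle2_def)

lemma cocycle3D: "cocycle3 f \<Longrightarrow> delta3 f x y z t = 0"
  by (simp add: cocycle3_def)

lemma cocycle2_delta1: "cocycle2 (delta1 w)"
  by (simp add: cocycle2_def delta1_def delta2_def algebra_simps)

lemma cocycle3_delta2: "cocycle3 (delta2 h)"
  by (simp add: cocycle3_def delta2_def delta3_def algebra_simps)

lemma delta1_add: "delta1 (\<lambda>x. v x + w x) x y = delta1 v x y + delta1 w x y"
  and delta2_add: "delta2 (\<lambda>x y. c x y + d x y) x y z = delta2 c x y z + delta2 d x y z"
  and delta2_diff: "delta2 (\<lambda>x y. c x y - d x y) x y z = delta2 c x y z - delta2 d x y z"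
  and delta3_add: "delta3 (\<lambda>x y z. f x y z + g x y z) x y z t = delta3 f x y z t + delta3 g x y z t"
  and delta3_diff: "delta3 (\<lambda>x y z. f x y z - g x y z) x y z t = delta3 f x y z t - delta3 g x y z t"
  by (simp_all add: delta1_def delta2_def delta3_def algebra_simps)

lemma cocycle2_add: "cocycle2 c \<Longrightarrow> cocycle2 d \<Longrightarrow> cocycle2 (\<lambda>x y. c x y + d x y)"
  by (simp add: cocycle2_def delta2_add)

lemma cocycle2_diff: "cocycle2 c \<Longrightarrow> cocycle2 d \<Longrightarrow> cocycle2 (\<lambda>x y. c x y - d x y)"
  by (simp add: cocycle2_def delta2_diff)

lemma cocycle3_diff: "cocycle3 f \<Longrightarrow> cocycle3 g \<Longrightarrow> cocycle3 (\<lambda>x y z. f x y z - g x y z)"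
  by (simp add: cocycle3_def delta3_diff)

lemma cocycle3_add: "cocycle3 f \<Longrightarrow> cocycle3 g \<Longrightarrow> cocycle3 (\<lambda>x y z. f x y z + g x y z)"
  by (simp add: cocycle3_def delta3_add)

text \<open>Signed sums over the (1,1)-, (2,1)- and (1,2)-shuffles. They are the mixed Kuenneth
  components of the pullback of a cocycle along addition: the first arguments lie in one copy of the
  group, the last ones in the other.\<close>

definition shuffle11 :: "('v \<Rightarrow> 'v \<Rightarrow> 'a::ab_group_add) \<Rightarrow> 'v \<Rightarrow> 'v \<Rightarrow> 'a" where
  "shuffle11 c x y = c x y - c y x"

definition shuffle21 :: "('v \<Rightarrow> 'v \<Rightarrow> 'v \<Rightarrow> 'a::ab_group_add) \<Rightarrow> 'v \<Rightarrow> 'v \<Rightarrow> 'v \<Rightarrow> 'a" where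
  "shuffle21 f x y z = f x y z - f x z y + f z x y"

definition shuffle12 :: "('v \<Rightarrow> 'v \<Rightarrow> 'v \<Rightarrow> 'a::ab_group_add) \<Rightarrow> 'v \<Rightarrow> 'v \<Rightarrow> 'v \<Rightarrow> 'a" where
  "shuffle12 f x y z = f x y z - f y x z + f y z x"

text \<open>The Eilenberg-Zilber homotopy for a product of two copies of the group, pulled back along the
  addition map. The combination of differentials in the proof of \<open>cocycle3_add_arg\<close> was found by linear
  algebra over the shuffles of the arguments.\<close>

definition ez_homotopy ::
  "('v::ab_group_add \<Rightarrow> 'v \<Rightarrow> 'v \<Rightarrow> 'a::ab_group_add) \<Rightarrow> 'v \<Rightarrow> 'v \<Rightarrow> 'v \<Rightarrow> 'v \<Rightarrow> 'a" where
  "ez_homotopy f x x' y y' = f x y' y - f x' x (y + y') + f x' y' (x + y) - f y' x y"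

text \<open>Eilenberg-Zilber in degree 2: the bracket is the coboundary, on the product of two
  copies of the group, of the 1-cochain sending \<open>(x, x')\<close> to
  \<open>c x' x\<close>.\<close>

lemma cocycle2_add_arg:
  assumes "cocycle2 c"
  shows "c (x + x') (y + y') =
    c x y + c x' y' + shuffle11 c x y' - (c y' y - c (x' + y') (x + y) + c x' x)"
proof -
  note D = cocycle2D[OF assms]
  have "c (x + x') (y + y') -
      (c x y + c x' y' + shuffle11 c x y' - (c y' y - c (x' + y') (x + y) + c x' x)) =
     delta2 c x y' y - delta2 c x' x (y + y') + delta2 c x' y' (x + y) - delta2 c y' x y"
    by (simp add: delta2_def shuffle11_def algebra_simps)
  then show ?thesis by (simp add: D)
qed

lemma cocycle3_add_arg:
  assumes "cocycle3 f"
  shows "f (x + x') (y + y') (z + z') =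
    f x y z + f x' y' z' + shuffle21 f x y z' + shuffle12 f x y' z' +
    (ez_homotopy f y y' z z' - ez_homotopy f (x + y) (x' + y') z z'
      + ez_homotopy f x x' (y + z) (y' + z') - ez_homotopy f x x' y y')"
proof -
  note D = cocycle3D[OF assms]
  have "f (x + x') (y + y') (z + z') - (f x y z + f x' y' z' + shuffle21 f x y z' + shuffle12 f x y' z' +
    (ez_homotopy f y y' z z' - ez_homotopy f (x + y) (x' + y') z z'
      + ez_homotopy f x x' (y + z) (y' + z') - ez_homotopy f x x' y y')) =
     - delta3 f x y z' z + delta3 f x y' y (z + z') - delta3 f x y' z' (y+z) + delta3 f x z' y z
     - delta3 f x' x (y+y') (z+z') + delta3 f x' y' (x+y) (z+z') - delta3 f x' y' z' (x+y+z)
     - delta3 f y' x y (z+z') + delta3 f y' x z' (y+z) - delta3 f y' z' x (y+z) - delta3 f z' x y z"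
    by (simp add: delta3_def ez_homotopy_def shuffle21_def shuffle12_def algebra_simps)
  then show ?thesis by (simp add: D)
qed

text \<open>Signed sum of \<open>delta3 f\<close> over the ways to insert \<open>a\<close> among
  \<open>b, c, d\<close>. The terms in which \<open>a\<close> is merged with a neighbour cancel
  because addition commutes.\<close>

lemma shuffle12_cocycle:
  assumes "cocycle3 f"
  shows "cocycle2 (shuffle12 f a)"
proof -
  note D = cocycle3D[OF assms]
  have "delta2 (shuffle12 f a) b c d =
     - delta3 f a b c d + delta3 f b a c d - delta3 f b c a d + delta3 f b c d a" for b c d
    by (simp add: delta3_def delta2_def shuffle12_def algebra_simps)
  then show ?thesis by (simp add: D cocycle2_def)
qed

lemma shuffle21_cocycle:
  assumes "cocycle3 f"
  shows "cocycle2 (\<lambda>a b. shuffle21 f a b d)"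
proof -
  note D = cocycle3D[OF assms]
  have "delta2 (\<lambda>a b. shuffle21 f a b d) a b c =
     delta3 f a b c d - delta3 f a b d c + delta3 f a d b c - delta3 f d a b c" for a b c
    by (simp add: delta3_def delta2_def shuffle21_def algebra_simps)
  then show ?thesis by (simp add: D cocycle2_def)
qed

text \<open>Signed sum over the six (2,2)-shuffles. It couples the two mixed components: what one
  lacks in additivity is a coboundary of the other, so a trivialisation of \<open>shuffle12\<close>
  can be used to correct \<open>shuffle21\<close>.\<close>

lemma shuffle21_add:
  assumes "cocycle3 f"
  shows "shuffle21 f a b (c + d) = shuffle21 f a b c + shuffle21 f a b d
     + delta1 (\<lambda>a. shuffle12 f a c d) a b"
proof -
  note D = cocycle3D[OF assms]
  have "shuffle21 f a b (c + d) - (shuffle21 f a b c + shuffle21 f a b d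
     + delta1 (\<lambda>a. shuffle12 f a c d) a b) =
     - (delta3 f a b c d - delta3 f a c b d + delta3 f a c d b + delta3 f c a b d
     - delta3 f c a d b + delta3 f c d a b)"
    by (simp add: delta3_def delta1_def shuffle12_def shuffle21_def algebra_simps)
  then show ?thesis by (simp add: D)
qed

text \<open>\<open>shuffle11 c\<close> is the commutator pairing of the central extension defined by
  \<open>c\<close>; its additivity is the signed sum over the (1,2)-shuffles.\<close>

lemma shuffle11_add_right:
  assumes "cocycle2 c"
  shows "shuffle11 c x (y + z) = shuffle11 c x y + shuffle11 c x z"
proof -
  note D = cocycle2D[OF assms]
  have "shuffle11 c x (y + z) - (shuffle11 c x y + shuffle11 c x z) =
     delta2 c x y z - delta2 c y x z + delta2 c y z x"
    by (simp add: delta2_def shuffle11_def algebra_simps)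
  then show ?thesis by (simp add: D)
qed

lemma shuffle11_add_left:
  assumes "cocycle2 c"
  shows "shuffle11 c (x + y) z = shuffle11 c x z + shuffle11 c y z"
  using shuffle11_add_right[OF assms, of z x y] by (simp add: shuffle11_def algebra_simps)

section \<open>Cocycles on the cyclic group of order p\<close>

abbreviation residue :: "'p::prime_card mod_ring \<Rightarrow> int" where
  "residue \<equiv> to_int_mod_ring"

lemma residue_bounds: "0 \<le> residue (x :: 'p::prime_card mod_ring)" "residue x < int CARD('p)"
  using range_to_int_mod_ring[where 'a='p] by auto

lemma of_int_residue [simp]: "of_int (residue x) = (x :: 'p::prime_card mod_ring)"
  by (simp add: of_int_of_int_mod_ring)

lemma residue_of_nat: "n < CARD('p) \<Longrightarrow> residue (of_nat n :: 'p::prime_card mod_ring) = int n"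
  by (metis of_int_of_int_mod_ring of_int_of_nat_eq of_nat_0_le_iff of_nat_less_iff to_int_mod_ring_of_int_mod_ring)

lemma residue_0 [simp]: "residue (0 :: 'p::prime_card mod_ring) = 0"
  using residue_of_nat[of 0, where 'p='p] by simp

lemma residue_1 [simp]: "residue (1 :: 'p::prime_card mod_ring) = 1"
  using residue_of_nat[of 1, where 'p='p] prime_gt_1_nat[OF prime_card[where 'a='p]] by simp

lemma residue_add: "residue (x + y :: 'p::prime_card mod_ring) = (residue x + residue y) mod int CARD('p)"
  by (rule to_int_mod_ring_add)

lemma residue_minus_1: "residue (- 1 :: 'p::prime_card mod_ring) = int CARD('p) - 1"
proof -
  have "(- 1 :: 'p mod_ring) = of_nat (CARD('p) - 1)"
    using prime_gt_1_nat[OF prime_card[where 'a='p]] by (simp add: of_nat_diff)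
  then show ?thesis
    using residue_of_nat[of "CARD('p) - 1", where 'p='p] prime_gt_1_nat[OF prime_card[where 'a='p]]
    by (simp add: of_nat_diff)
qed

lemma mod_ring_induct:
  fixes x :: "'p::prime_card mod_ring"
  assumes "P 0" and "\<And>n. Suc n < CARD('p) \<Longrightarrow> P (of_nat n) \<Longrightarrow> P (of_nat (Suc n))"
  shows "P x"
proof -
  obtain i where i: "i < CARD('p)" "x = of_nat i"
    using surj_of_nat_mod_ring by blast
  have "i < CARD('p) \<Longrightarrow> P (of_nat i)" for i
    by (induction i) (use assms in auto)
  then show ?thesis using i by blast
qed

lemma bij_betw_of_nat_mod_ring: "bij_betw of_nat {..<CARD('p)} (UNIV :: 'p::prime_card mod_ring set)"
proof (rule bij_betw_imageI)
  show "inj_on (of_nat :: nat \<Rightarrow> 'p mod_ring) {..<CARD('p)}"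
  proof (rule inj_onI)
    fix i j assume ij: "i \<in> {..<CARD('p)}" "j \<in> {..<CARD('p)}"
      and eq: "of_nat i = (of_nat j :: 'p mod_ring)"
    have "int i = residue (of_nat i :: 'p mod_ring)"
      using ij residue_of_nat[of i, where 'p='p] by simp
    also have "\<dots> = int j"
      unfolding eq using ij residue_of_nat[of j, where 'p='p] by simp
    finally show "i = j" by simp
  qed
  show "of_nat ` {..<CARD('p)} = (UNIV :: 'p mod_ring set)"
    using surj_of_nat_mod_ring by (auto simp: image_iff) 
qed

lemma sum_of_nat_mod_ring: "(\<Sum>i<CARD('p). F (of_nat i)) = (\<Sum>b\<in>(UNIV :: 'p::prime_card mod_ring set). F b)"
  by (rule sum.reindex_bij_betw[OF bij_betw_of_nat_mod_ring])

lemma sum_mod_ring_last: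
  fixes F :: "'p::prime_card mod_ring \<Rightarrow> 'a::ab_group_add"
  shows "(\<Sum>b\<in>UNIV. F b) = F (- 1) + (\<Sum>i<nat (residue (- 1 :: 'p mod_ring)). F (of_nat i))"
proof -
  obtain m where m: "CARD('p) = Suc m"
    using prime_gt_0_nat[OF prime_card[where 'a='p]] by (cases "CARD('p)") simp_all
  then have "(of_nat (Suc m) :: 'p mod_ring) = 0"
    using of_nat_card_eq_0[where 'a='p] by (simp only: m)
  then have "(of_nat m :: 'p mod_ring) = - 1"
    by (metis add.commute add_eq_0_iff2 of_nat_Suc)
  then show ?thesis
    unfolding sum_of_nat_mod_ring[of F, symmetric] residue_minus_1 unfolding m by (simp add: add.commute)
qed

lemma sum_UNIV_add:
  fixes c :: "'v::{finite,ab_group_add}"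
  shows "(\<Sum>b\<in>UNIV. F (b + c)) = (\<Sum>b\<in>UNIV. F b)"
  by (rule sum.reindex_bij_witness[of _ "\<lambda>b. b - c" "\<lambda>b. b + c"]) auto

section \<open>The carry cocycle and the cocycles of the cyclic group\<close>

definition carry :: "'p::prime_card mod_ring \<Rightarrow> 'p mod_ring \<Rightarrow> 'p mod_ring" where
  "carry x y = (if residue x + residue y < int CARD('p) then 0 else 1)"

lemma carry_residue:
  "residue x + residue y - residue (x + y :: 'p::prime_card mod_ring) =
     int CARD('p) * residue (carry x y)"
proof -
  have "(residue x + residue y) mod int CARD('p) = residue x + residue y - int CARD('p)"
    if "residue x + residue y \<ge> int CARD('p)"
    using that residue_bounds[of x] residue_bounds[of y]
    by (smt (verit) minus_mod_self2 mod_pos_pos_trivial)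
  then show ?thesis
    using residue_bounds[of x] residue_bounds[of y] by (auto simp: carry_def residue_add)
qed

lemma carry_commute: "carry x y = carry y x"
  by (simp add: carry_def add.commute)

text \<open>Over the integers \<open>p\<close> times the carry is the coboundary of
  \<open>residue\<close>, so the identity holds after multiplication by \<open>p\<close>; the factor
  is cancelled there, before reducing modulo \<open>p\<close>.\<close>

lemma cocycle2_carry: "cocycle2 (carry :: 'p::prime_card mod_ring \<Rightarrow> _)"
proof -
  have "int CARD('p) * (residue (carry y z) - residue (carry (x + y) z) + residue (carry x (y + z))
     - residue (carry x y)) = 0" for x y z :: "'p mod_ring"
    by (simp only: right_diff_distrib distrib_left carry_residue[symmetric]) (simp add: add.assoc)
  then have "residue (carry y z) - residue (carry (x + y) z) + residue (carry x (y + z))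
     - residue (carry x y) = 0" for x y z :: "'p mod_ring"
    by simp
  then have "of_int (residue (carry y z) - residue (carry (x + y) z) + residue (carry x (y + z))
     - residue (carry x y)) = (0 :: 'p mod_ring)" for x y z :: "'p mod_ring"
    by (metis of_int_0)
  then show ?thesis
    by (simp add: cocycle2_def delta2_def)
qed

lemma residue_Suc: "y \<noteq> - 1 \<Longrightarrow> residue (1 + y :: 'p::prime_card mod_ring) = residue y + 1"
proof -
  assume "y \<noteq> - 1"
  then have "residue y \<noteq> int CARD('p) - 1"
    by (metis of_int_residue residue_minus_1)
  then show ?thesis
    using residue_bounds[of y] by (simp add: residue_add)
qed

lemma of_nat_mod_ring_neq_minus_1: "Suc n < CARD('p) \<Longrightarrow> of_nat n \<noteq> (- 1 :: 'p::prime_card mod_ring)"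
  using residue_of_nat[of n, where 'p='p] residue_minus_1[where 'p='p] by auto

text \<open>Raising the first summand by one creates a carry exactly when the old sum has the top
  residue, that of \<open>- 1\<close>. The value \<open>N\<close> is left general so that the
  induction steps in degrees 2 and 3 can share this.\<close>

lemma carry_Suc:
  fixes c :: "'p::prime_card mod_ring"
  assumes "Suc n < CARD('p)"
  shows "(if carry (1 + of_nat n) c = 0 then 0 else N :: 'a::comm_monoid_add) =
    (if carry (of_nat n) c = 0 then 0 else N) + (if of_nat n + c = - 1 then N else 0)"
proof -
  have 1: "residue (1 + of_nat n :: 'p mod_ring) = int n + 1" "residue (of_nat n :: 'p mod_ring) = int n"
    using assms residue_of_nat[of n, where 'p='p] residue_of_nat[of "Suc n", where 'p='p] by simp_all
  have "of_nat n + c = - 1 \<longleftrightarrow> (int n + residue c) mod int CARD('p) = int CARD('p) - 1"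
    by (metis 1(2) of_int_residue residue_add residue_minus_1)
  also have "\<dots> \<longleftrightarrow> int n + residue c = int CARD('p) - 1"
  proof (cases "int n + residue c < int CARD('p)")
    case False
    then have "(int n + residue c) mod int CARD('p) = int n + residue c - int CARD('p)"
      using assms residue_bounds[of c] by (smt (verit) minus_mod_self2 mod_pos_pos_trivial of_nat_less_iff of_nat_Suc)
    then show ?thesis using False assms residue_bounds[of c] by auto
  qed (use residue_bounds[of c] in simp)
  finally show ?thesis
    by (auto simp: carry_def 1)
qed

text \<open>Once \<open>g 0 y\<close> vanishes, the cocycle identity at \<open>(1, n, y)\<close> is
  a recursion that determines \<open>g\<close> from \<open>g 1\<close>. The partial sums in
  \<open>h\<close> telescope \<open>g 1\<close> away except at \<open>- 1\<close>, where the total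
  \<open>N\<close> is left over. The constant \<open>k\<close> is its own coboundary, hence
  reappears inside the final 1-cochain.\<close>

lemma cyclic_cocycle2:
  fixes f :: "'p::prime_card mod_ring \<Rightarrow> 'p mod_ring \<Rightarrow> 'a::ab_group_add"
  assumes f: "cocycle2 f"
  obtains h N where "\<And>x y. f x y = delta1 h x y + (if carry x y = 0 then 0 else N)"
proof -
  define k where "k = f 0 0"
  define f' where "f' = (\<lambda>x y. f x y - k)"
  have f'c: "cocycle2 f'"
    using f by (simp add: cocycle2_def delta2_def f'_def algebra_simps)
  have f'0: "f' 0 y = 0" and f'10: "f' 1 0 = 0" for y
    using cocycle2D[OF f, of 0 0 y] cocycle2D[OF f, of 1 0 0] by (simp_all add: delta2_def f'_def k_def)
  define h where "h = (\<lambda>y :: 'p mod_ring. - (\<Sum>i<nat (residue y). f' 1 (of_nat i)))"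
  define N where "N = (\<Sum>b\<in>UNIV. f' 1 b)"
  define g where "g = (\<lambda>x y. f' x y - delta1 h x y)"
  have g: "cocycle2 g"
    unfolding g_def by (intro cocycle2_diff f'c cocycle2_delta1)
  have h01: "h 0 = 0" "h 1 = 0"
    by (simp_all add: h_def f'10)
  have g0: "g 0 y = 0" for y
    by (simp add: g_def delta1_def f'0 h01)
  have g1: "g 1 y = (if y = - 1 then N else 0)" for y
  proof (cases "y = - 1")
    case True
    have "N = f' 1 (-1) - h (-1)"
      by (simp add: N_def h_def sum_mod_ring_last)
    then show ?thesis
      by (simp add: True g_def delta1_def h01)
  next
    case False
    have "nat (residue (1 + y)) = Suc (nat (residue y))"
      using residue_Suc[OF False] residue_bounds[of y] by simp
    then show ?thesis
      using False residue_bounds(1)[of y] by (simp add: g_def delta1_def h01 h_def f'10)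
  qed
  have "g x y = (if carry x y = 0 then 0 else N)" for x y
  proof (induction x rule: mod_ring_induct)
    case 1
    then show ?case using residue_bounds[of y] by (simp add: g0 carry_def)
  next
    case (2 n)
    have "g (1 + of_nat n) y = g (of_nat n) y + g 1 (of_nat n + y) - g 1 (of_nat n)"
      using cocycle2D[OF g, of 1 "of_nat n" y] by (simp add: delta2_def algebra_simps)
    then show ?case
      using 2 carry_Suc[OF 2(1), of y N] of_nat_mod_ring_neq_minus_1[OF 2(1)] by (simp add: g1)
  qed
  then have "f x y = delta1 (\<lambda>x. h x + k) x y + (if carry x y = 0 then 0 else N)" for x y
    by (simp add: g_def f'_def delta1_def algebra_simps)
  then show ?thesis using that by blast
qed

text \<open>The argument of degree 2 with the last argument as a parameter. The leftover
  \<open>N\<close> is now a homomorphism, so the cocycle becomes a cup product of the carry with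
  \<open>N\<close>.\<close>

lemma cyclic_cocycle3:
  fixes f :: "'p::prime_card mod_ring \<Rightarrow> 'p mod_ring \<Rightarrow> 'p mod_ring \<Rightarrow> 'a::ab_group_add"
  assumes f: "cocycle3 f"
  obtains h N where "\<And>x y z. f x y z = delta2 h x y z + (if carry x y = 0 then 0 else N z)"
    "\<And>x y. N (x + y) = N x + N y"
proof -
  define k where "k = (\<lambda>(x :: 'p mod_ring) (y :: 'p mod_ring). f 0 0 y)"
  define f' where "f' = (\<lambda>x y z. f x y z - delta2 k x y z)"
  have f': "cocycle3 f'"
    unfolding f'_def by (intro cocycle3_diff f cocycle3_delta2)
  have f'0: "f' 0 y z = 0" for y z
    using cocycle3D[OF f, of 0 0 y z] by (simp add: delta2_def delta3_def f'_def k_def algebra_simps)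
  have f'10: "f' 1 0 (y + z) = f' 1 0 y" for y z
    using cocycle3D[OF f', of 1 0 y z] by (simp add: delta3_def f'0)
  define h where "h = (\<lambda>(y :: 'p mod_ring) z. - (\<Sum>i<nat (residue y). f' 1 (of_nat i) z))"
  define N where "N = (\<lambda>z. \<Sum>b\<in>UNIV. f' 1 b z)"
  define g where "g = (\<lambda>x y z. f' x y z - delta2 h x y z)"
  have g: "cocycle3 g"
    unfolding g_def by (intro cocycle3_diff f' cocycle3_delta2)
  \<comment> \<open>\<open>f' 1 0\<close> is constant by \<open>f'10\<close>, so the two terms of
    \<open>delta2 h\<close> that involve \<open>h 1\<close> cancel; this takes the place of
    \<open>h 1 = 0\<close> in degree 2.\<close>
  have h0: "h 0 y = 0" and h1: "h 1 (y + z) = h 1 y" for y z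
    by (simp_all add: h_def f'10)
  have g0: "g 0 y z = 0" for y z
    by (simp add: g_def delta2_def f'0 h0)
  have g1: "g 1 y z = (if y = - 1 then N z else 0)" for y z
  proof (cases "y = - 1")
    case True
    have "N z = f' 1 (-1) z - h (-1) z"
      by (simp add: N_def h_def sum_mod_ring_last[of "\<lambda>b. f' 1 b z"])
    then show ?thesis
      by (simp add: True g_def delta2_def h0 h1)
  next
    case False
    have "nat (residue (1 + y)) = Suc (nat (residue y))"
      using residue_Suc[OF False] residue_bounds[of y] by simp
    then have "h (1 + y) z = h y z - f' 1 y z"
      using residue_bounds(1)[of y] by (simp add: h_def)
    then show ?thesis
      using False by (simp add: g_def delta2_def h1)
  qed
  have gN: "g x y z = (if carry x y = 0 then 0 else N z)" for x y z
  proof (induction x rule: mod_ring_induct)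
    case 1
    then show ?case using residue_bounds[of y] by (simp add: g0 carry_def)
  next
    case (2 n)
    have "g (1 + of_nat n) y z =
        g (of_nat n) y z + g 1 (of_nat n + y) z - g 1 (of_nat n) (y + z) + g 1 (of_nat n) y"
      using cocycle3D[OF g, of 1 "of_nat n" y z] by (simp add: delta3_def algebra_simps)
    then show ?case
      using 2 carry_Suc[OF 2(1), of y "N z"] of_nat_mod_ring_neq_minus_1[OF 2(1)] by (simp add: g1)
  qed
  have fN: "f x y z = delta2 (\<lambda>x y. h x y + k x y) x y z + (if carry x y = 0 then 0 else N z)" for x y z
    using gN[of x y z] by (simp add: g_def f'_def delta2_add algebra_simps)
  have "N (y + z) = N y + N z" for y z
  proof -
    \<comment> \<open>Summed over all \<open>b\<close>, the first two terms of the identity differ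
      by a shift of \<open>b\<close> and cancel; the other three are values of
      \<open>N\<close>.\<close>
    have "0 = (\<Sum>b\<in>UNIV. delta3 f' 1 b y z)"
      by (simp add: cocycle3D[OF f'])
    also have "\<dots> = (\<Sum>b\<in>UNIV. f' b y z) - (\<Sum>b\<in>UNIV. f' (b + 1) y z)
        + (\<Sum>b\<in>UNIV. f' 1 (b + y) z) - N (y + z) + N y"
      by (simp add: delta3_def sum.distrib sum_subtractf N_def add.commute[of 1])
    finally show ?thesis
      unfolding sum_UNIV_add[of "\<lambda>b. f' 1 b z" y] sum_UNIV_add[of "\<lambda>b. f' b y z" 1]
      by (simp add: N_def algebra_simps)
  qed
  then show ?thesis using that fN by blast
qed

section \<open>Generators of the cocycles on an elementary abelian group\<close>

lemma additive_mod_ring: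
  fixes N :: "'p::prime_card mod_ring \<Rightarrow> 'p mod_ring"
  assumes "additive N"
  shows "N z = N 1 * z"
proof (induction z rule: mod_ring_induct)
  case 1
  then show ?case using additive.zero[OF assms] by simp
next
  case (2 n)
  then show ?case using additive.add[OF assms, of 1 "of_nat n"] by (simp add: algebra_simps)
qed

definition proj :: "'n set \<Rightarrow> 'f::comm_ring_1 ^ 'n \<Rightarrow> 'f ^ 'n" where
  "proj S x = (\<chi> i. if i \<in> S then x $ i else 0)"

lemma proj_empty: "proj {} x = 0"
  by (simp add: proj_def vec_eq_iff)

lemma proj_UNIV: "proj UNIV x = x"
  by (simp add: proj_def)

lemma proj_insert: "i \<notin> S \<Longrightarrow> proj (insert i S) x = proj S x + x $ i *s axis i 1"
  by (auto simp: proj_def vec_eq_iff axis_def)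

lemma proj_add: "proj S (x + y) = proj S x + proj S y"
  by (simp add: proj_def vec_eq_iff)

lemma additive_nth: "additive (\<lambda>x. x $ i)"
  by (simp add: additive_def)

lemma additive_scale_nth: "additive (\<lambda>x :: 'f::comm_ring_1 ^ 'n. c * x $ i)"
  by (simp add: additive_def algebra_simps)

text \<open>A predicate instead of a formula with coefficients: induction over it carries a
  decomposition in degree 2 over to degree 3. The scalar \<open>n\<close> sits in the carry clause
  because no functional is there to absorb it.\<close>

inductive gen2 :: "('v::ab_group_add \<Rightarrow> 'v \<Rightarrow> 'p::prime_card mod_ring) \<Rightarrow> bool" where
  bilinear: "additive a \<Longrightarrow> additive b \<Longrightarrow> gen2 (\<lambda>x y. a x * b y)"
| carry: "additive a \<Longrightarrow> gen2 (\<lambda>x y. n * carry (a x) (a y))"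
| coboundary: "gen2 (delta1 w)"
| sum: "gen2 c \<Longrightarrow> gen2 d \<Longrightarrow> gen2 (\<lambda>x y. c x y + d x y)"

lemma gen2_cong: "gen2 d \<Longrightarrow> (\<And>x y. c x y = d x y) \<Longrightarrow> gen2 c"
proof -
  assume "gen2 d" "\<And>x y. c x y = d x y"
  moreover from this have "c = d" by (intro ext)
  ultimately show "gen2 c" by simp
qed

text \<open>Adding the coordinate \<open>i\<close> contributes the shuffle term, which is bilinear, and a cocycle of the
  cyclic group, which is a multiple of the carry.\<close>

lemma gen2_proj:
  fixes c :: "'p::prime_card mod_ring ^ 'n \<Rightarrow> 'p mod_ring ^ 'n \<Rightarrow> 'p mod_ring"
  assumes c: "cocycle2 c" and "finite S"
  shows "gen2 (\<lambda>x y. c (proj S x) (proj S y))"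
  using \<open>finite S\<close>
proof (induction S)
  case empty
  show ?case
    by (rule gen2_cong[OF gen2.coboundary[of "\<lambda>_. c 0 0"]]) (simp add: proj_empty delta1_def)
next
  case (insert i S)
  define ax :: "'p mod_ring ^ 'n" where "ax = axis i 1"
  have "cocycle2 (\<lambda>s t. c (s *s ax) (t *s ax))"
    using cocycle2D[OF c] by (simp add: cocycle2_def delta2_def vector_sadd_rdistrib)
  then obtain h N where hN: "\<And>s t. c (s *s ax) (t *s ax) = delta1 h s t + (if carry s t = 0 then 0 else N)"
    by (rule cyclic_cocycle2) blast
  have sh: "shuffle11 c x (s *s ax) = shuffle11 c x ax * s" for x s
  proof -
    have "additive (\<lambda>s. shuffle11 c x (s *s ax))"
      by (simp add: additive_def vector_sadd_rdistrib shuffle11_add_right[OF c])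
    from additive_mod_ring[OF this, of s] show ?thesis by simp
  qed
  have g1: "gen2 (\<lambda>x y. shuffle11 c (proj S x) ax * y $ i)"
    by (intro gen2.bilinear additive_nth) (simp add: additive_def proj_add shuffle11_add_left[OF c])
  have g2: "gen2 (\<lambda>x y. N * carry (x $ i) (y $ i))"
    by (intro gen2.carry additive_nth)
  \<comment> \<open>\<open>h\<close> comes from the cyclic cocycle on the new axis, the other
    summand from the homotopy term of \<open>cocycle2_add_arg\<close>.\<close>
  have g3: "gen2 (delta1 (\<lambda>x. h (x $ i) - c (x $ i *s ax) (proj S x)))"
    by (rule gen2.coboundary)
  show ?case
  proof (rule gen2_cong[OF gen2.sum[OF insert.IH gen2.sum[OF g1 gen2.sum[OF g2 g3]]]])
    fix x y
    have "carry s t = 0 \<or> carry s t = 1" for s t :: "'p mod_ring"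
      by (simp add: carry_def)
    then have "(if carry (x $ i) (y $ i) = 0 then 0 else N) = N * carry (x $ i) (y $ i)"
      by (metis mult.right_neutral mult_zero_right)
    then show "c (proj (insert i S) x) (proj (insert i S) y) =
      c (proj S x) (proj S y) + (shuffle11 c (proj S x) ax * y $ i + (N * carry (x $ i) (y $ i) +
        delta1 (\<lambda>x. h (x $ i) - c (x $ i *s ax) (proj S x)) x y))"
      unfolding proj_insert[OF insert.hyps(2)] ax_def[symmetric] sh hN
        cocycle2_add_arg[OF c, of "proj S x" "x $ i *s ax" "proj S y" "y $ i *s ax"]
      by (simp add: delta1_def proj_add vector_sadd_rdistrib algebra_simps)
  qed
qed

lemma gen2_of_cocycle2:
  fixes c :: "'p::prime_card mod_ring ^ 'n \<Rightarrow> 'p mod_ring ^ 'n \<Rightarrow> 'p mod_ring"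
  assumes "cocycle2 c"
  shows "gen2 c"
  using gen2_proj[OF assms, of UNIV] by (simp add: proj_UNIV)

text \<open>The group \<^typ>\<open>'a\<close> stands for the multiplicative group of \<open>k\<close>, written additively, and \<^term>\<open>e\<close>
  for the choice of a primitive \<open>p\<close>-th root of unity.\<close>

locale torsion_embedding =
  fixes e :: "'p::prime_card mod_ring \<Rightarrow> 'a::ab_group_add"
  assumes e_add: "e (s + t) = e s + e t"
    and e_eq_0: "e s = 0 \<Longrightarrow> s = 0"
    and additive_eq_e: "additive N \<Longrightarrow> \<exists>t. \<forall>z. N z = e (t * z)"
    and divisible: "\<exists>E :: int \<Rightarrow> 'a. additive E \<and> E (int CARD('p)) = a"
begin

lemma additive_e: "additive e"
  by (simp add: additive_def e_add)

lemmas e_0 [simp] = additive.zero[OF additive_e]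
lemmas e_minus = additive.minus[OF additive_e]
lemmas e_diff = additive.diff[OF additive_e]
lemmas e_sum = additive.sum[OF additive_e]

inductive gen3 :: "('v::ab_group_add \<Rightarrow> 'v \<Rightarrow> 'v \<Rightarrow> 'a) \<Rightarrow> bool" where
  trilinear: "additive a \<Longrightarrow> additive b \<Longrightarrow> additive c \<Longrightarrow> gen3 (\<lambda>x y z. e (a x * b y * c z))"
| carry: "additive a \<Longrightarrow> additive b \<Longrightarrow> gen3 (\<lambda>x y z. e (carry (a x) (a y) * b z))"
| coboundary: "gen3 (delta2 h)"
| sum: "gen3 f \<Longrightarrow> gen3 g \<Longrightarrow> gen3 (\<lambda>x y z. f x y z + g x y z)"

lemma gen3_cong: "gen3 g \<Longrightarrow> (\<And>x y z. f x y z = g x y z) \<Longrightarrow> gen3 f"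
proof -
  assume "gen3 g" "\<And>x y z. f x y z = g x y z"
  moreover from this have "f = g" by (intro ext)
  ultimately show "gen3 f" by simp
qed

text \<open>Cup product with a functional \<open>b\<close>; \<alpha> will be the projection to the
  old coordinates. The scalar of a carry moves into \<open>b\<close>, and a coboundary stays one
  because additivity of \<open>b\<close> gives the product rule.\<close>

lemma gen2_imp_gen3:
  assumes "gen2 c" and \<alpha>: "additive \<alpha>" and b: "additive b"
  shows "gen3 (\<lambda>x y z. e (c (\<alpha> x) (\<alpha> y) * b z))"
  using \<open>gen2 c\<close>
proof induction
  case (bilinear a1 a2)
  have "gen3 (\<lambda>x y z. e (a1 (\<alpha> x) * a2 (\<alpha> y) * b z))"
    using bilinear \<alpha> b by (intro gen3.trilinear) (simp_all add: additive_def)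
  then show ?case .
next
  case (carry a n)
  have "gen3 (\<lambda>x y z. e (carry (a (\<alpha> x)) (a (\<alpha> y)) * (n * b z)))"
    using carry \<alpha> b by (intro gen3.carry) (simp_all add: additive_def algebra_simps)
  then show ?case by (simp add: mult_ac)
next
  case (coboundary w)
  show ?case
    by (rule gen3_cong[OF gen3.coboundary[of "\<lambda>x y. e (w (\<alpha> x) * b y)"]])
      (simp add: delta1_def delta2_def additive.add[OF \<alpha>] additive.add[OF b] e_add e_diff algebra_simps)
next
  case (sum c d)
  show ?case
    by (rule gen3_cong[OF gen3.sum[OF sum.IH]]) (simp add: e_add algebra_simps)
qed

text \<open>By divisibility the obstruction \<open>N\<close> is \<open>p\<close> times an element
  \<open>E 1\<close>. Then \<open>E\<close> applied to \<open>residue\<close> is a 1-cochain whose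
  coboundary is \<open>N\<close> times the carry, by \<open>carry_residue\<close>.\<close>

lemma cyclic_cocycle2_trivial:
  fixes f :: "'p mod_ring \<Rightarrow> 'p mod_ring \<Rightarrow> 'a"
  assumes "cocycle2 f"
  shows "\<exists>u. f = delta1 u"
proof -
  obtain h N where hN: "\<And>x y. f x y = delta1 h x y + (if carry x y = 0 then 0 else N)"
    using cyclic_cocycle2[OF assms] by blast
  obtain E :: "int \<Rightarrow> 'a" where E: "additive E" "E (int CARD('p)) = N"
    using divisible by blast
  have "(if carry x y = 0 then 0 else N) = delta1 (\<lambda>x. E (residue x)) x y" for x y :: "'p mod_ring"
  proof -
    have "(if carry x y = 0 then 0 else N) = E (int CARD('p) * residue (carry x y))"
      using additive.zero[OF E(1)] E(2) by (simp add: carry_def)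
    also have "\<dots> = E (residue x + residue y - residue (x + y))"
      by (simp only: carry_residue)
    finally show ?thesis
      by (simp add: delta1_def additive.add[OF E(1)] additive.diff[OF E(1)])
  qed
  then have "f = delta1 (\<lambda>x. h x + E (residue x))"
    by (simp add: fun_eq_iff hN delta1_add)
  then show ?thesis by blast
qed

text \<open>The term in one old and two new arguments is, for each value of the old one, a 2-cocycle of the
  cyclic group and hence the coboundary of some \<open>u\<close>. Correcting by \<open>u\<close> makes the term in two old and
  one new argument additive in the latter, so it is given by a 2-cocycle with values in the prime
  field.\<close>

lemma gen3_proj:
  fixes f :: "'p mod_ring ^ 'n \<Rightarrow> 'p mod_ring ^ 'n \<Rightarrow> 'p mod_ring ^ 'n \<Rightarrow> 'a"
  assumes f: "cocycle3 f" and "finite S"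
  shows "gen3 (\<lambda>x y z. f (proj S x) (proj S y) (proj S z))"
  using \<open>finite S\<close>
proof (induction S)
  case empty
  have "f 0 0 0 = 0"
    using cocycle3D[OF f, of 0 0 0 0] by (simp add: delta3_def)
  then show ?case
    by (intro gen3_cong[OF gen3.coboundary[of "\<lambda>_ _. 0"]]) (simp add: proj_empty delta2_def)
next
  case (insert i S)
  define ax :: "'p mod_ring ^ 'n" where "ax = axis i 1"
  have "cocycle3 (\<lambda>r s t. f (r *s ax) (s *s ax) (t *s ax))"
    using cocycle3D[OF f] by (simp add: cocycle3_def delta3_def vector_sadd_rdistrib)
  then obtain h N where hN: "\<And>r s t. f (r *s ax) (s *s ax) (t *s ax) =
      delta2 h r s t + (if carry r s = 0 then 0 else N t)"
    and N: "\<And>s t. N (s + t) = N s + N t"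
    by (rule cyclic_cocycle3) blast
  have "additive N"
    by (simp add: additive_def N)
  then obtain n where n: "\<And>t. N t = e (n * t)"
    using additive_eq_e by blast
  have "\<exists>u. (\<lambda>s t. shuffle12 f x (s *s ax) (t *s ax)) = delta1 u" for x
    by (rule cyclic_cocycle2_trivial)
      (use cocycle2D[OF shuffle12_cocycle[OF f]] in \<open>simp add: cocycle2_def delta2_def vector_sadd_rdistrib\<close>)
  then obtain u where u: "\<And>x. (\<lambda>s t. shuffle12 f x (s *s ax) (t *s ax)) = delta1 (u x)"
    by metis
  have u: "shuffle12 f x (s *s ax) (t *s ax) = delta1 (u x) s t" for x s t
    by (rule fun_cong[OF fun_cong[OF u]])
  define F where "F = (\<lambda>x y s. shuffle21 f x y (s *s ax) + delta1 (\<lambda>x. u x s) x y)"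
  have F: "additive (F x y)" for x y
    by (simp add: additive_def F_def vector_sadd_rdistrib shuffle21_add[OF f] u)
      (simp add: delta1_def algebra_simps)
  then obtain c where c: "\<And>x y s. F x y s = e (c x y * s)"
    using additive_eq_e[OF F] by metis
  \<comment> \<open>\<open>F x y 1\<close> is \<open>e (c x y)\<close>, and injectivity of
    \<open>e\<close> passes the cocycle identity down to \<open>c\<close>.\<close>
  have "cocycle2 (\<lambda>x y. F x y 1)"
    unfolding F_def by (intro cocycle2_add shuffle21_cocycle f cocycle2_delta1)
  moreover have "e (delta2 c x y z) = delta2 (\<lambda>x y. F x y 1) x y z" for x y z
    by (simp add: c delta2_def e_add e_diff)
  ultimately have "cocycle2 c"
    by (simp add: cocycle2_def e_eq_0)
  then have "gen2 c"
    by (rule gen2_of_cocycle2)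
  then have g1: "gen3 (\<lambda>x y z. e (c (proj S x) (proj S y) * z $ i))"
    by (rule gen2_imp_gen3) (simp_all add: additive_def proj_add)
  have g2: "gen3 (\<lambda>x y z. e (carry (x $ i) (y $ i) * (n * z $ i)))"
    by (intro gen3.carry additive_nth additive_scale_nth)
  \<comment> \<open>The three terms are the coboundary on the new axis, the correction
    \<open>u\<close> and the homotopy. The single term \<open>- u\<close> accounts both for the
    \<open>delta1\<close> added in \<open>F\<close> and for \<open>shuffle12\<close>, which is
    itself a \<open>delta1\<close> of \<open>u\<close>.\<close>
  let ?h = "\<lambda>x y. h (x $ i) (y $ i) - u (proj S x) (y $ i)
     + ez_homotopy f (proj S x) (x $ i *s ax) (proj S y) (y $ i *s ax)"
  have g3: "gen3 (delta2 ?h)"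
    by (rule gen3.coboundary)
  show ?case
  proof (rule gen3_cong[OF gen3.sum[OF insert.IH gen3.sum[OF g1 gen3.sum[OF g2 g3]]]])
    fix x y z
    have "carry s t = 0 \<or> carry s t = 1" for s t :: "'p mod_ring"
      by (simp add: carry_def)
    then have 1: "(if carry (x $ i) (y $ i) = 0 then 0 else e (n * z $ i)) = e (carry (x $ i) (y $ i) * (n * z $ i))"
      by (metis e_0 mult_1 mult_zero_left)
    show "f (proj (insert i S) x) (proj (insert i S) y) (proj (insert i S) z) =
      f (proj S x) (proj S y) (proj S z) + (e (c (proj S x) (proj S y) * z $ i)
        + (e (carry (x $ i) (y $ i) * (n * z $ i)) + delta2 ?h x y z))"
      unfolding proj_insert[OF insert.hyps(2)] ax_def[symmetric] hN
        cocycle3_add_arg[OF f, of "proj S x" "x $ i *s ax" "proj S y" "y $ i *s ax" "proj S z" "z $ i *s ax"] n 1 u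
        c[symmetric] F_def
      by (simp add: delta1_def delta2_def proj_add vector_sadd_rdistrib algebra_simps)
  qed
qed

lemma gen3_of_cocycle3:
  fixes f :: "'p mod_ring ^ 'n \<Rightarrow> 'p mod_ring ^ 'n \<Rightarrow> 'p mod_ring ^ 'n \<Rightarrow> 'a"
  assumes "cocycle3 f"
  shows "gen3 f"
  using gen3_proj[OF assms, of UNIV] by (simp add: proj_UNIV)

end

section \<open>Quotients of free algebras\<close>

lemma free_algebra_simps [simp]:
  "carrier (free_algebra B) = {x. Poly_Mapping.keys x \<subseteq> lists B}"
  "x \<otimes>\<^bsub>free_algebra B\<^esub> y = x * y" "\<one>\<^bsub>free_algebra B\<^esub> = 1"
  "x \<oplus>\<^bsub>free_algebra B\<^esub> y = x + y" "\<zero>\<^bsub>free_algebra B\<^esub> = 0"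
  by (simp_all add: free_algebra_def)

lemma keys_times_lists:
  assumes "Poly_Mapping.keys x \<subseteq> lists B" "Poly_Mapping.keys y \<subseteq> lists B"
  shows "Poly_Mapping.keys (x * y) \<subseteq> lists B"
  using keys_mult[of x y] assms by (fastforce simp: plus_list_def)

lemma keys_plus_subset:
  "Poly_Mapping.keys x \<subseteq> S \<Longrightarrow> Poly_Mapping.keys y \<subseteq> S \<Longrightarrow> Poly_Mapping.keys (x + y) \<subseteq> S"
  using Poly_Mapping.keys_add[of x y] by blast

lemma keys_uminus [simp]: "Poly_Mapping.keys (- x) = Poly_Mapping.keys (x :: 'a \<Rightarrow>\<^sub>0 'b::ab_group_add)"
  by (auto simp: in_keys_iff)

lemma keys_minus_subset:
  "Poly_Mapping.keys x \<subseteq> S \<Longrightarrow> Poly_Mapping.keys y \<subseteq> S \<Longrightarrow>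
    Poly_Mapping.keys (x - y :: 'a \<Rightarrow>\<^sub>0 'b::ab_group_add) \<subseteq> S"
  using keys_plus_subset[of x S "- y"] by simp

lemma keys_single_lists: "u \<in> S \<Longrightarrow> Poly_Mapping.keys (Poly_Mapping.single u c) \<subseteq> S"
  by simp

lemma ring_free_algebra: "ring (free_algebra B)"
proof (rule ringI)
  show "abelian_group (free_algebra B)"
  proof (rule abelian_groupI)
    fix x assume "x \<in> carrier (free_algebra B)"
    then have "- x \<in> carrier (free_algebra B)" "- x \<oplus>\<^bsub>free_algebra B\<^esub> x = \<zero>\<^bsub>free_algebra B\<^esub>"
      by simp_all
    then show "\<exists>y\<in>carrier (free_algebra B). y \<oplus>\<^bsub>free_algebra B\<^esub> x = \<zero>\<^bsub>free_algebra B\<^esub>"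
      by blast
  qed (simp_all add: keys_plus_subset add_ac)
  show "Group.monoid (free_algebra B)"
    by (rule monoidI) (simp_all add: keys_times_lists mult.assoc zero_list_def)
qed (simp_all add: algebra_simps)

lemma a_inv_free_algebra:
  assumes "x \<in> carrier (free_algebra B)"
  shows "\<ominus>\<^bsub>free_algebra B\<^esub> x = - x"
proof -
  interpret ring "free_algebra B" by (rule ring_free_algebra)
  show ?thesis
    by (rule minus_equality) (use assms in simp_all)
qed

lemma ideal_free_algebraD:
  assumes "ideal I (free_algebra B)"
  shows "I \<subseteq> {x. Poly_Mapping.keys x \<subseteq> lists B}" "0 \<in> I"
    "x \<in> I \<Longrightarrow> y \<in> I \<Longrightarrow> x + y \<in> I" "x \<in> I \<Longrightarrow> - x \<in> I" "x \<in> I \<Longrightarrow> y \<in> I \<Longrightarrow> x - y \<in> I"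
    "x \<in> I \<Longrightarrow> Poly_Mapping.keys z \<subseteq> lists B \<Longrightarrow> z * x \<in> I"
    "x \<in> I \<Longrightarrow> Poly_Mapping.keys z \<subseteq> lists B \<Longrightarrow> x * z \<in> I"
proof -
  interpret ideal I "free_algebra B" by fact
  show 0: "I \<subseteq> {x. Poly_Mapping.keys x \<subseteq> lists B}"
    using a_subset by simp
  show "0 \<in> I"
    using additive_subgroup.zero_closed[OF is_additive_subgroup] by simp
  show add: "x + y \<in> I" if "x \<in> I" "y \<in> I" for x y
    using additive_subgroup.a_closed[OF is_additive_subgroup that] by simp
  show inv: "- x \<in> I" if "x \<in> I" for x
    using additive_subgroup.a_inv_closed[OF is_additive_subgroup that] a_inv_free_algebra[of x B]
      subsetD[OF 0 that] by simp
  show "x - y \<in> I" if "x \<in> I" "y \<in> I"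
    using add[OF that(1) inv[OF that(2)]] by simp
  show "x \<in> I \<Longrightarrow> Poly_Mapping.keys z \<subseteq> lists B \<Longrightarrow> z * x \<in> I"
    "x \<in> I \<Longrightarrow> Poly_Mapping.keys z \<subseteq> lists B \<Longrightarrow> x * z \<in> I"
    using I_l_closed[of x z] I_r_closed[of x z] by simp_all
qed

lemma keys_induct [consumes 1, case_names zero single add]:
  fixes x :: "'b \<Rightarrow>\<^sub>0 'c::ab_group_add"
  assumes "Poly_Mapping.keys x \<subseteq> S" and "P 0" and "\<And>u c. u \<in> S \<Longrightarrow> P (Poly_Mapping.single u c)"
    and "\<And>x y. P x \<Longrightarrow> P y \<Longrightarrow> P (x + y)"
  shows "P x"
proof -
  have sum: "finite A \<Longrightarrow> A \<subseteq> S \<Longrightarrow> P (\<Sum>u\<in>A. Poly_Mapping.single u (Poly_Mapping.lookup x u))" for A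
    by (induction A rule: finite_induct) (use assms in auto)
  have "x = (\<Sum>u\<in>Poly_Mapping.keys x. Poly_Mapping.single u (Poly_Mapping.lookup x u))"
    by (rule poly_mapping_eqI)
      (auto simp: lookup_sum lookup_single when_def in_keys_iff if_distrib sum.delta' cong: if_cong)
  then show ?thesis
    using sum[of "Poly_Mapping.keys x"] assms(1) by simp
qed

text \<open>The \<open>x\<close> with \<open>K (y * x * z)\<close> for all \<open>y\<close> and \<open>z\<close> form an ideal, although \<open>K\<close> itself is only an
  additive subgroup.\<close>

lemma free_algebra_Idl_induct:
  fixes R :: "('w list \<Rightarrow>\<^sub>0 'f::field) set"
  assumes R: "R \<subseteq> carrier (free_algebra B)" and x: "x \<in> Idl\<^bsub>free_algebra B\<^esub> R"
    and 0: "K 0" and add: "\<And>x y. K x \<Longrightarrow> K y \<Longrightarrow> K (x + y)" and minus: "\<And>x. K x \<Longrightarrow> K (- x)"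
    and rel: "\<And>r u v c d. r \<in> R \<Longrightarrow> u \<in> lists B \<Longrightarrow> v \<in> lists B \<Longrightarrow>
       K (Poly_Mapping.single u c * r * Poly_Mapping.single v d)"
  shows "K x"
proof -
  let ?A = "free_algebra B :: ('w list \<Rightarrow>\<^sub>0 'f) ring"
  interpret ring ?A by (rule ring_free_algebra)
  define J where "J = {x \<in> carrier ?A. \<forall>y\<in>carrier ?A. \<forall>z\<in>carrier ?A. K (y * x * z)}"
  have "ideal J ?A"
  proof (rule idealI)
    show "subgroup J (add_monoid ?A)"
    proof (rule add.subgroupI)
      show "J \<subseteq> carrier ?A" by (auto simp: J_def)
      show "J \<noteq> {}" by (auto simp: J_def 0 intro!: exI[of _ 0])
      show "\<ominus>\<^bsub>?A\<^esub> a \<in> J" if "a \<in> J" for a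
        using that minus by (auto simp: J_def a_inv_free_algebra)
      show "a \<oplus>\<^bsub>?A\<^esub> b \<in> J" if "a \<in> J" "b \<in> J" for a b
        using that keys_plus_subset[of a "lists B" b] by (auto simp: J_def algebra_simps intro: add)
    qed
    show "z \<otimes>\<^bsub>?A\<^esub> a \<in> J" if "a \<in> J" "z \<in> carrier ?A" for a z
    proof -
      have "K (y * (z * a) * w)" if "y \<in> carrier ?A" "w \<in> carrier ?A" for y w
      proof -
        have "y * z \<in> carrier ?A"
          using that \<open>z \<in> carrier ?A\<close> keys_times_lists by simp
        then have "K ((y * z) * a * w)"
          using that \<open>a \<in> J\<close> unfolding J_def by blast
        then show ?thesis by (simp add: mult.assoc)
      qed
      moreover have "z * a \<in> carrier ?A"
        using that keys_times_lists[of z B a] by (simp add: J_def)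
      ultimately show ?thesis by (simp add: J_def)
    qed
    show "a \<otimes>\<^bsub>?A\<^esub> z \<in> J" if "a \<in> J" "z \<in> carrier ?A" for a z
    proof -
      have "K (y * (a * z) * w)" if "y \<in> carrier ?A" "w \<in> carrier ?A" for y w
      proof -
        have "z * w \<in> carrier ?A"
          using that \<open>z \<in> carrier ?A\<close> keys_times_lists by simp
        then have "K (y * a * (z * w))"
          using that \<open>a \<in> J\<close> unfolding J_def by blast
        then show ?thesis by (simp add: mult.assoc)
      qed
      moreover have "a * z \<in> carrier ?A"
        using that keys_times_lists[of a B z] by (simp add: J_def)
      ultimately show ?thesis by (simp add: J_def)
    qed
  qed (rule ring_free_algebra)
  moreover have "R \<subseteq> J"
  proof
    fix r assume r: "r \<in> R"
    have 1: "K (y * r * Poly_Mapping.single v d)"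
      if "Poly_Mapping.keys y \<subseteq> lists B" "v \<in> lists B" for y v d
      using that(1)
    proof (induction rule: keys_induct)
      case (single u c)
      then show ?case using rel[OF r _ that(2)] by blast
    next
      case (add x y)
      then show ?case using assms(4) by (simp add: algebra_simps)
    qed (simp add: 0)
    have "K (y * r * z)" if "Poly_Mapping.keys y \<subseteq> lists B" "Poly_Mapping.keys z \<subseteq> lists B" for y z
      using that(2)
    proof (induction rule: keys_induct)
      case (single u c)
      then show ?case using 1[OF that(1)] by blast
    next
      case (add x y)
      then show ?case using assms(4) by (simp add: algebra_simps)
    qed (simp add: 0)
    then show "r \<in> J" using subsetD[OF R r] by (simp add: J_def)
  qed
  ultimately have "x \<in> J"
    using genideal_minimal[of J R] x by blast
  then have "K (1 * x * 1)"
    unfolding J_def using one_closed[unfolded free_algebra_simps] by (simp del: mult_1_left mult_1_right)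
  then show ?thesis by simp
qed

lemma free_algebra_Idl_relation:
  fixes R :: "('w list \<Rightarrow>\<^sub>0 'f::field) set"
  assumes R: "R \<subseteq> carrier (free_algebra B)"
  shows "ideal (Idl\<^bsub>free_algebra B\<^esub> R) (free_algebra B)" "R \<subseteq> Idl\<^bsub>free_algebra B\<^esub> R"
proof -
  interpret ring "free_algebra B :: ('w list \<Rightarrow>\<^sub>0 'f) ring" by (rule ring_free_algebra)
  show "ideal (Idl\<^bsub>free_algebra B\<^esub> R) (free_algebra B)" "R \<subseteq> Idl\<^bsub>free_algebra B\<^esub> R"
    by (rule genideal_ideal[OF R], rule genideal_self[OF R])
qed

section \<open>Linear functionals and induced endomorphisms of the free algebra\<close>

definition eval_words :: "('w list \<Rightarrow> 'f::comm_ring_1) \<Rightarrow> ('w list \<Rightarrow>\<^sub>0 'f) \<Rightarrow> 'f" where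
  "eval_words \<phi> x = (\<Sum>u\<in>Poly_Mapping.keys x. Poly_Mapping.lookup x u * \<phi> u)"

lemma eval_words_superset:
  "finite A \<Longrightarrow> Poly_Mapping.keys x \<subseteq> A \<Longrightarrow> eval_words \<phi> x = (\<Sum>u\<in>A. Poly_Mapping.lookup x u * \<phi> u)"
  unfolding eval_words_def by (rule sum.mono_neutral_left) (auto simp: in_keys_iff)

lemma eval_words_add: "eval_words \<phi> (x + y) = eval_words \<phi> x + eval_words \<phi> y"
proof -
  let ?A = "Poly_Mapping.keys x \<union> Poly_Mapping.keys y"
  have "eval_words \<phi> z = (\<Sum>u\<in>?A. Poly_Mapping.lookup z u * \<phi> u)" if "z \<in> {x, y, x + y}" for z
    using that by (intro eval_words_superset) (auto dest: subsetD[OF Poly_Mapping.keys_add])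
  then show ?thesis
    by (simp add: lookup_add distrib_right sum.distrib)
qed

lemma eval_words_0 [simp]: "eval_words \<phi> 0 = 0"
  by (simp add: eval_words_def)

lemma eval_words_single [simp]: "eval_words \<phi> (Poly_Mapping.single u c) = c * \<phi> u"
  by (simp add: eval_words_def)

lemma additive_eval_words: "additive (eval_words \<phi>)"
  by (simp add: additive_def eval_words_add)

lemma eval_words_minus: "eval_words \<phi> (- x) = - eval_words \<phi> x"
  by (rule additive.minus[OF additive_eval_words])

lemma eval_words_diff: "eval_words \<phi> (x - y) = eval_words \<phi> x - eval_words \<phi> y"
  by (rule additive.diff[OF additive_eval_words])

lemma free_algebra_map_superset:
  "finite A \<Longrightarrow> Poly_Mapping.keys x \<subseteq> A \<Longrightarrow>
    free_algebra_map h x = (\<Sum>u\<in>A. Poly_Mapping.single (map h u) (Poly_Mapping.lookup x u))"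
  unfolding free_algebra_map_def by (rule sum.mono_neutral_left) (auto simp: in_keys_iff)

lemma free_algebra_map_add: "free_algebra_map h (x + y) = free_algebra_map h x + free_algebra_map h y"
proof -
  let ?A = "Poly_Mapping.keys x \<union> Poly_Mapping.keys y"
  have "free_algebra_map h z = (\<Sum>u\<in>?A. Poly_Mapping.single (map h u) (Poly_Mapping.lookup z u))"
    if "z \<in> {x, y, x + y}" for z
    using that by (intro free_algebra_map_superset) (auto dest: subsetD[OF Poly_Mapping.keys_add])
  then show ?thesis
    by (simp add: lookup_add single_add sum.distrib)
qed

lemma free_algebra_map_single [simp]:
  "free_algebra_map h (Poly_Mapping.single u c) = Poly_Mapping.single (map h u) c"
  by (cases "c = 0") (simp_all add: free_algebra_map_def)

lemma additive_free_algebra_map: "additive (free_algebra_map h)"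
  by (simp add: additive_def free_algebra_map_add)

lemmas free_algebra_map_0 [simp] = additive.zero[OF additive_free_algebra_map]
lemmas free_algebra_map_minus = additive.minus[OF additive_free_algebra_map]
lemmas free_algebra_map_diff = additive.diff[OF additive_free_algebra_map]

lemma free_algebra_map_mult: "free_algebra_map h (x * y) = free_algebra_map h x * free_algebra_map h y"
proof (induction x rule: keys_induct[OF subset_UNIV])
  case (2 u c)
  show ?case
    by (induction y rule: keys_induct[OF subset_UNIV])
      (simp_all add: mult_single plus_list_def algebra_simps free_algebra_map_add)
qed (simp_all add: algebra_simps free_algebra_map_add)

lemma eval_words_free_algebra_map:
  "eval_words \<phi> (free_algebra_map h x) = eval_words (\<lambda>u. \<phi> (map h u)) x"
  by (induction x rule: keys_induct[OF subset_UNIV])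
    (simp_all add: free_algebra_map_add eval_words_add)

lemma free_algebra_map_comp:
  "free_algebra_map g (free_algebra_map h x) = free_algebra_map (\<lambda>w. g (h w)) x"
  by (induction x rule: keys_induct[OF subset_UNIV]) (simp_all add: free_algebra_map_add comp_def)

lemma free_algebra_map_ident:
  assumes "Poly_Mapping.keys x \<subseteq> lists B" "\<And>w. w \<in> B \<Longrightarrow> h w = w"
  shows "free_algebra_map h x = x"
  using assms(1)
proof (induction rule: keys_induct)
  case (single u c)
  then have "map h u = u"
    using assms(2) by (intro map_idI) auto
  then show ?case by simp
qed (simp_all add: free_algebra_map_add)

lemma keys_free_algebra_map:
  assumes "Poly_Mapping.keys x \<subseteq> S" "\<And>u. u \<in> S \<Longrightarrow> map h u \<in> T"
  shows "Poly_Mapping.keys (free_algebra_map h x) \<subseteq> T"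
  using assms(1)
  by (induction rule: keys_induct) (use assms(2) in \<open>simp_all add: free_algebra_map_add keys_plus_subset\<close>)

lemma free_algebra_map_Idl:
  assumes R: "R \<subseteq> carrier (free_algebra B)" and h: "\<And>w. w \<in> B \<Longrightarrow> h w \<in> B"
    and rel: "\<And>r. r \<in> R \<Longrightarrow> free_algebra_map h r \<in> R"
    and x: "x \<in> Idl\<^bsub>free_algebra B\<^esub> R"
  shows "free_algebra_map h x \<in> Idl\<^bsub>free_algebra B\<^esub> R"
proof (rule free_algebra_Idl_induct[OF R x])
  note I = ideal_free_algebraD[OF free_algebra_Idl_relation(1)[OF R]]
  fix r u v and c d :: 'b
  assume r: "r \<in> R" and uv: "u \<in> lists B" "v \<in> lists B"
  have "map h u \<in> lists B" "map h v \<in> lists B"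
    using uv h by auto
  moreover have "free_algebra_map h r \<in> Idl\<^bsub>free_algebra B\<^esub> R"
    using rel[OF r] free_algebra_Idl_relation(2)[OF R] by blast
  ultimately show "free_algebra_map h (Poly_Mapping.single u c * r * Poly_Mapping.single v d)
      \<in> Idl\<^bsub>free_algebra B\<^esub> R"
    by (simp add: free_algebra_map_mult I keys_single_lists del: keys_single)
qed (use ideal_free_algebraD[OF free_algebra_Idl_relation(1)[OF R]] in
  \<open>simp_all add: free_algebra_map_add free_algebra_map_minus\<close>)

section \<open>From words of functionals to cocycles\<close>

lemma additive_imp_linear:
  fixes a :: "'p::prime_card mod_ring ^ 'n \<Rightarrow> 'p mod_ring"
  assumes "additive a"
  shows "a (c *s v) = c * a v"
proof -
  have "additive (\<lambda>c. a (c *s v))"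
    by (simp add: additive_def vector_sadd_rdistrib additive.add[OF assms])
  from additive_mod_ring[OF this, of c] show ?thesis by simp
qed

text \<open>A scalar of the prime field is a sum of ones, so homogeneity follows from additivity.
  From here on the dual space is handled through \<open>additive\<close> alone.\<close>

lemma functional_iff_additive:
  fixes a :: "'p::prime_card mod_ring ^ 'n \<Rightarrow> 'p mod_ring"
  shows "Vector_Spaces.linear (*s) (*) a \<longleftrightarrow> additive a"
  unfolding Vector_Spaces.linear_iff additive_def
  using additive_imp_linear[of a] vec.vector_space_axioms vector_space_over_itself.vector_space_axioms
  by (auto simp: additive_def)

abbreviation dual :: "('p::prime_card mod_ring, 'p mod_ring ^ 'n \<Rightarrow> 'p mod_ring) module" where
  "dual \<equiv> dual_space"

lemma dual_space_simps [simp]: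
  "carrier dual = {a :: 'p::prime_card mod_ring ^ 'n \<Rightarrow> 'p mod_ring. additive a}"
  "a \<oplus>\<^bsub>dual\<^esub> b = (\<lambda>v. a v + b v)"
  "c \<odot>\<^bsub>dual\<^esub> a = (\<lambda>v. c * a v)"
  by (simp_all add: dual_space_def functional_iff_additive)

lemma free_gen_tensor_relation:
  "free_gen (\<lambda>v. a v + b v) - free_gen a - free_gen b \<in> tensor_relations dual"
  if "additive a" "additive b"
  using that by (force simp: tensor_relations_def)

lemma free_gen_smult_relation:
  "free_gen (\<lambda>v. c * a v) - free_scalar c * free_gen a \<in> tensor_relations dual" if "additive a"
  using that by (force simp: tensor_relations_def)

lemma relations_subset:
  "tensor_relations W \<subseteq> exterior_relations W" "tensor_relations W \<subseteq> symmetric_relations W"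
  by (auto simp: exterior_relations_def symmetric_relations_def)

lemma additive_plus: "additive a \<Longrightarrow> additive b \<Longrightarrow> additive (\<lambda>v. a v + b v)"
  by (simp add: additive_def algebra_simps)

lemma additive_times: "additive a \<Longrightarrow> additive (\<lambda>v. c * a v :: 'a::comm_ring_1)"
  by (simp add: additive_def algebra_simps)

lemma tensor_relations_cases:
  assumes "r \<in> tensor_relations (dual :: (_, 'p::prime_card mod_ring ^ 'n \<Rightarrow> _) module)"
  obtains (add) a b where "additive a" "additive b"
      "r = Poly_Mapping.single [\<lambda>v. a v + b v] 1 - Poly_Mapping.single [a] 1 - Poly_Mapping.single [b] 1"
  | (smult) c a where "additive a" "r = Poly_Mapping.single [\<lambda>v. c * a v] 1 - Poly_Mapping.single [a] c"
  using assms unfolding tensor_relations_def free_gen_def free_scalar_def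
  by (auto simp: mult_single plus_list_def)

lemma exterior_relations_cases:
  assumes "r \<in> exterior_relations (dual :: (_, 'p::prime_card mod_ring ^ 'n \<Rightarrow> _) module)"
  obtains (tensor) "r \<in> tensor_relations dual"
  | (square) a where "additive a" "r = Poly_Mapping.single [a, a] 1"
  using assms unfolding exterior_relations_def free_gen_def
  by (auto simp: mult_single plus_list_def)

lemma symmetric_relations_cases:
  assumes "r \<in> symmetric_relations (dual :: (_, 'p::prime_card mod_ring ^ 'n \<Rightarrow> _) module)"
  obtains (tensor) "r \<in> tensor_relations dual"
  | (commutator) a b where "additive a" "additive b"
      "r = Poly_Mapping.single [a, b] 1 - Poly_Mapping.single [b, a] 1"
  using assms unfolding symmetric_relations_def free_gen_def
  by (auto simp: mult_single plus_list_def)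

lemma relations_closed:
  "exterior_relations (dual :: (_, 'p::prime_card mod_ring ^ 'n \<Rightarrow> _) module) \<subseteq> carrier (free_algebra (carrier dual))"
  "symmetric_relations (dual :: (_, 'p::prime_card mod_ring ^ 'n \<Rightarrow> _) module) \<subseteq> carrier (free_algebra (carrier dual))"
proof -
  have tensor: "Poly_Mapping.keys r \<subseteq> lists {a. additive a}"
    if "r \<in> tensor_relations (dual :: (_, 'p mod_ring ^ 'n \<Rightarrow> _) module)" for r
    using that
    by (cases rule: tensor_relations_cases) (simp_all add: keys_minus_subset additive_plus additive_times)
  have "Poly_Mapping.keys r \<subseteq> lists {a. additive a}"
    if "r \<in> exterior_relations (dual :: (_, 'p mod_ring ^ 'n \<Rightarrow> _) module)" for r
    using that by (cases rule: exterior_relations_cases) (simp_all add: tensor)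
  moreover have "Poly_Mapping.keys r \<subseteq> lists {a. additive a}"
    if "r \<in> symmetric_relations (dual :: (_, 'p mod_ring ^ 'n \<Rightarrow> _) module)" for r
    using that by (cases rule: symmetric_relations_cases) (simp_all add: tensor keys_minus_subset)
  ultimately show
    "exterior_relations (dual :: (_, 'p mod_ring ^ 'n \<Rightarrow> _) module) \<subseteq> carrier (free_algebra (carrier dual))"
    "symmetric_relations (dual :: (_, 'p mod_ring ^ 'n \<Rightarrow> _) module) \<subseteq> carrier (free_algebra (carrier dual))"
    by (simp_all add: subset_eq)
qed

text \<open>The value 0 on words of other lengths makes the evaluation total: the ideals contain
  elements of every degree, and their other components must not contribute.\<close>

definition word3 :: "'v \<Rightarrow> 'v \<Rightarrow> 'v \<Rightarrow> ('v \<Rightarrow> 'f::comm_ring_1) list \<Rightarrow> 'f" where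
  "word3 x y z u = (if length u = 3 then (u ! 0) x * (u ! 1) y * (u ! 2) z else 0)"

definition word2 :: "'v \<Rightarrow> 'v \<Rightarrow> 'v \<Rightarrow> ('v \<Rightarrow> 'p::prime_card mod_ring) list \<Rightarrow> 'p mod_ring" where
  "word2 x y z u = (if length u = 2 then carry ((u ! 0) x) ((u ! 0) y) * (u ! 1) z else 0)"

lemma length_eq_2_iff: "length u = 2 \<longleftrightarrow> (\<exists>a b. u = [a, b])"
  and length_eq_3_iff: "length u = 3 \<longleftrightarrow> (\<exists>a b c. u = [a, b, c])"
  by (auto simp: numeral_2_eq_2 numeral_3_eq_3 length_Suc_conv)

lemma word3_simps [simp]: "word3 x y z [a, b, c] = a x * b y * c z"
  by (simp add: word3_def numeral_2_eq_2)

lemma word2_simps [simp]: "word2 x y z [a, b] = carry (a x) (a y) * b z"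
  by (simp add: word2_def)

lemma length_append_Cons_3:
  assumes "length (u @ w # v) = 3"
  shows "(\<exists>b c. u = [] \<and> v = [b, c]) \<or> (\<exists>b c. u = [b] \<and> v = [c]) \<or> (\<exists>b c. u = [b, c] \<and> v = [])"
proof -
  from assms have "length u + length v = 2" by simp
  then have "length u = 0 \<and> length v = 2 \<or> length u = 1 \<and> length v = 1 \<or> length u = 2 \<and> length v = 0"
    by presburger
  then show ?thesis
    by (auto simp: length_eq_2_iff length_Suc_conv)
qed

lemma length_append_Cons_2:
  assumes "length (u @ w # v) = 2"
  shows "(\<exists>b. u = [] \<and> v = [b]) \<or> (\<exists>b. u = [b] \<and> v = [])"
proof -
  from assms have "length u + length v = 1" by simp
  then have "length u = 0 \<and> length v = 1 \<or> length u = 1 \<and> length v = 0"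
    by presburger
  then show ?thesis
    by (auto simp: length_Suc_conv)
qed

lemma word3_add:
  "word3 x y z (u @ (\<lambda>v. a v + b v) # v) = word3 x y z (u @ a # v) + word3 x y z (u @ b # v)"
proof (cases "length (u @ a # v) = 3")
  case True
  from length_append_Cons_3[OF this] show ?thesis
    by (auto simp: algebra_simps)
qed (simp add: word3_def)

lemma word3_times:
  "word3 x y z (u @ (\<lambda>v. c * a v) # v) = c * word3 x y z (u @ a # v)"
proof (cases "length (u @ a # v) = 3")
  case True
  from length_append_Cons_3[OF this] show ?thesis
    by (auto simp: algebra_simps)
qed (simp add: word3_def)

section \<open>Coboundaries in degree 3 and the two invariants of a class\<close>

definition coboundary3 :: "('v::ab_group_add \<Rightarrow> 'v \<Rightarrow> 'v \<Rightarrow> 'a::ab_group_add) \<Rightarrow> bool" where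
  "coboundary3 f \<longleftrightarrow> (\<exists>h. f = delta2 h)"

lemma coboundary3I: "(\<And>x y z. f x y z = delta2 h x y z) \<Longrightarrow> coboundary3 f"
  unfolding coboundary3_def by (intro exI[of _ h] ext)

lemma coboundary3_0: "coboundary3 (\<lambda>_ _ _. 0)"
  by (rule coboundary3I[of _ "\<lambda>_ _. 0"]) (simp add: delta2_def)

lemma coboundary3_add:
  assumes "coboundary3 f" "coboundary3 g"
  shows "coboundary3 (\<lambda>x y z. f x y z + g x y z)"
proof -
  obtain h k where "f = delta2 h" "g = delta2 k"
    using assms by (auto simp: coboundary3_def)
  then show ?thesis
    by (intro coboundary3I[of _ "\<lambda>x y. h x y + k x y"]) (simp add: delta2_add)
qed

lemma coboundary3_minus:
  assumes "coboundary3 f"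
  shows "coboundary3 (\<lambda>x y z. - f x y z)"
proof -
  obtain h where "f = delta2 h"
    using assms by (auto simp: coboundary3_def)
  then show ?thesis
    by (intro coboundary3I[of _ "\<lambda>x y. - h x y"]) (simp add: delta2_def)
qed

lemma coboundary3_diff:
  "coboundary3 f \<Longrightarrow> coboundary3 g \<Longrightarrow> coboundary3 (\<lambda>x y z. f x y z - g x y z)"
  using coboundary3_add[OF _ coboundary3_minus] by fastforce

definition alternation :: "('v \<Rightarrow> 'v \<Rightarrow> 'v \<Rightarrow> 'a::ab_group_add) \<Rightarrow> 'v \<Rightarrow> 'v \<Rightarrow> 'v \<Rightarrow> 'a" where
  "alternation f x y z = f x y z - f x z y - f y x z + f y z x + f z x y - f z y x"

definition cyclic_trace :: "('p::prime_card mod_ring ^ 'n \<Rightarrow> _ \<Rightarrow> _ \<Rightarrow> 'a::ab_group_add) \<Rightarrow> _ \<Rightarrow> 'a" where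
  "cyclic_trace f v = (\<Sum>t\<in>UNIV. f v (t *s v) v)"

lemma alternation_coboundary3: "coboundary3 f \<Longrightarrow> alternation f x y z = 0"
  by (auto simp: coboundary3_def alternation_def delta2_def algebra_simps)

text \<open>Merging \<open>v\<close> with \<open>t *s v\<close> only shifts the summation index to
  \<open>t + 1\<close>, so the four terms of \<open>delta2\<close> cancel in pairs.\<close>

lemma cyclic_trace_coboundary3:
  assumes "coboundary3 f"
  shows "cyclic_trace f v = 0"
proof -
  obtain h where h: "f = delta2 h"
    using assms by (auto simp: coboundary3_def)
  have "cyclic_trace f v = (\<Sum>t\<in>UNIV. h (t *s v) v) - (\<Sum>t\<in>UNIV. h ((t + 1) *s v) v)
      + (\<Sum>t\<in>UNIV. h v ((t + 1) *s v)) - (\<Sum>t\<in>UNIV. h v (t *s v))"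
    by (simp add: cyclic_trace_def h delta2_def sum.distrib sum_subtractf vector_sadd_rdistrib add.commute)
  then show ?thesis
    unfolding sum_UNIV_add[of "\<lambda>t. h (t *s v) v"] sum_UNIV_add[of "\<lambda>t. h v (t *s v)"] by simp
qed

text \<open>The integral sum of \<open>residue (t * s) - residue ((t + 1) * s)\<close> over the
  cycle is 0, which leaves \<open>p\<close> copies of \<open>residue s\<close>; \<open>p\<close> is
  cancelled over the integers.\<close>

lemma sum_carry: "(\<Sum>t\<in>UNIV. carry s (t * s)) = (s :: 'p::prime_card mod_ring)"
proof -
  have "int CARD('p) * (\<Sum>t\<in>UNIV. residue (carry s (t * s))) =
      (\<Sum>t\<in>(UNIV :: 'p mod_ring set). residue s + residue (t * s) - residue ((t + 1) * s))"
    unfolding sum_distrib_left carry_residue[symmetric] by (simp add: algebra_simps)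
  also have "\<dots> = int CARD('p) * residue s"
    using sum_UNIV_add[of "\<lambda>t. residue (t * s)" 1] by (simp add: sum.distrib sum_subtractf)
  finally have "(\<Sum>t\<in>UNIV. residue (carry s (t * s))) = residue s"
    by simp
  then have "of_int (\<Sum>t\<in>UNIV. residue (carry s (t * s))) = (of_int (residue s) :: 'p mod_ring)"
    by (rule arg_cong)
  then show ?thesis by simp
qed

text \<open>The commutator term of \<open>cocycle2_add_arg\<close> vanishes because the carry is
  symmetric: the Bockstein is additive up to a coboundary.\<close>

lemma carry_add_args:
  "carry (s + s') (t + t') = carry s t + carry s' t' -
    (carry t' t - carry (s' + t') (s + t) + carry s' (s :: 'p::prime_card mod_ring))"
  using cocycle2_add_arg[OF cocycle2_carry, of s s' t t'] by (simp add: shuffle11_def carry_commute)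

text \<open>Homogeneity of the Bockstein up to a coboundary, from additivity by adding
  \<open>s\<close> repeatedly; each step subtracts one homotopy term of
  \<open>carry_add_args\<close> from \<open>w\<close>.\<close>

lemma carry_times:
  "\<exists>w. \<forall>s t. carry (c * s) (c * t) = c * carry s t + delta1 w s (t :: 'p::prime_card mod_ring)"
proof (induction c rule: mod_ring_induct)
  case 1
  show ?case
    using residue_0[where 'p='p] prime_gt_0_nat[OF prime_card[where 'a='p]]
    by (intro exI[of _ "\<lambda>_. 0"]) (simp add: delta1_def carry_def)
next
  case (2 n)
  then obtain w where w: "\<And>s t :: 'p mod_ring. carry (of_nat n * s) (of_nat n * t) = of_nat n * carry s t + delta1 w s t"
    by blast
  show ?case
  proof (intro exI allI)
    fix s t :: "'p mod_ring"
    show "carry (of_nat (Suc n) * s) (of_nat (Suc n) * t) =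
        of_nat (Suc n) * carry s t + delta1 (\<lambda>s. w s - carry (of_nat n * s) s) s t"
      using carry_add_args[of s "of_nat n * s" t "of_nat n * t"]
      by (simp add: distrib_right w) (simp add: delta1_def algebra_simps)
  qed
qed

context torsion_embedding
begin

definition ext_cocycle ::
  "(('p mod_ring ^ 'n \<Rightarrow> 'p mod_ring) list \<Rightarrow>\<^sub>0 'p mod_ring) \<Rightarrow> 'p mod_ring ^ 'n \<Rightarrow> 'p mod_ring ^ 'n \<Rightarrow> 'p mod_ring ^ 'n \<Rightarrow> 'a"
where "ext_cocycle a x y z = e (eval_words (word3 x y z) a)"

definition sym_cocycle ::
  "(('p mod_ring ^ 'n \<Rightarrow> 'p mod_ring) list \<Rightarrow>\<^sub>0 'p mod_ring) \<Rightarrow> 'p mod_ring ^ 'n \<Rightarrow> 'p mod_ring ^ 'n \<Rightarrow> 'p mod_ring ^ 'n \<Rightarrow> 'a"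
where "sym_cocycle a x y z = e (eval_words (word2 x y z) a)"

lemma ext_cocycle_0 [simp]: "ext_cocycle 0 = (\<lambda>_ _ _. 0)"
  and ext_cocycle_add: "ext_cocycle (a + b) = (\<lambda>x y z. ext_cocycle a x y z + ext_cocycle b x y z)"
  and ext_cocycle_minus: "ext_cocycle (- a) = (\<lambda>x y z. - ext_cocycle a x y z)"
  and ext_cocycle_diff: "ext_cocycle (a - b) = (\<lambda>x y z. ext_cocycle a x y z - ext_cocycle b x y z)"
  and ext_cocycle_single: "ext_cocycle (Poly_Mapping.single u c) = (\<lambda>x y z. e (c * word3 x y z u))"
  by (simp_all add: ext_cocycle_def fun_eq_iff eval_words_add eval_words_minus eval_words_diff e_add e_minus e_diff)

lemma sym_cocycle_0 [simp]: "sym_cocycle 0 = (\<lambda>_ _ _. 0)"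
  and sym_cocycle_add: "sym_cocycle (a + b) = (\<lambda>x y z. sym_cocycle a x y z + sym_cocycle b x y z)"
  and sym_cocycle_minus: "sym_cocycle (- a) = (\<lambda>x y z. - sym_cocycle a x y z)"
  and sym_cocycle_diff: "sym_cocycle (a - b) = (\<lambda>x y z. sym_cocycle a x y z - sym_cocycle b x y z)"
  and sym_cocycle_single: "sym_cocycle (Poly_Mapping.single u c) = (\<lambda>x y z. e (c * word2 x y z u))"
  by (simp_all add: sym_cocycle_def fun_eq_iff eval_words_add eval_words_minus eval_words_diff e_add e_minus e_diff)

lemma cocycle3_ext_cocycle:
  assumes "Poly_Mapping.keys a \<subseteq> lists {\<phi>. additive \<phi>}"
  shows "cocycle3 (ext_cocycle a)"
  using assms
proof (induction rule: keys_induct)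
  case (single u c)
  show ?case
  proof (cases "length u = 3")
    case True
    then obtain \<alpha> \<beta> \<gamma> where u: "u = [\<alpha>, \<beta>, \<gamma>]"
      by (auto simp: length_eq_3_iff)
    then have "additive \<alpha>" "additive \<beta>" "additive \<gamma>"
      using single by auto
    then show ?thesis
      unfolding ext_cocycle_single u
      by (simp add: cocycle3_def delta3_def additive.add e_add[symmetric] e_diff[symmetric] algebra_simps)
  qed (simp add: ext_cocycle_single word3_def cocycle3_def delta3_def)
qed (simp_all add: ext_cocycle_add cocycle3_add, simp add: cocycle3_def delta3_def)

lemma cocycle3_sym_cocycle:
  assumes "Poly_Mapping.keys a \<subseteq> lists {\<phi>. additive \<phi>}"
  shows "cocycle3 (sym_cocycle a)"
  using assms
proof (induction rule: keys_induct)
  case (single u c)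
  show ?case
  proof (cases "length u = 2")
    case True
    then obtain \<alpha> \<beta> where u: "u = [\<alpha>, \<beta>]"
      by (auto simp: length_eq_2_iff)
    then have ab: "additive \<alpha>" "additive \<beta>"
      using single by auto
    have "delta3 (sym_cocycle (Poly_Mapping.single u c)) x y z t =
        e (c * \<beta> t * delta2 carry (\<alpha> x) (\<alpha> y) (\<alpha> z))" for x y z t
      unfolding sym_cocycle_single u
      by (simp add: delta2_def delta3_def additive.add[OF ab(1)] additive.add[OF ab(2)] e_add[symmetric] e_diff[symmetric])
         (simp add: algebra_simps)
    then show ?thesis
      by (simp add: cocycle3_def cocycle2D[OF cocycle2_carry])
  qed (simp add: sym_cocycle_single word2_def cocycle3_def delta3_def)
qed (simp_all add: sym_cocycle_add cocycle3_add, simp add: cocycle3_def delta3_def)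

end

section \<open>Ideals of relations and coboundaries\<close>

lemma single_relation_closed:
  assumes I: "ideal I (free_algebra B)" and "r \<in> I" "u \<in> lists B" "v \<in> lists B"
  shows "Poly_Mapping.single u c * r * Poly_Mapping.single v d \<in> I"
  by (intro ideal_free_algebraD(6,7)[OF I] assms(2) keys_single_lists assms(3,4))

lemma single_mult_singles [simp]:
  "Poly_Mapping.single u c * Poly_Mapping.single w k * Poly_Mapping.single v d =
    Poly_Mapping.single (u @ w @ v) (c * k * d)"
  by (simp add: mult_single plus_list_def)

lemma functional_expansion:
  fixes a :: "'p::prime_card mod_ring ^ 'n \<Rightarrow> 'p mod_ring"
  assumes "additive a"
  shows "a = (\<lambda>v. \<Sum>i\<in>UNIV. a (axis i 1) * v $ i)"
proof
  fix v
  have "a v = a (\<Sum>i\<in>UNIV. v $ i *s axis i 1)"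
    by (simp add: basis_expansion)
  then show "a v = (\<Sum>i\<in>UNIV. a (axis i 1) * v $ i)"
    by (simp add: additive.sum[OF assms] additive_imp_linear[OF assms] mult.commute)
qed

abbreviation coord :: "'n \<Rightarrow> 'f ^ 'n \<Rightarrow> 'f" where
  "coord i \<equiv> \<lambda>v. v $ i"

text \<open>Only the spanning half of a normal form: nothing is claimed about uniqueness of the
  coefficients \<open>t\<close>, which the invariants settle later.\<close>

definition reduces ::
  "('w list \<Rightarrow>\<^sub>0 'f::field) set \<Rightarrow> 'i set \<Rightarrow> ('i \<Rightarrow> 'w list) \<Rightarrow> ('w list \<Rightarrow>\<^sub>0 'f) \<Rightarrow> bool" where
  "reduces I T word x \<longleftrightarrow> (\<exists>t. x - (\<Sum>i\<in>T. Poly_Mapping.single (word i) (t i)) \<in> I)"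

lemma reduces_ideal:
  assumes "x \<in> I"
  shows "reduces I T word x"
  unfolding reduces_def by (rule exI[of _ "\<lambda>_. 0"]) (use assms in simp)

lemma reduces_add:
  assumes I: "ideal I (free_algebra B)" and "reduces I T word x" "reduces I T word y"
  shows "reduces I T word (x + y)"
proof -
  obtain s t where "x - (\<Sum>i\<in>T. Poly_Mapping.single (word i) (s i)) \<in> I"
    "y - (\<Sum>i\<in>T. Poly_Mapping.single (word i) (t i)) \<in> I"
    using assms(2,3) unfolding reduces_def by blast
  from ideal_free_algebraD(3)[OF I this]
  have "x + y - (\<Sum>i\<in>T. Poly_Mapping.single (word i) (s i + t i)) \<in> I"
    by (simp add: single_add sum.distrib algebra_simps)
  then show ?thesis unfolding reduces_def by (intro exI[of _ "\<lambda>i. s i + t i"])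
qed

lemma reduces_cong:
  assumes I: "ideal I (free_algebra B)" and "x - y \<in> I" "reduces I T word y"
  shows "reduces I T word x"
  using reduces_add[OF I reduces_ideal[OF assms(2)] assms(3)] by simp

lemma reduces_single:
  assumes I: "ideal I (free_algebra B)" and "finite T" "i \<in> T"
  shows "reduces I T word (Poly_Mapping.single (word i) c)"
proof -
  have "(\<Sum>j\<in>T. Poly_Mapping.single (word j) (if j = i then c else 0)) =
      (\<Sum>j\<in>T. if j = i then Poly_Mapping.single (word j) c else 0)"
    by (rule sum.cong) simp_all
  also have "\<dots> = Poly_Mapping.single (word i) c"
    using assms by simp
  finally show ?thesis
    unfolding reduces_def using ideal_free_algebraD(2)[OF I]
    by (intro exI[of _ "\<lambda>j. if j = i then c else 0"]) simp
qed

text \<open>Multilinearity of words modulo the ideal: one letter at a fixed position is expanded in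
  coordinates, by induction over the set of coordinates already included.\<close>

lemma reduces_expand:
  fixes I :: "(('p::prime_card mod_ring ^ 'n \<Rightarrow> 'p mod_ring) list \<Rightarrow>\<^sub>0 'p mod_ring) set"
  assumes I: "ideal I (free_algebra {a. additive a})" and rel: "tensor_relations dual \<subseteq> I"
    and uv: "u \<in> lists {a. additive a}" "v \<in> lists {a. additive a}" and a: "additive a"
    and coords: "\<And>i c. reduces I T word (Poly_Mapping.single (u @ coord i # v) c)"
  shows "reduces I T word (Poly_Mapping.single (u @ a # v) c)"
proof -
  let ?g = "\<lambda>S v. \<Sum>i\<in>S. a (axis i 1) * v $ i"
  have g: "additive (?g S)" for S
    by (simp add: additive_def sum.distrib algebra_simps)
  have smult: "Poly_Mapping.single (u @ (\<lambda>x. k * b x) # v) c - Poly_Mapping.single (u @ b # v) (c * k) \<in> I"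
    if "additive b" for k b
  proof -
    have "Poly_Mapping.single [\<lambda>x. k * b x] 1 - Poly_Mapping.single [b] k \<in> I"
      using subsetD[OF rel free_gen_smult_relation[OF that, of k]]
      by (simp add: free_gen_def free_scalar_def mult_single plus_list_def)
    from single_relation_closed[OF I this uv, of c 1] show ?thesis
      by (simp add: left_diff_distrib right_diff_distrib)
  qed
  have add: "Poly_Mapping.single (u @ (\<lambda>x. b x + b' x) # v) c - Poly_Mapping.single (u @ b # v) c
      - Poly_Mapping.single (u @ b' # v) c \<in> I"
    if "additive b" "additive b'" for b b'
  proof -
    have "Poly_Mapping.single [\<lambda>x. b x + b' x] 1 - Poly_Mapping.single [b] 1 - Poly_Mapping.single [b'] 1 \<in> I"
      using subsetD[OF rel free_gen_tensor_relation[OF that]] by (simp add: free_gen_def)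
    from single_relation_closed[OF I this uv, of c 1] show ?thesis
      by (simp add: left_diff_distrib right_diff_distrib)
  qed
  have "reduces I T word (Poly_Mapping.single (u @ ?g S # v) c)" if "finite S" for S
    using that
  proof (induction S)
    case empty
    \<comment> \<open>The zero functional is a letter like any other; the scalar relation with
      factor 0 puts words containing it into the ideal.\<close>
    have "additive (\<lambda>x :: 'p mod_ring ^ 'n. 0 :: 'p mod_ring)"
      by (simp add: additive_def)
    from smult[OF this, of 0] show ?case
      by (intro reduces_ideal) simp
  next
    case (insert i S)
    let ?x = "Poly_Mapping.single (u @ ?g (insert i S) # v) c"
    let ?y = "Poly_Mapping.single (u @ coord i # v) (c * a (axis i 1)) + Poly_Mapping.single (u @ ?g S # v) c"
    have "?x - ?y \<in> I"
      using ideal_free_algebraD(3)[OF I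
          add[OF additive_times[OF additive_nth[of i], of "a (axis i 1)"] g[of S]]
          smult[OF additive_nth[of i], of "a (axis i 1)"]]
        insert.hyps by (simp add: algebra_simps)
    then show ?case
      by (rule reduces_cong[OF I]) (intro reduces_add[OF I] coords insert.IH)
  qed
  from this[of UNIV] show ?thesis
    by (subst functional_expansion[OF a]) simp
qed

section \<open>Normal forms modulo the exterior and the symmetric ideal\<close>

abbreviation exterior_ideal ::
  "(('p::prime_card mod_ring ^ 'n \<Rightarrow> 'p mod_ring) list \<Rightarrow>\<^sub>0 'p mod_ring) set" where
  "exterior_ideal \<equiv> Idl\<^bsub>free_algebra (carrier dual)\<^esub> (exterior_relations dual)"

abbreviation symmetric_ideal ::
  "(('p::prime_card mod_ring ^ 'n \<Rightarrow> 'p mod_ring) list \<Rightarrow>\<^sub>0 'p mod_ring) set" where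
  "symmetric_ideal \<equiv> Idl\<^bsub>free_algebra (carrier dual)\<^esub> (symmetric_relations dual)"

lemma exterior_ideal: "ideal exterior_ideal (free_algebra {a. additive a})"
  using free_algebra_Idl_relation(1)[OF relations_closed(1)] by simp

lemma symmetric_ideal: "ideal symmetric_ideal (free_algebra {a. additive a})"
  using free_algebra_Idl_relation(1)[OF relations_closed(2)] by simp

lemma exterior_relations_in_ideal: "r \<in> exterior_relations dual \<Longrightarrow> r \<in> exterior_ideal"
  using free_algebra_Idl_relation(2)[OF relations_closed(1)] by blast

lemma symmetric_relations_in_ideal: "r \<in> symmetric_relations dual \<Longrightarrow> r \<in> symmetric_ideal"
  using free_algebra_Idl_relation(2)[OF relations_closed(2)] by blast

lemma exterior_square:
  assumes "additive a"
  shows "Poly_Mapping.single [a] 1 * Poly_Mapping.single [a] 1 \<in> exterior_ideal"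
  using assms by (intro exterior_relations_in_ideal) (force simp: exterior_relations_def free_gen_def)

lemma exterior_antisym:
  assumes a: "additive a" and b: "additive b"
  shows "Poly_Mapping.single [a, b] 1 + Poly_Mapping.single [b, a] 1 \<in> exterior_ideal"
proof -
  note I = ideal_free_algebraD[OF exterior_ideal]
  let ?ab = "\<lambda>v. a v + b v"
  define s t g r where "s = Poly_Mapping.single [a] (1 :: 'a mod_ring)"
    and "t = Poly_Mapping.single [b] (1 :: 'a mod_ring)"
    and "g = Poly_Mapping.single [?ab] (1 :: 'a mod_ring)" and "r = g - s - t"
  have keys: "Poly_Mapping.keys s \<subseteq> lists {a. additive a}" "Poly_Mapping.keys t \<subseteq> lists {a. additive a}"
      "Poly_Mapping.keys g \<subseteq> lists {a. additive a}"
    using a b additive_plus[OF a b] by (simp_all add: s_def t_def g_def)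
  have "r \<in> tensor_relations dual"
    using free_gen_tensor_relation[OF a b] by (simp add: r_def s_def t_def g_def free_gen_def)
  then have r: "r \<in> exterior_ideal"
    using relations_subset(1) by (intro exterior_relations_in_ideal) blast
  have squares: "s * s \<in> exterior_ideal" "t * t \<in> exterior_ideal" "g * g \<in> exterior_ideal"
    unfolding s_def t_def g_def by (intro exterior_square a b additive_plus)+
  \<comment> \<open>The usual polarisation of squares. Since \<open>g\<close> is a letter of its own
    and equals \<open>s + t\<close> only modulo \<open>r\<close>, the terms \<open>r * g\<close> and
    \<open>(s + t) * r\<close> appear.\<close>
  have "s * t + t * s = g * g - r * g - (s + t) * r - s * s - t * t"
    by (simp add: r_def algebra_simps)
  also have "\<dots> \<in> exterior_ideal"
    by (intro I squares r keys keys_plus_subset)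
  finally show ?thesis
    by (simp add: s_def t_def mult_single plus_list_def)
qed

text \<open>The index type carries no order; the numbering \<open>r\<close>, later an injection into
  the naturals, provides one.\<close>

definition sorted_triples :: "('n \<Rightarrow> nat) \<Rightarrow> ('n \<times> 'n \<times> 'n) set" where
  "sorted_triples r = {(i, j, l). r i < r j \<and> r j < r l}"

definition sorted_pairs :: "('n \<Rightarrow> nat) \<Rightarrow> ('n \<times> 'n) set" where
  "sorted_pairs r = {(i, j). r i \<le> r j}"

abbreviation word_triple :: "'n \<times> 'n \<times> 'n \<Rightarrow> ('f ^ 'n \<Rightarrow> 'f) list" where
  "word_triple \<equiv> \<lambda>(i, j, l). [coord i, coord j, coord l]"

abbreviation word_pair :: "'n \<times> 'n \<Rightarrow> ('f ^ 'n \<Rightarrow> 'f) list" where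
  "word_pair \<equiv> \<lambda>(i, j). [coord i, coord j]"

lemma exterior_reduces:
  fixes x :: "('p::prime_card mod_ring ^ 'n \<Rightarrow> 'p mod_ring) list \<Rightarrow>\<^sub>0 'p mod_ring"
  assumes r: "inj r" and "Poly_Mapping.keys x \<subseteq> {u \<in> lists {a. additive a}. length u = 3}"
  shows "reduces exterior_ideal (sorted_triples r) word_triple x"
  using assms(2)
proof (induction rule: keys_induct)
  note I = exterior_ideal and ID = ideal_free_algebraD[OF exterior_ideal]
  let ?R = "reduces exterior_ideal (sorted_triples r) word_triple ::
    (('p mod_ring ^ 'n \<Rightarrow> 'p mod_ring) list \<Rightarrow>\<^sub>0 'p mod_ring) \<Rightarrow> bool"
  {
    case zero
    show ?case by (intro reduces_ideal ID)
  next
    case (add x y)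
    then show ?case by (intro reduces_add[OF I])
  next
    case (single u c)
    \<comment> \<open>The premise is required for all coefficients because exchanging the letters
      negates \<open>c\<close>.\<close>
    have swap: "?R (Poly_Mapping.single (u @ coord j # coord i # v) c)"
      if "\<And>c. ?R (Poly_Mapping.single (u @ coord i # coord j # v) c)"
        "u \<in> lists {a. additive a}" "v \<in> lists {a. additive a}" for u v i j c
    proof -
      have "Poly_Mapping.single (u @ coord j # coord i # v) c
          - Poly_Mapping.single (u @ coord i # coord j # v) (- c) \<in> exterior_ideal"
        using single_relation_closed[OF I exterior_antisym[OF additive_nth additive_nth, of i j] that(2,3), of c 1]
        by (simp add: distrib_left distrib_right single_uminus add.commute)
      then show ?thesis
        by (rule reduces_cong[OF I]) (rule that(1))
    qed
    have eq: "?R (Poly_Mapping.single (u @ coord i # coord i # v) c)"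
      if "u \<in> lists {a. additive a}" "v \<in> lists {a. additive a}" for u v i c
      using single_relation_closed[OF I exterior_square[OF additive_nth, of i] that, of c 1]
      by (intro reduces_ideal) (simp add: mult_single plus_list_def)
    have sorted: "?R (Poly_Mapping.single [coord i, coord j, coord l] c)" if "r i < r j" "r j < r l" for i j l c
      using reduces_single[OF I, of "sorted_triples r" "(i, j, l)" word_triple c] that
      by (simp add: sorted_triples_def)
    have swap1: "?R (Poly_Mapping.single [coord j, coord i, coord l] c)"
      if "\<And>c. ?R (Poly_Mapping.single [coord i, coord j, coord l] c)" for i j l c
      using swap[of "[]" i j "[coord l]" c] that by (simp add: additive_nth)
    have swap2: "?R (Poly_Mapping.single [coord i, coord l, coord j] c)"
      if "\<And>c. ?R (Poly_Mapping.single [coord i, coord j, coord l] c)" for i j l c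
      using swap[of "[coord i]" j l "[]" c] that by (simp add: additive_nth)
    have eq12: "?R (Poly_Mapping.single [coord i, coord i, coord l] c)" for i l c
      using eq[of "[]" "[coord l]" i c] by (simp add: additive_nth)
    have basis: "?R (Poly_Mapping.single [coord i, coord j, coord l] c)" for i j l c
    proof -
      consider "i = j" | "i = l" | "j = l" | "r i < r j" "r j < r l" | "r i < r l" "r l < r j"
        | "r j < r i" "r i < r l" | "r j < r l" "r l < r i" | "r l < r i" "r i < r j" | "r l < r j" "r j < r i"
        by (metis injD[OF r] linorder_neqE_nat)
      then show ?thesis
      proof cases
        case 1 then show ?thesis using eq12 by simp
      next
        case 2 then show ?thesis using swap2[OF eq12] by simp
      next
        case 3 then show ?thesis using swap1[OF swap2[OF eq12]] by simp
      next
        case 4 then show ?thesis using sorted by simp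
      next
        case 5 then show ?thesis using swap2[OF sorted] by simp
      next
        case 6 then show ?thesis using swap1[OF sorted] by simp
      next
        case 7 then show ?thesis using swap1[OF swap2[OF sorted]] by simp
      next
        case 8 then show ?thesis using swap2[OF swap1[OF sorted]] by simp
      next
        case 9 then show ?thesis using swap1[OF swap2[OF swap1[OF sorted]]] by simp
      qed
    qed
    have rel: "tensor_relations dual \<subseteq> exterior_ideal"
      using relations_subset(1) exterior_relations_in_ideal by blast
    from single obtain a1 a2 a3 where u: "u = [a1, a2, a3]" and a: "additive a1" "additive a2" "additive a3"
      by (auto simp: length_eq_3_iff)
    note expand = reduces_expand[OF I rel, where T = "sorted_triples r" and word = word_triple]
    have "?R (Poly_Mapping.single [coord i, coord j, a3] c)" for i j c
      using expand[of "[coord i, coord j]" "[]" a3] basis a by (simp add: additive_nth)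
    then have "?R (Poly_Mapping.single [coord i, a2, a3] c)" for i c
      using expand[of "[coord i]" "[a3]" a2] a by (simp add: additive_nth)
    then show ?case
      using expand[of "[]" "[a2, a3]" a1] a by (simp add: u)
  }
qed

lemma symmetric_reduces:
  fixes x :: "('p::prime_card mod_ring ^ 'n \<Rightarrow> 'p mod_ring) list \<Rightarrow>\<^sub>0 'p mod_ring"
  assumes "Poly_Mapping.keys x \<subseteq> {u \<in> lists {a. additive a}. length u = 2}"
  shows "reduces symmetric_ideal (sorted_pairs r) word_pair x"
  using assms
proof (induction rule: keys_induct)
  note I = symmetric_ideal and ID = ideal_free_algebraD[OF symmetric_ideal]
  let ?R = "reduces symmetric_ideal (sorted_pairs r) word_pair ::
    (('p mod_ring ^ 'n \<Rightarrow> 'p mod_ring) list \<Rightarrow>\<^sub>0 'p mod_ring) \<Rightarrow> bool"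
  {
    case zero
    show ?case by (intro reduces_ideal ID)
  next
    case (add x y)
    then show ?case by (intro reduces_add[OF I])
  next
    case (single u c)
    have sorted: "?R (Poly_Mapping.single [coord i, coord j] c)" if "r i \<le> r j" for i j c
      using reduces_single[OF I, of "sorted_pairs r" "(i, j)" word_pair c] that
      by (simp add: sorted_pairs_def)
    have basis: "?R (Poly_Mapping.single [coord i, coord j] c)" for i j c
    proof (cases "r i \<le> r j")
      case False
      have "Poly_Mapping.single [coord i, coord j] 1 - Poly_Mapping.single [coord j, coord i] (1 :: 'p mod_ring)
          \<in> symmetric_ideal"
        by (rule symmetric_relations_in_ideal)
          (force simp: symmetric_relations_def free_gen_def mult_single plus_list_def additive_nth)
      from single_relation_closed[OF I this, of "[]" "[]" c 1]
      have "Poly_Mapping.single [coord i, coord j] c - Poly_Mapping.single [coord j, coord i] c \<in> symmetric_ideal"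
        by (simp add: left_diff_distrib right_diff_distrib)
      then show ?thesis
        by (rule reduces_cong[OF I]) (use sorted False in simp)
    qed (use sorted in simp)
    have rel: "tensor_relations dual \<subseteq> symmetric_ideal"
      using relations_subset(2) symmetric_relations_in_ideal by blast
    from single obtain a1 a2 where u: "u = [a1, a2]" and a: "additive a1" "additive a2"
      by (auto simp: length_eq_2_iff)
    note expand = reduces_expand[OF I rel, where T = "sorted_pairs r" and word = word_pair]
    have "?R (Poly_Mapping.single [coord i, a2] c)" for i c
      using expand[of "[coord i]" "[]" a2] basis a by (simp add: additive_nth)
    then show ?case
      using expand[of "[]" "[a2]" a1] a by (simp add: u)
  }
qed

text \<open>\<open>E 1\<close> is a \<open>p\<close>-th root of \<open>e c\<close>, hence killed by
  the square of \<open>p\<close>. On multiples of \<open>p\<close> the map \<open>E\<close> is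
  \<open>e\<close> scaled by \<open>c\<close>, which converts integral identities between residues
  into identities between values of \<open>e\<close>.\<close>

lemma (in torsion_embedding) divisible_e:
  "\<exists>E :: int \<Rightarrow> 'a. additive E \<and> (\<forall>s :: 'p mod_ring. E (int CARD('p) * residue s) = e (c * s))"
proof -
  obtain E :: "int \<Rightarrow> 'a" where E: "additive E" "E (int CARD('p)) = e c"
    using divisible by blast
  have "E (int CARD('p) * residue s) = e (c * s)" for s
  proof (induction s rule: mod_ring_induct)
    case 1
    show ?case by (simp add: additive.zero[OF E(1)])
  next
    case (2 n)
    then show ?case
      using residue_of_nat[of n, where 'p='p] residue_of_nat[of "Suc n", where 'p='p]
      by (simp add: distrib_left additive.add[OF E(1)] E(2) e_add)
  qed
  then show ?thesis using E(1) by blast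
qed

section \<open>Relations of the algebras become coboundaries when \<open>p\<close> is odd\<close>

locale odd_torsion_embedding = torsion_embedding e
  for e :: "'p::prime_card mod_ring \<Rightarrow> 'a::ab_group_add" +
  assumes odd_card: "odd CARD('p)"
begin

lemma two_neq_0: "(2 :: 'p mod_ring) \<noteq> 0"
proof
  assume "(2 :: 'p mod_ring) = 0"
  then have "CARD('p) dvd 2"
    using of_nat_0_mod_ring_dvd[of 2, where 'a='p] by simp
  then show False
    using odd_card dvd_imp_le[of "CARD('p)" 2] prime_gt_1_nat[OF prime_card[where 'a='p]]
    by (cases "CARD('p) = 2") auto
qed

lemma halves: "c / 2 + c / 2 = (c :: 'p mod_ring)"
  using two_neq_0 by (simp add: field_simps)

lemma sum_UNIV_mod_ring: "(\<Sum>t\<in>UNIV. t) = (0 :: 'p mod_ring)"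
proof -
  define S where "S = (\<Sum>t\<in>UNIV. t :: 'p mod_ring)"
  have "S = (\<Sum>t\<in>UNIV. - t)"
    unfolding S_def by (rule sum.reindex_bij_witness[of _ uminus uminus]) auto
  also have "\<dots> = - S"
    by (simp add: sum_negf S_def)
  finally have "S + S = 0"
    by (metis add.right_inverse)
  then have "2 * S = 0"
    by simp
  then show ?thesis
    using two_neq_0 by (simp add: S_def)
qed

lemma coboundary3_ext_ideal:
  assumes "r \<in> exterior_ideal"
  shows "coboundary3 (ext_cocycle r :: 'p mod_ring ^ 'n \<Rightarrow> _)"
proof (rule free_algebra_Idl_induct[OF relations_closed(1) assms])
  fix r and u v :: "('p mod_ring ^ 'n \<Rightarrow> 'p mod_ring) list" and c d :: "'p mod_ring"
  assume r: "r \<in> exterior_relations (dual :: (_, 'p mod_ring ^ 'n \<Rightarrow> _) module)"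
    and uv: "u \<in> lists (carrier dual)" "v \<in> lists (carrier (dual :: (_, 'p mod_ring ^ 'n \<Rightarrow> _) module))"
  show "coboundary3 (ext_cocycle (Poly_Mapping.single u c * r * Poly_Mapping.single v d))"
    using r
  proof (cases rule: exterior_relations_cases)
    case tensor
    have "ext_cocycle (Poly_Mapping.single u c * r * Poly_Mapping.single v d) = (\<lambda>_ _ _. 0)"
      using tensor
    proof (cases rule: tensor_relations_cases)
      case (add a b)
      show ?thesis
        by (simp add: add left_diff_distrib right_diff_distrib ext_cocycle_diff ext_cocycle_single word3_add
            e_add[symmetric] e_diff[symmetric] distrib_left)
    next
      case (smult k a)
      show ?thesis
        by (simp add: smult left_diff_distrib right_diff_distrib ext_cocycle_diff ext_cocycle_single word3_times
            e_diff[symmetric])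
    qed
    then show ?thesis using coboundary3_0 by simp
  next
    case (square a)
    have eq: "Poly_Mapping.single u c * r * Poly_Mapping.single v d = Poly_Mapping.single (u @ a # a # v) (c * d)"
      by (simp add: square)
    \<comment> \<open>\<open>k\<close> is half of the coefficient; writing the latter as
      \<open>k + k\<close> matches the two mixed terms in the expansion of a square.\<close>
    define k where "k = c * d / 2"
    have k: "c * d = k + k"
      by (simp add: k_def halves)
    show ?thesis
    proof (cases "length (u @ a # a # v) = 3")
      case True
      from length_append_Cons_3[OF this]
      consider b where "u = []" "v = [b]" | b where "u = [b]" "v = []"
        by auto
      then show ?thesis
      proof cases
        case 1
        then have b: "additive b" using uv by simp
        show ?thesis
          unfolding eq unfolding 1 ext_cocycle_single k
          by (intro coboundary3I[of _ "\<lambda>x y. - e (k * a x * a x * b y)"])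
            (simp add: delta2_def additive.add[OF square(1)] additive.add[OF b] e_add[symmetric] e_diff[symmetric] e_minus[symmetric] algebra_simps)
      next
        case 2
        then have b: "additive b" using uv by simp
        show ?thesis
          unfolding eq unfolding 2 ext_cocycle_single k
          \<comment> \<open>The sign is opposite to the previous case because the differential has
            to pass the degree 1 factor \<open>b\<close>.\<close>
          by (intro coboundary3I[of _ "\<lambda>x y. e (k * b x * a y * a y)"])
            (simp add: delta2_def additive.add[OF square(1)] additive.add[OF b] e_add[symmetric] e_diff[symmetric] algebra_simps)
      qed
    next
      case False
      then show ?thesis
        unfolding eq ext_cocycle_single by (simp add: word3_def coboundary3_0)
    qed
  qed
qed (simp_all add: ext_cocycle_add ext_cocycle_minus coboundary3_0 coboundary3_add coboundary3_minus)

lemma coboundary3_delta1_times: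
  assumes "additive b"
  shows "coboundary3 (\<lambda>x y z. e (c * delta1 w x y * b z))"
  by (rule coboundary3I[of _ "\<lambda>x y. e (c * w x * b y)"])
    (simp add: delta1_def delta2_def additive.add[OF assms] e_add[symmetric] e_diff[symmetric] algebra_simps)

text \<open>With \<open>E\<close> an extension of \<open>e\<close> to roots of unity of order \<open>p\<^sup>2\<close>, the coboundary of \<open>E(a(x) b(y))\<close>
  exchanges \<open>\<beta>(a) b\<close> and \<open>a \<beta>(b)\<close>, and the coboundary of \<open>\<beta>(b)(x, y) a(x + y)\<close> exchanges \<open>\<beta>(b) a\<close> and
  \<open>a \<beta>(b)\<close> (a cup-1 product).\<close>

lemma coboundary3_carry_swap:
  assumes a: "additive a" and b: "additive b"
  shows "coboundary3 (\<lambda>x y z. e (c * carry (a x) (a y) * b z) - e (c * carry (b x) (b y) * a z))"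
proof -
  obtain E :: "int \<Rightarrow> 'a" where E: "additive E"
    and Ee: "\<And>s :: 'p mod_ring. E (int CARD('p) * residue s) = e (c * s)"
    using divisible_e[of c] by blast
  have Ee': "E (int CARD('p) * residue s * residue t) = e (c * s * t)" for s t :: "'p mod_ring"
  proof (induction t rule: mod_ring_induct)
    case 1
    show ?case by (simp add: additive.zero[OF E])
  next
    case (2 n)
    then show ?case
      using residue_of_nat[of n, where 'p='p] residue_of_nat[of "Suc n", where 'p='p]
      by (simp add: distrib_left additive.add[OF E] Ee e_add)
  qed
  define h where "h = (\<lambda>x y. E (residue (a x) * residue (b y)))"
  define k where "k = (\<lambda>x y. e (c * carry (b x) (b y) * (a x + a y)))"
  have h: "delta2 h x y z = e (c * carry (a x) (a y) * b z) - e (c * carry (b y) (b z) * a x)" for x y z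
  proof -
    have "delta2 h x y z = E ((residue (a x) + residue (a y) - residue (a x + a y)) * residue (b z)
        - (residue (b y) + residue (b z) - residue (b y + b z)) * residue (a x))"
      by (simp add: delta2_def h_def additive.add[OF a] additive.add[OF b]
          additive.add[OF E, symmetric] additive.diff[OF E, symmetric] algebra_simps)
    then show ?thesis
      unfolding carry_residue by (simp add: additive.diff[OF E] Ee')
  qed
  have k: "delta2 k x y z = e (c * carry (b x) (b y) * a z) - e (c * carry (b y) (b z) * a x)" for x y z
  proof -
    have "delta2 k x y z - (e (c * carry (b x) (b y) * a z) - e (c * carry (b y) (b z) * a x)) =
        e (c * (a x + a y + a z) * delta2 carry (b x) (b y) (b z))"
      by (simp add: delta2_def k_def additive.add[OF a] additive.add[OF b]
          e_add[symmetric] e_diff[symmetric] algebra_simps)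
    then show ?thesis
      by (simp add: cocycle2D[OF cocycle2_carry])
  qed
  show ?thesis
    by (rule coboundary3I[of _ "\<lambda>x y. h x y - k x y"])
      (use h k in \<open>simp add: delta2_diff\<close>)
qed

text \<open>\<open>sym_cocycle\<close> is strictly linear in the second letter. In the first it is
  linear only up to a \<open>delta1\<close>, by \<open>carry_add_args\<close> and
  \<open>carry_times\<close>; multiplied by the additive second letter, this error is a coboundary.
  Commutators are covered by \<open>coboundary3_carry_swap\<close>.\<close>

lemma coboundary3_sym_ideal:
  assumes "r \<in> symmetric_ideal"
  shows "coboundary3 (sym_cocycle r :: 'p mod_ring ^ 'n \<Rightarrow> _)"
proof (rule free_algebra_Idl_induct[OF relations_closed(2) assms])
  fix r and u v :: "('p mod_ring ^ 'n \<Rightarrow> 'p mod_ring) list" and c d :: "'p mod_ring"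
  assume r: "r \<in> symmetric_relations (dual :: (_, 'p mod_ring ^ 'n \<Rightarrow> _) module)"
    and uv: "u \<in> lists (carrier dual)" "v \<in> lists (carrier (dual :: (_, 'p mod_ring ^ 'n \<Rightarrow> _) module))"
  show "coboundary3 (sym_cocycle (Poly_Mapping.single u c * r * Poly_Mapping.single v d))"
    using r
  proof (cases rule: symmetric_relations_cases)
    case tensor
    then show ?thesis
    proof (cases rule: tensor_relations_cases)
      case (add a b)
      have eq: "sym_cocycle (Poly_Mapping.single u c * r * Poly_Mapping.single v d) = (\<lambda>x y z.
          e (c * d * (word2 x y z (u @ (\<lambda>v. a v + b v) # v) - word2 x y z (u @ a # v) - word2 x y z (u @ b # v))))"
        by (simp add: add left_diff_distrib right_diff_distrib sym_cocycle_diff sym_cocycle_single e_diff)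
      show ?thesis
      proof (cases "length (u @ a # v) = 2")
        case True
        from length_append_Cons_2[OF this]
        consider f where "u = []" "v = [f]" | f where "u = [f]" "v = []" by auto
        then show ?thesis
        proof cases
          case 1
          then have f: "additive f" using uv by simp
          show ?thesis
            unfolding eq unfolding 1
          proof -
            have "carry (a x + b x) (a y + b y) - carry (a x) (a y) - carry (b x) (b y) =
                - delta1 (\<lambda>v. carry (b v) (a v)) x y" for x y
              using carry_add_args[of "a x" "b x" "a y" "b y"]
              by (simp add: delta1_def additive.add[OF add(1)] additive.add[OF add(2)])
            then have *: "e (c * d * (word2 x y z ([] @ (\<lambda>v. a v + b v) # [f]) - word2 x y z ([] @ a # [f])
                - word2 x y z ([] @ b # [f]))) = e (- (c * d) * delta1 (\<lambda>v. carry (b v) (a v)) x y * f z)" for x y z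
              by (simp add: left_diff_distrib[symmetric] mult.assoc)
            show "coboundary3 (\<lambda>x y z. e (c * d * (word2 x y z ([] @ (\<lambda>v. a v + b v) # [f])
                - word2 x y z ([] @ a # [f]) - word2 x y z ([] @ b # [f]))))"
              unfolding * by (rule coboundary3_delta1_times[OF f])
          qed
        next
          case 2
          then show ?thesis
            unfolding eq unfolding 2 by (simp add: distrib_left coboundary3_0)
        qed
      next
        case False
        then show ?thesis
          unfolding eq by (simp add: word2_def coboundary3_0)
      qed
    next
      case (smult k a)
      have eq: "sym_cocycle (Poly_Mapping.single u c * r * Poly_Mapping.single v d) = (\<lambda>x y z.
          e (c * d * (word2 x y z (u @ (\<lambda>v. k * a v) # v) - k * word2 x y z (u @ a # v))))"
        by (simp add: smult left_diff_distrib right_diff_distrib sym_cocycle_diff sym_cocycle_single e_diff) (simp add: mult_ac)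
      show ?thesis
      proof (cases "length (u @ a # v) = 2")
        case True
        from length_append_Cons_2[OF this]
        consider f where "u = []" "v = [f]" | f where "u = [f]" "v = []" by auto
        then show ?thesis
        proof cases
          case 1
          then have f: "additive f" using uv by simp
          obtain w where w: "\<And>s t :: 'p mod_ring. carry (k * s) (k * t) = k * carry s t + delta1 w s t"
            using carry_times[of k] by blast
          have "delta1 w (a x) (a y) = delta1 (\<lambda>v. w (a v)) x y" for x y
            by (simp add: delta1_def additive.add[OF smult(1)])
          then have *: "e (c * d * (word2 x y z ([] @ (\<lambda>v. k * a v) # [f]) - k * word2 x y z ([] @ a # [f])))
              = e (c * d * delta1 (\<lambda>v. w (a v)) x y * f z)" for x y z
            by (simp add: w distrib_right mult.assoc)
          show ?thesis
            unfolding eq unfolding 1 unfolding * by (rule coboundary3_delta1_times[OF f])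
        next
          case 2
          then show ?thesis
            unfolding eq unfolding 2 by (simp add: mult_ac coboundary3_0)
        qed
      next
        case False
        then show ?thesis
          unfolding eq by (simp add: word2_def coboundary3_0)
      qed
    qed
  next
    case (commutator a b)
    have eq: "sym_cocycle (Poly_Mapping.single u c * r * Poly_Mapping.single v d) =
        (\<lambda>x y z. e (c * d * word2 x y z (u @ a # b # v)) - e (c * d * word2 x y z (u @ b # a # v)))"
      by (simp add: commutator left_diff_distrib right_diff_distrib sym_cocycle_diff sym_cocycle_single)
    show ?thesis
    proof (cases "u = [] \<and> v = []")
      case True
      then show ?thesis
        unfolding eq using coboundary3_carry_swap[OF commutator(1,2), of "c * d"] by (simp add: mult.assoc)
    next
      case False
      then show ?thesis
        unfolding eq by (cases "u = []") (simp_all add: word2_def coboundary3_0)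
    qed
  qed
qed (simp_all add: sym_cocycle_add sym_cocycle_minus coboundary3_0 coboundary3_add coboundary3_minus)

end

section \<open>Detecting classes by invariants\<close>

lemma axis_nth_if: "axis i (x :: 'a::zero) $ j = (if i = j then x else 0)"
  by (auto simp: axis_def)

lemma word3_map: "word3 x y z (map (\<lambda>\<phi> v. \<phi> (\<alpha> v)) u) = word3 (\<alpha> x) (\<alpha> y) (\<alpha> z) u"
  by (simp add: word3_def)

lemma word2_map: "word2 x y z (map (\<lambda>\<phi> v. \<phi> (\<alpha> v)) u) = word2 (\<alpha> x) (\<alpha> y) (\<alpha> z) u"
  by (simp add: word2_def)

text \<open>The quadratic form of a word of length 2; by \<open>sum_carry\<close> it is what the
  cyclic trace sees of the corresponding cocycle.\<close>

definition square_word :: "'v \<Rightarrow> ('v \<Rightarrow> 'f::comm_ring_1) list \<Rightarrow> 'f" where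
  "square_word v u = (if length u = 2 then (u ! 0) v * (u ! 1) v else 0)"

context torsion_embedding
begin

lemma ext_cocycle_map:
  "ext_cocycle (free_algebra_map (\<lambda>\<phi> v. \<phi> (\<alpha> v)) a) x y z = ext_cocycle a (\<alpha> x) (\<alpha> y) (\<alpha> z)"
  by (simp add: ext_cocycle_def eval_words_free_algebra_map word3_map cong: if_cong)

lemma sym_cocycle_map:
  "sym_cocycle (free_algebra_map (\<lambda>\<phi> v. \<phi> (\<alpha> v)) a) x y z = sym_cocycle a (\<alpha> x) (\<alpha> y) (\<alpha> z)"
  by (simp add: sym_cocycle_def eval_words_free_algebra_map word2_map)

lemma alternation_add:
  "alternation (\<lambda>x y z. f x y z + g x y z) x y z = alternation f x y z + (alternation g x y z :: 'a)"
  by (simp add: alternation_def algebra_simps)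

lemma cyclic_trace_add:
  "cyclic_trace (\<lambda>x y z. f x y z + g x y z) v = cyclic_trace f v + (cyclic_trace g v :: 'a)"
  by (simp add: cyclic_trace_def sum.distrib)

text \<open>The carry makes the cocycle symmetric in its first two arguments, so the six terms
  cancel in pairs.\<close>

lemma alternation_sym_cocycle:
  fixes x y z :: "'p mod_ring ^ 'n"
  shows "alternation (sym_cocycle b) x y z = 0"
proof -
  have "word2 x y z = word2 y x z" for x y z :: "'p mod_ring ^ 'n"
    by (simp add: word2_def fun_eq_iff carry_commute)
  then have "sym_cocycle b x y z = sym_cocycle b y x z" for x y z
    unfolding sym_cocycle_def by metis
  then show ?thesis
    by (simp add: alternation_def)
qed

lemma cyclic_trace_sym_cocycle:
  assumes "Poly_Mapping.keys b \<subseteq> lists {\<phi>. additive \<phi>}"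
  shows "cyclic_trace (sym_cocycle b) v = e (eval_words (square_word v) b)"
  using assms
proof (induction rule: keys_induct)
  case (single u c)
  show ?case
  proof (cases "length u = 2")
    case True
    then obtain \<alpha> \<beta> where u: "u = [\<alpha>, \<beta>]" by (auto simp: length_eq_2_iff)
    then have \<alpha>: "additive \<alpha>" using single by simp
    have "cyclic_trace (sym_cocycle (Poly_Mapping.single u c)) v =
        e (c * (\<Sum>t\<in>UNIV. carry (\<alpha> v) (t * \<alpha> v)) * \<beta> v)"
      by (simp add: cyclic_trace_def sym_cocycle_single u additive_imp_linear[OF \<alpha>] e_sum[symmetric]
          sum_distrib_left sum_distrib_right mult_ac)
    then show ?thesis
      by (simp add: sum_carry square_word_def u mult.assoc)
  qed (simp add: cyclic_trace_def sym_cocycle_single word2_def square_word_def)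
qed (simp_all add: sym_cocycle_add cyclic_trace_add eval_words_add e_add, simp add: cyclic_trace_def)

end

context odd_torsion_embedding
begin

text \<open>On a line through \<open>v\<close> the trilinear form depends on \<open>t\<close> only
  by a factor \<open>t\<close>, and the sum of all \<open>t\<close> is 0 for odd
  \<open>p\<close>.\<close>

lemma cyclic_trace_ext_cocycle:
  assumes "Poly_Mapping.keys a \<subseteq> lists {\<phi>. additive \<phi>}"
  shows "cyclic_trace (ext_cocycle a) v = 0"
  using assms
proof (induction rule: keys_induct)
  case (single u c)
  show ?case
  proof (cases "length u = 3")
    case True
    then obtain \<alpha> \<beta> \<gamma> where u: "u = [\<alpha>, \<beta>, \<gamma>]" by (auto simp: length_eq_3_iff)
    then have \<beta>: "additive \<beta>" using single by simp
    have "cyclic_trace (ext_cocycle (Poly_Mapping.single u c)) v =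
        e (c * \<alpha> v * (\<Sum>t\<in>UNIV. t) * \<beta> v * \<gamma> v)"
      by (simp add: cyclic_trace_def ext_cocycle_single u additive_imp_linear[OF \<beta>] e_sum[symmetric]
          sum_distrib_left sum_distrib_right mult_ac)
    then show ?thesis
      by (simp add: sum_UNIV_mod_ring)
  qed (simp add: cyclic_trace_def ext_cocycle_single word3_def)
qed (simp_all add: ext_cocycle_add cyclic_trace_add, simp add: cyclic_trace_def)

text \<open>\<open>a\<close> and \<open>b\<close> are replaced by their reductions, which changes
  the cocycles by coboundaries only. Each invariant then sees one of the two reductions, and
  suitable arguments isolate its coefficients one by one.\<close>

lemma kernel_in_ideals:
  fixes a b :: "('p mod_ring ^ 'n \<Rightarrow> 'p mod_ring) list \<Rightarrow>\<^sub>0 'p mod_ring"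
  assumes a: "Poly_Mapping.keys a \<subseteq> {u \<in> lists {\<phi>. additive \<phi>}. length u = 3}"
    and b: "Poly_Mapping.keys b \<subseteq> {u \<in> lists {\<phi>. additive \<phi>}. length u = 2}"
    and cob: "coboundary3 (\<lambda>x y z. ext_cocycle a x y z + sym_cocycle b x y z)"
  shows "a \<in> exterior_ideal" "b \<in> symmetric_ideal"
proof -
  have a': "Poly_Mapping.keys a \<subseteq> lists {\<phi>. additive \<phi>}" and b': "Poly_Mapping.keys b \<subseteq> lists {\<phi>. additive \<phi>}"
    using a b by blast+
  obtain r :: "'n \<Rightarrow> nat" where r: "inj r"
    using finite_imp_inj_to_nat_seg[of "UNIV :: 'n set"] by auto
  define T where "T = sorted_triples r"
  define P where "P = sorted_pairs r"
  obtain t where t: "a - (\<Sum>\<tau>\<in>T. Poly_Mapping.single (word_triple \<tau>) (t \<tau>)) \<in> exterior_ideal" (is "a - ?a \<in> _")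
    using exterior_reduces[OF r a] unfolding reduces_def T_def by blast
  obtain s where s: "b - (\<Sum>\<tau>\<in>P. Poly_Mapping.single (word_pair \<tau>) (s \<tau>)) \<in> symmetric_ideal" (is "b - ?b \<in> _")
    using symmetric_reduces[OF b, of r] unfolding reduces_def P_def by blast
  have alt0: "alternation (ext_cocycle ?a) x y z = 0" for x y z
  proof -
    have "0 = alternation (\<lambda>x y z. ext_cocycle a x y z + sym_cocycle b x y z) x y z"
      using alternation_coboundary3[OF cob] by simp
    also have "\<dots> = alternation (ext_cocycle (?a + (a - ?a))) x y z"
      by (simp add: alternation_add alternation_sym_cocycle)
    also have "\<dots> = alternation (ext_cocycle ?a) x y z + alternation (ext_cocycle (a - ?a)) x y z"
      unfolding ext_cocycle_add alternation_add ..
    finally show ?thesis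
      using alternation_coboundary3[OF coboundary3_ext_ideal[OF t]] by simp
  qed
  have alt1: "alternation (ext_cocycle ?a) x y z =
      e (\<Sum>\<tau>\<in>T. t \<tau> * alternation (\<lambda>x y z. word3 x y z (word_triple \<tau>)) x y z)" for x y z
    by (simp add: alternation_def ext_cocycle_def additive.sum[OF additive_eval_words]
        e_add[symmetric] e_diff[symmetric] sum.distrib sum_subtractf algebra_simps)
  have alt: "(\<Sum>\<tau>\<in>T. t \<tau> * alternation (\<lambda>x y z. word3 x y z (word_triple \<tau>)) x y z) = 0" for x y z
    using alt0[of x y z] unfolding alt1 by (rule e_eq_0)
  have "t \<tau> = 0" if \<tau>: "\<tau> \<in> T" for \<tau>
  proof -
    obtain i j l where ijl: "\<tau> = (i, j, l)" "r i < r j" "r j < r l"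
      using \<tau> by (auto simp: T_def sorted_triples_def)
    \<comment> \<open>At unit vectors the alternation tests \<sigma> against all six orders of
      \<open>i, j, l\<close>; only the increasing one is a sorted triple.\<close>
    have "alternation (\<lambda>x y z. word3 x y z (word_triple \<sigma>)) (axis i 1) (axis j 1) (axis l (1 :: 'p mod_ring))
        = (if \<sigma> = \<tau> then 1 else 0)" if "\<sigma> \<in> T" for \<sigma>
    proof -
      have "word3 (axis a 1) (axis b 1) (axis c (1 :: 'p mod_ring)) (word_triple \<sigma>)
          = (if \<sigma> = (a, b, c) then 1 else 0)" for a b c :: 'n
        by (cases \<sigma>) (auto simp: axis_nth_if)
      moreover have "\<sigma> \<noteq> (i, l, j)" "\<sigma> \<noteq> (j, i, l)" "\<sigma> \<noteq> (j, l, i)" "\<sigma> \<noteq> (l, i, j)" "\<sigma> \<noteq> (l, j, i)"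
        using that ijl by (auto simp: T_def sorted_triples_def)
      ultimately show ?thesis
        by (simp only: alternation_def ijl(1) if_False if_cancel simp_thms) simp
    qed
    then have "(\<Sum>\<sigma>\<in>T. t \<sigma> * alternation (\<lambda>x y z. word3 x y z (word_triple \<sigma>)) (axis i 1) (axis j 1) (axis l 1))
        = (\<Sum>\<sigma>\<in>T. if \<sigma> = \<tau> then t \<sigma> else 0)"
      by (intro sum.cong) simp_all
    also have "\<dots> = t \<tau>"
      using \<tau> by simp
    finally show ?thesis
      using alt by simp
  qed
  then show "a \<in> exterior_ideal"
    using t by simp
  have tr0: "cyclic_trace (sym_cocycle ?b) v = 0" for v
  proof -
    have "0 = cyclic_trace (\<lambda>x y z. ext_cocycle a x y z + sym_cocycle b x y z) v"
      using cyclic_trace_coboundary3[OF cob] by simp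
    also have "\<dots> = cyclic_trace (sym_cocycle (?b + (b - ?b))) v"
      by (simp add: cyclic_trace_add cyclic_trace_ext_cocycle[OF a'])
    also have "\<dots> = cyclic_trace (sym_cocycle ?b) v + cyclic_trace (sym_cocycle (b - ?b)) v"
      unfolding sym_cocycle_add cyclic_trace_add ..
    finally show ?thesis
      using cyclic_trace_coboundary3[OF coboundary3_sym_ideal[OF s]] by simp
  qed
  have keys: "Poly_Mapping.keys ?b \<subseteq> lists {\<phi>. additive \<phi>}"
    using keys_minus_subset[OF b' subsetD[OF ideal_free_algebraD(1)[OF symmetric_ideal] s, simplified]] by simp
  have "eval_words (square_word v) ?b = 0" for v
    using tr0[of v] unfolding cyclic_trace_sym_cocycle[OF keys] by (rule e_eq_0)
  then have q: "(\<Sum>\<tau>\<in>P. s \<tau> * square_word v (word_pair \<tau>)) = 0" for v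
    by (simp add: additive.sum[OF additive_eval_words])
  have diag: "s (i, i) = 0" for i
  proof -
    have "square_word (axis i (1 :: 'p mod_ring)) (word_pair \<sigma>) = (if \<sigma> = (i, i) then 1 else 0)" for \<sigma>
      by (cases \<sigma>) (auto simp: square_word_def axis_nth_if)
    then have "(\<Sum>\<sigma>\<in>P. s \<sigma> * square_word (axis i 1) (word_pair \<sigma>)) = (\<Sum>\<sigma>\<in>P. if \<sigma> = (i, i) then s \<sigma> else 0)"
      by (intro sum.cong) simp_all
    also have "\<dots> = s (i, i)"
      by (simp add: P_def sorted_pairs_def)
    finally show ?thesis using q by simp
  qed
  have "s \<tau> = 0" if \<tau>: "\<tau> \<in> P" for \<tau>
  proof -
    obtain i j where ij: "\<tau> = (i, j)" "r i \<le> r j"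
      using \<tau> by (auto simp: P_def sorted_pairs_def)
    show ?thesis
    proof (cases "i = j")
      case True
      then show ?thesis using diag ij by simp
    next
      case False
      \<comment> \<open>At the sum of two unit vectors the pairs \<open>(i, i)\<close>,
        \<open>(j, j)\<close> and \<open>(i, j)\<close> are seen; the first two drop out by
        \<open>diag\<close>, and \<open>(j, i)\<close> is not sorted.\<close>
      have "s \<sigma> * square_word (axis i 1 + axis j (1 :: 'p mod_ring)) (word_pair \<sigma>) = (if \<sigma> = \<tau> then s \<sigma> else 0)"
        if "\<sigma> \<in> P" for \<sigma>
      proof -
        obtain i' j' where \<sigma>: "\<sigma> = (i', j')" "r i' \<le> r j'"
          using \<open>\<sigma> \<in> P\<close> by (auto simp: P_def sorted_pairs_def)
        have ji: "\<not> (i' = j \<and> j' = i)"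
          using \<sigma> ij False injD[OF r, of i j] by auto
        have "square_word (axis i 1 + axis j (1 :: 'p mod_ring)) (word_pair \<sigma>) =
            ((if i = i' then 1 else 0) + (if j = i' then 1 else 0)) *
            ((if i = j' then 1 else 0) + (if j = j' then 1 else 0))"
          by (simp only: \<sigma>(1) prod.case) (simp add: square_word_def axis_nth_if)
        then show ?thesis
          unfolding \<sigma>(1) ij(1)
          using ji False diag[of i] diag[of j]
          by (cases "i' = i"; cases "i' = j"; cases "j' = i"; cases "j' = j") simp_all
      qed
      then have "(\<Sum>\<sigma>\<in>P. s \<sigma> * square_word (axis i 1 + axis j 1) (word_pair \<sigma>))
          = (\<Sum>\<sigma>\<in>P. if \<sigma> = \<tau> then s \<sigma> else 0)"
        by (intro sum.cong) simp_all
      also have "\<dots> = s \<tau>"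
        using \<tau> by simp
      finally show ?thesis using q by simp
    qed
  qed
  then show "b \<in> symmetric_ideal"
    using s by simp
qed

text \<open>Each generator is a single word. The lengths are tracked along because the
  representatives must lie in degrees 3 and 2 of the algebras.\<close>

lemma gen3_represented:
  fixes f :: "'p mod_ring ^ 'n \<Rightarrow> 'p mod_ring ^ 'n \<Rightarrow> 'p mod_ring ^ 'n \<Rightarrow> 'a"
  assumes "gen3 f"
  shows "\<exists>a b. Poly_Mapping.keys a \<subseteq> {u \<in> lists {\<phi>. additive \<phi>}. length u = 3} \<and>
    Poly_Mapping.keys b \<subseteq> {u \<in> lists {\<phi>. additive \<phi>}. length u = 2} \<and>
    coboundary3 (\<lambda>x y z. f x y z - (ext_cocycle a x y z + sym_cocycle b x y z))"
  using assms
proof induction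
  case (trilinear a b c)
  then show ?case
    by (intro exI[of _ "Poly_Mapping.single [a, b, c] 1"] exI[of _ 0])
      (simp add: ext_cocycle_single coboundary3_0)
next
  case (carry a b)
  then show ?case
    by (intro exI[of _ 0] exI[of _ "Poly_Mapping.single [a, b] 1"])
      (simp add: sym_cocycle_single coboundary3_0)
next
  case (coboundary h)
  show ?case
    by (intro exI[of _ 0]) (auto simp: coboundary3_def)
next
  case (sum f g)
  then obtain a b a' b' where
    "Poly_Mapping.keys a \<subseteq> {u \<in> lists {\<phi>. additive \<phi>}. length u = 3}"
    "Poly_Mapping.keys a' \<subseteq> {u \<in> lists {\<phi>. additive \<phi>}. length u = 3}"
    "Poly_Mapping.keys b \<subseteq> {u \<in> lists {\<phi>. additive \<phi>}. length u = 2}"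
    "Poly_Mapping.keys b' \<subseteq> {u \<in> lists {\<phi>. additive \<phi>}. length u = 2}"
    and cob: "coboundary3 (\<lambda>x y z. f x y z - (ext_cocycle a x y z + sym_cocycle b x y z))"
    "coboundary3 (\<lambda>x y z. g x y z - (ext_cocycle a' x y z + sym_cocycle b' x y z))"
    by blast
  moreover have "coboundary3 (\<lambda>x y z. f x y z + g x y z - (ext_cocycle (a + a') x y z + sym_cocycle (b + b') x y z))"
    using coboundary3_add[OF cob] by (simp add: ext_cocycle_add sym_cocycle_add algebra_simps)
  ultimately show ?case
    by (intro exI[of _ "a + a'"] exI[of _ "b + b'"] conjI keys_plus_subset)
qed

end

section \<open>The multiplicative group of a field in additive notation\<close>

text \<open>A type, not a record, so that the units become an instance of
  \<open>ab_group_add\<close> and the additive calculus of cochains applies to them.\<close>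

typedef (overloaded) 'k nonzero = "{x :: 'k::field. x \<noteq> 0}" morphisms val nonzero
  by (intro exI[of _ 1]) simp

lemma val_neq_0 [simp]: "val x \<noteq> 0"
  using val[of x] by simp

instantiation nonzero :: (field) ab_group_add
begin

definition zero_nonzero :: "'a nonzero" where "zero_nonzero = nonzero 1"
definition plus_nonzero :: "'a nonzero \<Rightarrow> 'a nonzero \<Rightarrow> 'a nonzero" where
  "plus_nonzero x y = nonzero (val x * val y)"
definition uminus_nonzero :: "'a nonzero \<Rightarrow> 'a nonzero" where
  "uminus_nonzero x = nonzero (inverse (val x))"
definition minus_nonzero :: "'a nonzero \<Rightarrow> 'a nonzero \<Rightarrow> 'a nonzero" where
  "minus_nonzero x y = nonzero (val x / val y)"

instance
  by standard (simp_all add: zero_nonzero_def plus_nonzero_def uminus_nonzero_def minus_nonzero_def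
      nonzero_inverse val_inverse mult_ac divide_inverse)

end

lemma val_0 [simp]: "val 0 = 1"
  and val_add [simp]: "val (x + y) = val x * val y"
  and val_minus [simp]: "val (- x) = inverse (val x)"
  and val_diff [simp]: "val (x - y) = val x / val y"
  by (simp_all add: zero_nonzero_def plus_nonzero_def uminus_nonzero_def minus_nonzero_def nonzero_inverse)

lemma nonzero_eqI: "val x = val y \<Longrightarrow> x = y"
  by (simp add: val_inject)

lemma val_of_nat_additive:
  assumes "additive N"
  shows "val (N (of_nat n)) = val (N 1) ^ n"
  by (induction n) (simp_all add: additive.zero[OF assms] additive.add[OF assms])

text \<open>A root of 1 + X + ... + X^(p-1). It is not 1, since the value of this polynomial there
  is \<open>p\<close>, which is nonzero in characteristic 0.\<close>

lemma exists_root_of_unity: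
  assumes "prime p"
  obtains \<zeta> :: "'k::{alg_closed_field, field_char_0}" where "\<zeta> \<noteq> 1" "\<zeta> ^ p = 1"
proof -
  have p: "p - 1 > 0" "{..p - 1} = {..<p}"
    using prime_gt_1_nat[OF assms] by auto
  obtain \<zeta> :: 'k where "(\<Sum>k\<le>p - 1. 1 * \<zeta> ^ k) = 0"
    using alg_closed[OF p(1), of "\<lambda>_. 1"] by auto
  then have sum: "(\<Sum>k<p. \<zeta> ^ k) = 0"
    unfolding p(2) by simp
  then have "\<zeta> \<noteq> 1"
    using prime_gt_0_nat[OF assms] by auto
  moreover from this have "\<zeta> ^ p = 1"
    using sum by (simp add: geometric_sum)
  ultimately show ?thesis by (rule that)
qed

lemma card_roots_of_unity_le:
  assumes "n > 0"
  shows "finite {x :: 'k::field. x ^ n = 1} \<and> card {x :: 'k. x ^ n = 1} \<le> n"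
proof -
  define P :: "'k poly" where "P = monom 1 n + [:- 1:]"
  have deg: "degree P = n"
    unfolding P_def using assms by (subst degree_add_eq_left) (simp_all add: degree_monom_eq)
  have "P \<noteq> 0"
    using deg assms by auto
  moreover have "{x. x ^ n = 1} = {x. poly P x = 0}"
    by (simp add: P_def poly_monom)
  ultimately show ?thesis
    using poly_roots_finite[of P] card_poly_roots_bound[of P] deg by simp
qed

lemma exists_torsion_embedding:
  assumes odd: "odd CARD('p::prime_card)"
  obtains e :: "'p::prime_card mod_ring \<Rightarrow> 'k::{alg_closed_field, field_char_0} nonzero"
  where "odd_torsion_embedding e"
proof -
  let ?p = "CARD('p)"
  have p: "prime ?p" by (rule prime_card)
  obtain \<zeta> :: 'k where \<zeta>: "\<zeta> \<noteq> 1" "\<zeta> ^ ?p = 1"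
    using exists_root_of_unity[OF p] by blast
  have \<zeta>0: "\<zeta> \<noteq> 0"
    using \<zeta>(2) prime_gt_0_nat[OF p] by (metis power_0_left less_numeral_extra(3) zero_neq_one)
  have \<zeta>mod: "\<zeta> ^ (n mod ?p) = \<zeta> ^ n" for n
  proof -
    have "\<zeta> ^ n = \<zeta> ^ (?p * (n div ?p) + n mod ?p)" by simp
    then show ?thesis by (simp only: power_add power_mult \<zeta>(2) power_one mult_1_left)
  qed
  define e :: "'p mod_ring \<Rightarrow> 'k nonzero" where "e = (\<lambda>s. nonzero (\<zeta> ^ nat (residue s)))"
  have val_e: "val (e s) = \<zeta> ^ nat (residue s)" for s
    using \<zeta>0 by (simp add: e_def nonzero_inverse)
  have e_add: "e (s + t) = e s + e t" for s t
  proof (rule nonzero_eqI)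
    have "nat (residue (s + t)) = (nat (residue s) + nat (residue t)) mod ?p"
      using residue_bounds(1)[of s] residue_bounds(1)[of t]
      by (simp add: residue_add nat_mod_distrib nat_add_distrib)
    then show "val (e (s + t)) = val (e s + e t)"
      by (simp add: val_e \<zeta>mod power_add)
  qed
  have add_e: "additive e"
    by (simp add: additive_def e_add)
  have e1: "val (e 1) = \<zeta>"
    by (simp add: val_e)
  have e_eq_0: "s = 0" if "e s = 0" for s
  proof (rule ccontr)
    assume "s \<noteq> 0"
    \<comment> \<open>The kernel of \<open>e\<close> is closed under multiples, hence an ideal of a
      field; a nonzero \<open>s\<close> in it would bring in 1.\<close>
    have "e (s * u) = 0" for u
      by (induction u rule: mod_ring_induct) (simp_all add: additive.zero[OF add_e] distrib_left e_add that)
    from this[of "inverse s"] have "e 1 = 0"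
      using \<open>s \<noteq> 0\<close> by simp
    then show False
      using e1 \<zeta>(1) by simp
  qed
  \<comment> \<open>By counting: the values of \<open>e\<close> are \<open>p\<close> distinct roots,
    and there are at most \<open>p\<close> of them.\<close>
  have roots: "{x. x ^ ?p = 1} = range (\<lambda>s. val (e s))"
  proof (rule sym, rule card_subset_eq)
    show "finite {x :: 'k. x ^ ?p = 1}"
      using card_roots_of_unity_le[OF prime_gt_0_nat[OF p]] by blast
    have "val (e s) ^ ?p = 1" for s
      by (simp add: val_e power_mult[symmetric] mult.commute[of _ ?p]) (simp add: power_mult \<zeta>(2))
    then show sub: "range (\<lambda>s. val (e s)) \<subseteq> {x. x ^ ?p = 1}"
      by auto
    have "inj (\<lambda>s. val (e s))"
    proof (rule injI)
      fix s t assume "val (e s) = val (e t)"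
      then have "e (s - t) = 0"
        by (simp add: val_inject additive.diff[OF add_e])
      from e_eq_0[OF this] show "s = t" by simp
    qed
    then have "card (range (\<lambda>s. val (e s))) = ?p"
      by (simp add: card_image)
    then show "card (range (\<lambda>s. val (e s))) = card {x :: 'k. x ^ ?p = 1}"
      using card_roots_of_unity_le[OF prime_gt_0_nat[OF p], where 'k='k]
        card_mono[OF _ sub] by simp
  qed
  have additive_eq_e: "\<exists>t. \<forall>z. N z = e (t * z)" if N: "additive N" for N :: "'p mod_ring \<Rightarrow> 'k nonzero"
  proof -
    \<comment> \<open>\<open>p\<close> times 1 is 0 in the prime field, so \<open>N 1\<close> is
      killed by \<open>p\<close>.\<close>
    have "val (N 1) ^ ?p = 1"
      using val_of_nat_additive[OF N, of ?p] by (simp add: additive.zero[OF N])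
    then have "val (N 1) \<in> range (\<lambda>s. val (e s))"
      by (simp add: roots[symmetric])
    then obtain t where t: "N 1 = e t"
      by (auto simp: val_inject)
    have "N z = e (t * z)" for z
      by (induction z rule: mod_ring_induct)
        (simp_all add: additive.zero[OF N] additive.zero[OF add_e] additive.add[OF N] distrib_left e_add t)
    then show ?thesis by blast
  qed
  have divisible: "\<exists>E :: int \<Rightarrow> 'k nonzero. additive E \<and> E (int ?p) = a" for a
  proof -
    obtain y where y: "y ^ ?p = val a"
      using nth_root_exists[OF prime_gt_0_nat[OF p]] by blast
    have "y \<noteq> 0"
    proof
      assume "y = 0"
      then have "val a = 0"
        using y prime_gt_0_nat[OF p] by (simp add: power_0_left)
      then show False by simp
    qed
    then have val: "val (nonzero (y powi m)) = y powi m" for m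
      by (simp add: nonzero_inverse)
    have "additive (\<lambda>m. nonzero (y powi m))"
      by (rule additive.intro, rule nonzero_eqI) (simp add: power_int_add \<open>y \<noteq> 0\<close> nonzero_inverse)
    moreover have "nonzero (y powi int ?p) = a"
      by (simp add: y val_inverse)
    ultimately show ?thesis by blast
  qed
  have "odd_torsion_embedding e"
    by unfold_locales (use e_add e_eq_0 additive_eq_e divisible odd in auto)
  then show ?thesis by (rule that)
qed

section \<open>Cochains with values in the multiplicative group\<close>

abbreviation units :: "'k::field monoid" where "units \<equiv> multiplicative_group"

lemma multiplicative_group_simps [simp]:
  "carrier units = UNIV - {0 :: 'k::field}" "x \<otimes>\<^bsub>units\<^esub> y = x * (y :: 'k)" "\<one>\<^bsub>units\<^esub> = (1 :: 'k)"
  by (simp_all add: multiplicative_group_def)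

lemma additive_group_simps [simp]:
  "carrier additive_group = UNIV" "x \<otimes>\<^bsub>additive_group\<^esub> y = x + y" "\<one>\<^bsub>additive_group\<^esub> = 0"
  by (simp_all add: additive_group_def)

lemma comm_group_units: "comm_group (units :: 'k::field monoid)"
proof (rule comm_groupI)
  fix x :: 'k assume "x \<in> carrier units"
  then show "\<exists>y\<in>carrier units. y \<otimes>\<^bsub>units\<^esub> x = \<one>\<^bsub>units\<^esub>"
    by (intro bexI[of _ "inverse x"]) auto
qed (auto simp: mult_ac)

lemma inv_units: "x \<noteq> 0 \<Longrightarrow> inv\<^bsub>units\<^esub> x = inverse (x :: 'k::field)"
proof -
  interpret comm_group "units :: 'k monoid" by (rule comm_group_units)
  show "x \<noteq> 0 \<Longrightarrow> inv\<^bsub>units\<^esub> x = inverse x"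
    by (rule inv_equality) auto
qed

lemma int_pow_units:
  assumes "x \<noteq> 0"
  shows "x [^]\<^bsub>units\<^esub> (1 :: int) = (x :: 'k::field)" "x [^]\<^bsub>units\<^esub> (- 1 :: int) = inverse x"
proof -
  interpret comm_group "units :: 'k monoid" by (rule comm_group_units)
  show "x [^]\<^bsub>units\<^esub> (1 :: int) = x"
    using assms by (intro int_pow_1) simp
  then show "x [^]\<^bsub>units\<^esub> (- 1 :: int) = inverse x"
    using assms int_pow_neg[of x 1] by (simp add: inv_units)
qed

lemma tuples_additive_group: "xs \<in> tuples additive_group n \<longleftrightarrow> length xs = n"
  by (simp add: tuples_def)

text \<open>The restriction to tuples matches the product group, whose elements are
  \<open>undefined\<close> elsewhere. So every 3-cochain arises in this way, from one function
  only.\<close>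

definition cochain3 ::
  "('v::ab_group_add \<Rightarrow> 'v \<Rightarrow> 'v \<Rightarrow> 'k::field nonzero) \<Rightarrow> 'v list \<Rightarrow> 'k" where
  "cochain3 f = (\<lambda>xs\<in>tuples additive_group 3. val (f (xs ! 0) (xs ! 1) (xs ! 2)))"

definition cochain2 :: "('v::ab_group_add \<Rightarrow> 'v \<Rightarrow> 'k::field nonzero) \<Rightarrow> 'v list \<Rightarrow> 'k" where
  "cochain2 h = (\<lambda>xs\<in>tuples additive_group 2. val (h (xs ! 0) (xs ! 1)))"

lemma cochain3_inject: "cochain3 f = cochain3 g \<longleftrightarrow> f = g"
proof
  assume eq: "cochain3 f = cochain3 g"
  have "f x y z = g x y z" for x y z
    using fun_cong[OF eq, of "[x, y, z]"]
    by (simp add: cochain3_def tuples_additive_group val_inject numeral_2_eq_2)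
  then show "f = g" by (intro ext)
qed simp

lemma carrier_cochain_group:
  "carrier (cochain_group additive_group units n) = (\<Pi>\<^sub>E xs\<in>tuples additive_group n. UNIV - {0})"
  by (simp add: cochain_group_def)

lemma carrier_cochain_group_3:
  "carrier (cochain_group (additive_group :: 'v::ab_group_add monoid) (units :: 'k::field monoid) 3) = range cochain3"
proof
  show "carrier (cochain_group (additive_group :: 'v monoid) (units :: 'k monoid) 3) \<subseteq> range cochain3"
  proof
    fix F :: "'v list \<Rightarrow> 'k" assume F: "F \<in> carrier (cochain_group additive_group units 3)"
    have "F xs \<noteq> 0" if "length xs = 3" for xs
      using F that by (auto simp: carrier_cochain_group tuples_additive_group PiE_iff)
    then have "F = cochain3 (\<lambda>x y z. nonzero (F [x, y, z]))"
      using F by (intro ext)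
        (auto simp: cochain3_def carrier_cochain_group tuples_additive_group PiE_iff extensional_def
          nonzero_inverse length_eq_3_iff restrict_def)
    then show "F \<in> range cochain3" by blast
  qed
qed (auto simp: carrier_cochain_group cochain3_def)

lemma carrier_cochain_group_2:
  "carrier (cochain_group (additive_group :: 'v::ab_group_add monoid) (units :: 'k::field monoid) 2) = range cochain2"
proof
  show "carrier (cochain_group (additive_group :: 'v monoid) (units :: 'k monoid) 2) \<subseteq> range cochain2"
  proof
    fix F :: "'v list \<Rightarrow> 'k" assume F: "F \<in> carrier (cochain_group additive_group units 2)"
    have "F xs \<noteq> 0" if "length xs = 2" for xs
      using F that by (auto simp: carrier_cochain_group tuples_additive_group PiE_iff)
    then have "F = cochain2 (\<lambda>x y. nonzero (F [x, y]))"
      using F by (intro ext)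
        (auto simp: cochain2_def carrier_cochain_group tuples_additive_group PiE_iff extensional_def
          nonzero_inverse length_eq_2_iff restrict_def)
    then show "F \<in> range cochain2" by blast
  qed
qed (auto simp: carrier_cochain_group cochain2_def)

lemma finprod_units:
  assumes "finite A" "\<And>i. i \<in> A \<Longrightarrow> g i \<noteq> (0 :: 'k::field)"
  shows "finprod units g A = (\<Prod>i\<in>A. g i)"
proof -
  interpret comm_group "units :: 'k monoid" by (rule comm_group_units)
  show ?thesis
    using assms by (induction A) (auto simp: Pi_iff)
qed

lemma cobound_cochain2: "cobound additive_group units 2 (cochain2 h) = cochain3 (delta2 h)"
proof
  fix xs :: "'a list"
  show "cobound additive_group units 2 (cochain2 h) xs = cochain3 (delta2 h) xs"
  proof (cases "length xs = 3")
    case True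
    then obtain x y z where xs: "xs = [x, y, z]" by (auto simp: length_eq_3_iff)
    let ?F = "\<lambda>i. cochain2 h (tuple_face additive_group i xs) [^]\<^bsub>units\<^esub> ((-1) ^ i :: int)"
    have F: "?F 0 = val (h y z)" "?F 1 = inverse (val (h (x + y) z))" "?F 2 = val (h x (y + z))"
        "?F 3 = inverse (val (h x y))"
      by (simp_all add: xs tuple_face_def cochain2_def tuples_additive_group int_pow_units)
    have set: "{..Suc 2} = {0, 1, 2, 3 :: nat}"
      by auto
    have "finprod units ?F {..Suc 2} = (\<Prod>i\<in>{..Suc 2}. ?F i)"
    proof (rule finprod_units)
      fix i assume "i \<in> {..Suc 2}"
      then have "i \<in> {0, 1, 2, 3}"
        unfolding set .
      then show "?F i \<noteq> 0"
        by (elim insertE) (use F in simp_all)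
    qed simp
    also have "\<dots> = ?F 0 * (?F 1 * (?F 2 * ?F 3))"
      unfolding set by simp
    also have "\<dots> = val (delta2 h x y z)"
      unfolding F by (simp add: delta2_def divide_inverse mult_ac)
    finally show ?thesis
      by (simp add: cobound_def cochain3_def tuples_additive_group xs numeral_2_eq_2)
  qed (simp add: cobound_def cochain3_def tuples_additive_group)
qed

lemma cobound_cochain3:
  "cobound additive_group units 3 (cochain3 f) =
    (\<lambda>xs\<in>tuples additive_group 4. val (delta3 f (xs ! 0) (xs ! 1) (xs ! 2) (xs ! 3)))"
proof
  fix xs :: "'a list"
  show "cobound additive_group units 3 (cochain3 f) xs =
    (\<lambda>xs\<in>tuples additive_group 4. val (delta3 f (xs ! 0) (xs ! 1) (xs ! 2) (xs ! 3))) xs"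
  proof (cases "length xs = 4")
    case True
    then obtain x y z t where xs: "xs = [x, y, z, t]"
      by (auto simp: numeral_eq_Suc length_Suc_conv)
    let ?F = "\<lambda>i. cochain3 f (tuple_face additive_group i xs) [^]\<^bsub>units\<^esub> ((-1) ^ i :: int)"
    have F: "?F 0 = val (f y z t)" "?F 1 = inverse (val (f (x + y) z t))" "?F 2 = val (f x (y + z) t)"
        "?F 3 = inverse (val (f x y (z + t)))" "?F 4 = val (f x y z)"
      by (simp_all add: xs tuple_face_def cochain3_def tuples_additive_group int_pow_units numeral_eq_Suc)
    have set: "{..Suc 3} = {0, 1, 2, 3, 4 :: nat}"
      by auto
    have "finprod units ?F {..Suc 3} = (\<Prod>i\<in>{..Suc 3}. ?F i)"
    proof (rule finprod_units)
      fix i assume "i \<in> {..Suc 3}"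
      then have "i \<in> {0, 1, 2, 3, 4}"
        unfolding set .
      then show "?F i \<noteq> 0"
        by (elim insertE) (use F in simp_all)
    qed simp
    also have "\<dots> = ?F 0 * (?F 1 * (?F 2 * (?F 3 * ?F 4)))"
      unfolding set by simp
    also have "\<dots> = val (delta3 f x y z t)"
      unfolding F by (simp add: delta3_def divide_inverse mult_ac)
    finally show ?thesis
      by (simp add: cobound_def tuples_additive_group xs numeral_eq_Suc)
  qed (simp add: cobound_def tuples_additive_group)
qed

lemma coboundaries_3:
  "coboundaries (additive_group :: 'v::ab_group_add monoid) (units :: 'k::field monoid) 3 = cochain3 ` {f. coboundary3 f}"
proof -
  have "coboundaries (additive_group :: 'v monoid) (units :: 'k monoid) 3 =
      cobound additive_group units 2 ` carrier (cochain_group additive_group units 2)"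
    by (simp add: coboundaries_def numeral_3_eq_3 numeral_2_eq_2)
  then show ?thesis
    by (auto simp: carrier_cochain_group_2 cobound_cochain2 coboundary3_def image_iff)
qed

lemma cocycles_3:
  "cocycles (additive_group :: 'v::ab_group_add monoid) (units :: 'k::field monoid) 3 = cochain3 ` {f. cocycle3 f}"
proof -
  have one: "\<one>\<^bsub>cochain_group (additive_group :: 'v monoid) (units :: 'k monoid) (Suc 3)\<^esub> = (\<lambda>xs\<in>tuples additive_group 4. 1)"
    by (simp add: cochain_group_def)
  have "cobound additive_group units 3 (cochain3 f) = \<one>\<^bsub>cochain_group additive_group units (Suc 3)\<^esub>
      \<longleftrightarrow> cocycle3 f" for f :: "'v \<Rightarrow> 'v \<Rightarrow> 'v \<Rightarrow> 'k nonzero"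
  proof
    assume eq: "cobound additive_group units 3 (cochain3 f) = \<one>\<^bsub>cochain_group additive_group units (Suc 3)\<^esub>"
    have "val (delta3 f x y z t) = val 0" for x y z t
      using fun_cong[OF eq, of "[x, y, z, t]"]
      unfolding one cobound_cochain3 by (simp add: tuples_additive_group numeral_eq_Suc)
    then show "cocycle3 f"
      by (simp add: cocycle3_def val_inject del: val_0)
  next
    assume "cocycle3 f"
    then show "cobound additive_group units 3 (cochain3 f) = \<one>\<^bsub>cochain_group additive_group units (Suc 3)\<^esub>"
      unfolding one cobound_cochain3 by (intro restrict_ext) (simp add: cocycle3_def)
  qed
  then show ?thesis
    unfolding cocycles_def kernel_def carrier_cochain_group_3 by auto
qed

section \<open>The isomorphism\<close>

lemma comm_group_image:
  assumes "comm_group G" and car: "carrier H = h ` carrier G"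
    and mult: "\<And>x y. x \<in> carrier G \<Longrightarrow> y \<in> carrier G \<Longrightarrow> h (x \<otimes>\<^bsub>G\<^esub> y) = h x \<otimes>\<^bsub>H\<^esub> h y"
    and one: "h \<one>\<^bsub>G\<^esub> = \<one>\<^bsub>H\<^esub>"
  shows "comm_group H"
proof -
  interpret G: comm_group G by fact
  show ?thesis
  proof (rule comm_groupI)
    fix x assume "x \<in> carrier H"
    then obtain g where "g \<in> carrier G" "x = h g"
      using car by blast
    then show "\<exists>y\<in>carrier H. y \<otimes>\<^bsub>H\<^esub> x = \<one>\<^bsub>H\<^esub>"
      by (intro bexI[of _ "h (inv\<^bsub>G\<^esub> g)"]) (simp_all add: car mult[symmetric] one[symmetric])
  qed (auto simp: car mult[symmetric] one[symmetric] G.m_ac)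
qed

text \<open>The cohomology group and the graded components are images of concrete groups of cocycles
  and of homogeneous elements. Module laws are checked on such representatives and pushed along the
  class map \<open>h\<close>, whose kernel never has to be described.\<close>

lemma group_module_image:
  assumes G: "Group.group G" and M: "comm_group M"
    and car: "carrier N = h ` carrier M"
    and mult: "\<And>x y. x \<in> carrier M \<Longrightarrow> y \<in> carrier M \<Longrightarrow> h (x \<otimes>\<^bsub>M\<^esub> y) = h x \<otimes>\<^bsub>N\<^esub> h y"
    and one: "h \<one>\<^bsub>M\<^esub> = \<one>\<^bsub>N\<^esub>"
    and closed: "\<And>g x. g \<in> carrier G \<Longrightarrow> x \<in> carrier M \<Longrightarrow> a g x \<in> carrier M"
    and act: "\<And>g x. g \<in> carrier G \<Longrightarrow> x \<in> carrier M \<Longrightarrow> act g (h x) = h (a g x)"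
    and a_mult: "\<And>g x y. g \<in> carrier G \<Longrightarrow> x \<in> carrier M \<Longrightarrow> y \<in> carrier M \<Longrightarrow>
      a g (x \<otimes>\<^bsub>M\<^esub> y) = a g x \<otimes>\<^bsub>M\<^esub> a g y"
    and a_one: "\<And>x. x \<in> carrier M \<Longrightarrow> a \<one>\<^bsub>G\<^esub> x = x"
    and a_comp: "\<And>g k x. g \<in> carrier G \<Longrightarrow> k \<in> carrier G \<Longrightarrow> x \<in> carrier M \<Longrightarrow>
      a (g \<otimes>\<^bsub>G\<^esub> k) x = a g (a k x)"
  shows "group_module G N act"
proof -
  interpret G: Group.group G by fact
  interpret M: comm_group M by fact
  show ?thesis
    unfolding group_module_def
  proof (intro conjI ballI)
    show "comm_group N" by (rule comm_group_image[OF M car mult one])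
    show "act g \<in> hom N N" if "g \<in> carrier G" for g
      using that by (auto simp: hom_def car act closed mult[symmetric] a_mult)
  qed (auto simp: car act a_one a_comp closed G)
qed

lemma group_module_DirProd:
  assumes "group_module G M a" "group_module G N b"
  shows "group_module G (M \<times>\<times> N) (\<lambda>g. map_prod (a g) (b g))"
proof -
  have M: "comm_group M" and N: "comm_group N"
    using assms by (simp_all add: group_module_def)
  interpret M: comm_group M by (rule M)
  interpret N: comm_group N by (rule N)
  have "comm_group (M \<times>\<times> N)"
    by (rule group.group_comm_groupI[OF DirProd_group[OF M.is_group N.is_group]])
      (auto simp: M.m_comm N.m_comm)
  then show ?thesis
    using assms by (auto simp: group_module_def hom_def DirProd_def Pi_iff)
qed

section \<open>The general linear group\<close>

lemma matrix_inv_eqI: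
  fixes A B :: "'f::field ^ 'n ^ 'n"
  assumes "A ** B = mat 1" "B ** A = mat 1"
  shows "matrix_inv A = B"
proof -
  have "A ** matrix_inv A = mat 1 \<and> matrix_inv A ** A = mat 1"
    unfolding matrix_inv_def by (rule someI[of _ B]) (use assms in simp)
  then show ?thesis
    by (metis assms(2) matrix_mul_assoc matrix_mul_lid matrix_mul_rid)
qed

lemma invertible_matrix_inv:
  fixes A :: "'f::field ^ 'n ^ 'n"
  assumes "invertible A"
  shows "A ** matrix_inv A = mat 1" "matrix_inv A ** A = mat 1" "invertible (matrix_inv A)"
proof -
  obtain B where "A ** B = mat 1" "B ** A = mat 1"
    using assms unfolding invertible_def by blast
  then show "A ** matrix_inv A = mat 1" "matrix_inv A ** A = mat 1" "invertible (matrix_inv A)"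
    using matrix_inv_eqI[of A B] by (auto simp: invertible_def)
qed

lemma general_linear_group_simps [simp]:
  "carrier general_linear_group = {A :: 'f::field ^ 'n ^ 'n. invertible A}"
  "A \<otimes>\<^bsub>general_linear_group\<^esub> B = A ** B" "\<one>\<^bsub>general_linear_group\<^esub> = mat 1"
  by (simp_all add: general_linear_group_def)

lemma invertible_mat_1: "invertible (mat 1 :: 'f::field ^ 'n ^ 'n)"
  unfolding invertible_def by (intro exI[of _ "mat 1"]) simp

lemma group_general_linear_group: "Group.group (general_linear_group :: ('f::field ^ 'n ^ 'n) monoid)"
proof (rule groupI)
  fix A :: "'f ^ 'n ^ 'n" assume "A \<in> carrier general_linear_group"
  then show "\<exists>B\<in>carrier general_linear_group. B \<otimes>\<^bsub>general_linear_group\<^esub> A = \<one>\<^bsub>general_linear_group\<^esub>"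
    using invertible_matrix_inv[of A] by auto
qed (simp_all add: invertible_mult invertible_mat_1 matrix_mul_assoc)

lemma matrix_inv_mat_1: "matrix_inv (mat 1) = (mat 1 :: 'f::field ^ 'n ^ 'n)"
  by (rule matrix_inv_eqI) simp_all

lemma matrix_inv_mult:
  fixes A B :: "'f::field ^ 'n ^ 'n"
  assumes "invertible A" "invertible B"
  shows "matrix_inv (A ** B) = matrix_inv B ** matrix_inv A"
proof (rule matrix_inv_eqI)
  have "A ** B ** (matrix_inv B ** matrix_inv A) = A ** (B ** matrix_inv B) ** matrix_inv A"
    by (simp only: matrix_mul_assoc)
  then show "A ** B ** (matrix_inv B ** matrix_inv A) = mat 1"
    using assms by (simp add: invertible_matrix_inv)
  have "matrix_inv B ** matrix_inv A ** (A ** B) = matrix_inv B ** (matrix_inv A ** A) ** B"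
    by (simp only: matrix_mul_assoc)
  then show "matrix_inv B ** matrix_inv A ** (A ** B) = mat 1"
    using assms by (simp add: invertible_matrix_inv)
qed

section \<open>Classes and cosets through their representatives\<close>

definition cocycle_group :: "('v::ab_group_add \<Rightarrow> 'v \<Rightarrow> 'v \<Rightarrow> 'a::ab_group_add) monoid" where
  "cocycle_group = \<lparr>carrier = {f. cocycle3 f}, monoid.mult = (\<lambda>f g x y z. f x y z + g x y z), one = (\<lambda>_ _ _. 0)\<rparr>"

definition homogeneous_group :: "'w set \<Rightarrow> nat \<Rightarrow> ('w list \<Rightarrow>\<^sub>0 'f::field) monoid" where
  "homogeneous_group B i =
     \<lparr>carrier = {x. Poly_Mapping.keys x \<subseteq> {u \<in> lists B. length u = i}}, monoid.mult = (+), one = 0\<rparr>"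

lemma cocycle_group_simps [simp]:
  "carrier cocycle_group = {f. cocycle3 f}" "f \<otimes>\<^bsub>cocycle_group\<^esub> g = (\<lambda>x y z. f x y z + g x y z)"
  "\<one>\<^bsub>cocycle_group\<^esub> = (\<lambda>_ _ _. 0)"
  by (simp_all add: cocycle_group_def)

lemma homogeneous_group_simps [simp]:
  "carrier (homogeneous_group B i) = {x. Poly_Mapping.keys x \<subseteq> {u \<in> lists B. length u = i}}"
  "x \<otimes>\<^bsub>homogeneous_group B i\<^esub> y = x + y" "\<one>\<^bsub>homogeneous_group B i\<^esub> = 0"
  by (simp_all add: homogeneous_group_def)

lemma comm_group_cocycle_group: "comm_group cocycle_group"
proof (rule comm_groupI)
  fix f :: "'a \<Rightarrow> 'a \<Rightarrow> 'a \<Rightarrow> 'b" assume f: "f \<in> carrier cocycle_group"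
  have "cocycle3 (\<lambda>_ _ _. 0 :: 'b)"
    by (simp add: cocycle3_def delta3_def)
  from cocycle3_diff[OF this, of f] f
  show "\<exists>g\<in>carrier cocycle_group. g \<otimes>\<^bsub>cocycle_group\<^esub> f = \<one>\<^bsub>cocycle_group\<^esub>"
    by (intro bexI[of _ "\<lambda>x y z. - f x y z"]) simp_all
qed (simp_all add: cocycle3_add add_ac, simp add: cocycle3_def delta3_def)

lemma comm_group_homogeneous_group: "comm_group (homogeneous_group B i)"
proof (rule comm_groupI)
  fix x assume "x \<in> carrier (homogeneous_group B i)"
  then show "\<exists>y\<in>carrier (homogeneous_group B i). y \<otimes>\<^bsub>homogeneous_group B i\<^esub> x = \<one>\<^bsub>homogeneous_group B i\<^esub>"
    by (intro bexI[of _ "- x"]) simp_all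
qed (simp_all add: keys_plus_subset add_ac)

definition cohomology_class ::
  "('v::ab_group_add \<Rightarrow> 'v \<Rightarrow> 'v \<Rightarrow> 'k::field nonzero) \<Rightarrow> ('v list \<Rightarrow> 'k) set" where
  "cohomology_class f = cochain3 ` {g. coboundary3 (\<lambda>x y z. g x y z - f x y z)}"

lemma cochain3_mult:
  "cochain3 f \<otimes>\<^bsub>cochain_group additive_group units 3\<^esub> cochain3 g = cochain3 (\<lambda>x y z. f x y z + g x y z)"
  by (auto simp: cochain_group_def cochain3_def)

lemma coset_cochain3:
  "coboundaries additive_group units 3 #>\<^bsub>cochain_group additive_group units 3\<^esub> cochain3 f
    = cohomology_class f"
proof -
  have "coboundaries additive_group units 3 #>\<^bsub>cochain_group additive_group units 3\<^esub> cochain3 f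
      = (\<lambda>b. cochain3 (\<lambda>x y z. b x y z + f x y z)) ` {b. coboundary3 b}"
    by (auto simp: r_coset_def coboundaries_3 cochain3_mult)
  also have "\<dots> = cohomology_class f"
  proof -
    have "g \<in> (\<lambda>b x y z. b x y z + f x y z) ` {b. coboundary3 b}"
      if "coboundary3 (\<lambda>x y z. g x y z - f x y z)" for g
      using that by (intro image_eqI[of _ _ "\<lambda>x y z. g x y z - f x y z"]) simp_all
    then show ?thesis
      unfolding cohomology_class_def by auto
  qed
  finally show ?thesis .
qed

lemma cohomology_class_eq_iff:
  "cohomology_class f = cohomology_class g \<longleftrightarrow> coboundary3 (\<lambda>x y z. f x y z - g x y z)"
proof
  assume "cohomology_class f = cohomology_class g"
  moreover have "cochain3 f \<in> cohomology_class f"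
    by (simp add: cohomology_class_def coboundary3_0)
  ultimately show "coboundary3 (\<lambda>x y z. f x y z - g x y z)"
    by (auto simp: cohomology_class_def cochain3_inject)
next
  assume fg: "coboundary3 (\<lambda>x y z. f x y z - g x y z)"
  have "coboundary3 (\<lambda>x y z. h x y z - f x y z) \<longleftrightarrow> coboundary3 (\<lambda>x y z. h x y z - g x y z)" for h
    using coboundary3_add[OF _ fg, of "\<lambda>x y z. h x y z - f x y z"]
      coboundary3_diff[OF _ fg, of "\<lambda>x y z. h x y z - g x y z"] by auto
  then show "cohomology_class f = cohomology_class g"
    by (simp add: cohomology_class_def)
qed

lemma cohomology_group_3:
  fixes H defines "H \<equiv> cohomology_group 3 (additive_group :: 'v::ab_group_add monoid) (units :: 'k::field monoid)"
  shows "carrier H = cohomology_class ` {f. cocycle3 f}"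
    "cohomology_class f \<otimes>\<^bsub>H\<^esub> cohomology_class g = cohomology_class (\<lambda>x y z. f x y z + g x y z)"
    "\<one>\<^bsub>H\<^esub> = cohomology_class (\<lambda>_ _ _. 0)"
proof -
  show "carrier H = cohomology_class ` {f. cocycle3 f}"
    by (auto simp: H_def cohomology_group_def FactGroup_def RCOSETS_def cocycles_3 coset_cochain3)
  have "cohomology_class f \<otimes>\<^bsub>H\<^esub> cohomology_class g =
      (\<Union>f'\<in>{f'. coboundary3 (\<lambda>x y z. f' x y z - f x y z)}. \<Union>g'\<in>{g'. coboundary3 (\<lambda>x y z. g' x y z - g x y z)}.
        {cochain3 (\<lambda>x y z. f' x y z + g' x y z)})"
    by (simp add: H_def cohomology_group_def FactGroup_def set_mult_def cohomology_class_def cochain3_mult)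
  also have "\<dots> = cohomology_class (\<lambda>x y z. f x y z + g x y z)"
  proof (intro equalityI subsetI)
    fix F assume "F \<in> cohomology_class (\<lambda>x y z. f x y z + g x y z)"
    then obtain h where h: "F = cochain3 h" "coboundary3 (\<lambda>x y z. h x y z - (f x y z + g x y z))"
      by (auto simp: cohomology_class_def)
    then show "F \<in> (\<Union>f'\<in>{f'. coboundary3 (\<lambda>x y z. f' x y z - f x y z)}.
        \<Union>g'\<in>{g'. coboundary3 (\<lambda>x y z. g' x y z - g x y z)}. {cochain3 (\<lambda>x y z. f' x y z + g' x y z)})"
      \<comment> \<open>The whole deviation of \<open>h\<close> from \<open>f + g\<close> is put
        into the first factor; the second is \<open>g\<close> itself.\<close>
      by (intro UN_I[of "\<lambda>x y z. h x y z - g x y z"] UN_I[of g])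
        (simp_all add: coboundary3_0 diff_diff_eq add.commute)
  next
    fix F assume "F \<in> (\<Union>f'\<in>{f'. coboundary3 (\<lambda>x y z. f' x y z - f x y z)}.
        \<Union>g'\<in>{g'. coboundary3 (\<lambda>x y z. g' x y z - g x y z)}. {cochain3 (\<lambda>x y z. f' x y z + g' x y z)})"
    then obtain f' g' where "coboundary3 (\<lambda>x y z. f' x y z - f x y z)" "coboundary3 (\<lambda>x y z. g' x y z - g x y z)"
      and F: "F = cochain3 (\<lambda>x y z. f' x y z + g' x y z)"
      by auto
    from coboundary3_add[OF this(1,2)] show "F \<in> cohomology_class (\<lambda>x y z. f x y z + g x y z)"
      by (auto simp: F cohomology_class_def algebra_simps)
  qed
  finally show "cohomology_class f \<otimes>\<^bsub>H\<^esub> cohomology_class g = cohomology_class (\<lambda>x y z. f x y z + g x y z)" .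
  show "\<one>\<^bsub>H\<^esub> = cohomology_class (\<lambda>_ _ _. 0)"
    by (simp add: H_def cohomology_group_def FactGroup_def coboundaries_3 cohomology_class_def)
qed

lemma coboundary3_comp:
  assumes "coboundary3 f" "additive \<alpha>"
  shows "coboundary3 (\<lambda>x y z. f (\<alpha> x) (\<alpha> y) (\<alpha> z))"
proof -
  obtain h where "f = delta2 h"
    using assms by (auto simp: coboundary3_def)
  then show ?thesis
    by (intro coboundary3I[of _ "\<lambda>x y. h (\<alpha> x) (\<alpha> y)"]) (simp add: delta2_def additive.add[OF assms(2)])
qed

text \<open>Pulling back a class along \<alpha> gives cocycles of the expected class; pulling back
  along the inverse \<beta> shows that all of them are reached.\<close>

lemma cohomology_pullback_class:
  assumes \<alpha>: "additive \<alpha>" and \<beta>: "additive \<beta>" and inv: "\<And>v. \<alpha> (\<beta> v) = v" "\<And>v. \<beta> (\<alpha> v) = v"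
  shows "cohomology_pullback 3 additive_group \<alpha> (cohomology_class f) =
    cohomology_class (\<lambda>x y z. f (\<alpha> x) (\<alpha> y) (\<alpha> z))"
proof -
  have pull: "(\<lambda>xs\<in>tuples additive_group 3. cochain3 g (map \<alpha> xs)) = cochain3 (\<lambda>x y z. g (\<alpha> x) (\<alpha> y) (\<alpha> z))" for g
    by (auto simp: cochain3_def tuples_additive_group)
  have "(\<lambda>g x y z. g (\<alpha> x) (\<alpha> y) (\<alpha> z)) ` {g. coboundary3 (\<lambda>x y z. g x y z - f x y z)} =
      {g. coboundary3 (\<lambda>x y z. g x y z - f (\<alpha> x) (\<alpha> y) (\<alpha> z))}"
  proof (intro equalityI subsetI)
    fix g assume "g \<in> {g. coboundary3 (\<lambda>x y z. g x y z - f (\<alpha> x) (\<alpha> y) (\<alpha> z))}"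
    then have "coboundary3 (\<lambda>x y z. g (\<beta> x) (\<beta> y) (\<beta> z) - f x y z)"
      using coboundary3_comp[OF _ \<beta>, of "\<lambda>x y z. g x y z - f (\<alpha> x) (\<alpha> y) (\<alpha> z)"] by (simp add: inv)
    then show "g \<in> (\<lambda>g x y z. g (\<alpha> x) (\<alpha> y) (\<alpha> z)) ` {g. coboundary3 (\<lambda>x y z. g x y z - f x y z)}"
      by (intro image_eqI[of _ _ "\<lambda>x y z. g (\<beta> x) (\<beta> y) (\<beta> z)"]) (simp_all add: inv)
  qed (use coboundary3_comp[OF _ \<alpha>, of "\<lambda>x y z. _ x y z - f x y z"] in auto)
  then show ?thesis
    unfolding cohomology_pullback_def cohomology_class_def image_image pull by (metis (no_types) image_image)
qed

lemma coset_free_algebra: "I +>\<^bsub>free_algebra B\<^esub> x = (\<lambda>i. i + x) ` I"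
  by (auto simp: a_r_coset_def')

lemma coset_free_algebra_eq_iff:
  assumes I: "ideal I (free_algebra B)"
  shows "I +>\<^bsub>free_algebra B\<^esub> x = I +>\<^bsub>free_algebra B\<^esub> y \<longleftrightarrow> x - y \<in> I"
proof
  note ID = ideal_free_algebraD[OF I]
  assume "I +>\<^bsub>free_algebra B\<^esub> x = I +>\<^bsub>free_algebra B\<^esub> y"
  moreover have "x \<in> (\<lambda>i. i + x) ` I"
    using ID(2) by (intro image_eqI[of _ _ 0]) simp_all
  ultimately show "x - y \<in> I"
    by (auto simp: coset_free_algebra)
next
  note ID = ideal_free_algebraD[OF I]
  assume xy: "x - y \<in> I"
  have "i + x \<in> (\<lambda>i. i + y) ` I" if "i \<in> I" for i
    using ID(3)[OF that xy] by (intro image_eqI[of _ _ "i + (x - y)"]) simp_all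
  moreover have "i + y \<in> (\<lambda>i. i + x) ` I" if "i \<in> I" for i
    using ID(5)[OF that xy] by (intro image_eqI[of _ _ "i - (x - y)"]) simp_all
  ultimately show "I +>\<^bsub>free_algebra B\<^esub> x = I +>\<^bsub>free_algebra B\<^esub> y"
    by (auto simp: coset_free_algebra)
qed

lemma graded_component_free_algebra:
  fixes B :: "'w set" and I :: "('w list \<Rightarrow>\<^sub>0 'f::field) set" and n :: nat
  assumes I: "ideal I (free_algebra B)"
  defines "Q \<equiv> graded_component n (free_algebra B Quot I)"
  shows "carrier Q = (\<lambda>x. I +>\<^bsub>free_algebra B\<^esub> x) ` carrier (homogeneous_group B n)"
    "x \<in> carrier (homogeneous_group B n) \<Longrightarrow> y \<in> carrier (homogeneous_group B n) \<Longrightarrow>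
      I +>\<^bsub>free_algebra B\<^esub> (x + y) = (I +>\<^bsub>free_algebra B\<^esub> x) \<otimes>\<^bsub>Q\<^esub> (I +>\<^bsub>free_algebra B\<^esub> y)"
    "I +>\<^bsub>free_algebra B\<^esub> 0 = \<one>\<^bsub>Q\<^esub>"
proof -
  interpret ideal I "free_algebra B" by (rule I)
  note ID = ideal_free_algebraD[OF I]
  have carQ: "carrier Q = {X. (\<exists>y. Poly_Mapping.keys y \<subseteq> lists B \<and> X = I +>\<^bsub>free_algebra B\<^esub> y) \<and>
      (\<exists>x\<in>X. \<forall>u\<in>Poly_Mapping.keys x. length u = n)}"
    by (auto simp: Q_def graded_component_def FactRing_def A_RCOSETS_def' )
  show "carrier Q = (\<lambda>x. I +>\<^bsub>free_algebra B\<^esub> x) ` carrier (homogeneous_group B n)"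
  proof (intro equalityI subsetI)
    fix X assume "X \<in> carrier Q"
    then obtain y x where y: "Poly_Mapping.keys y \<subseteq> lists B" "X = I +>\<^bsub>free_algebra B\<^esub> y"
      and x: "x \<in> X" "\<forall>u\<in>Poly_Mapping.keys x. length u = n"
      unfolding carQ by blast
    \<comment> \<open>The homogeneous member \<open>x\<close> need not be the representative
      \<open>y\<close> of the coset, but differs from it by an element of \<open>I\<close>; so
      \<open>x\<close> is a word combination over \<open>B\<close> too and represents the same
      coset.\<close>
    then obtain i where i: "i \<in> I" "x = i + y"
      by (auto simp: coset_free_algebra)
    then have "Poly_Mapping.keys x \<subseteq> lists B"
      using ID(1) y(1) by (auto intro!: keys_plus_subset del: subsetI)
    then have "x \<in> carrier (homogeneous_group B n)"
      using x(2) by auto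
    moreover have "X = I +>\<^bsub>free_algebra B\<^esub> x"
      using i ID(4)[OF i(1)] by (simp add: y(2) coset_free_algebra_eq_iff[OF I])
    ultimately show "X \<in> (\<lambda>x. I +>\<^bsub>free_algebra B\<^esub> x) ` carrier (homogeneous_group B n)"
      by blast
  next
    fix X assume "X \<in> (\<lambda>x. I +>\<^bsub>free_algebra B\<^esub> x) ` carrier (homogeneous_group B n)"
    then obtain x where x: "Poly_Mapping.keys x \<subseteq> {u \<in> lists B. length u = n}" "X = I +>\<^bsub>free_algebra B\<^esub> x"
      by auto
    moreover have "x \<in> I +>\<^bsub>free_algebra B\<^esub> x"
      unfolding coset_free_algebra using ID(2) by (intro image_eqI[of _ _ 0]) simp_all
    ultimately show "X \<in> carrier Q"
      unfolding carQ by blast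
  qed
  show "I +>\<^bsub>free_algebra B\<^esub> (x + y) = (I +>\<^bsub>free_algebra B\<^esub> x) \<otimes>\<^bsub>Q\<^esub> (I +>\<^bsub>free_algebra B\<^esub> y)"
    if "x \<in> carrier (homogeneous_group B n)" "y \<in> carrier (homogeneous_group B n)"
  proof -
    have "x \<in> carrier (free_algebra B)" "y \<in> carrier (free_algebra B)"
      using that by auto
    from a_rcos_sum[OF this] show ?thesis
      by (simp add: Q_def graded_component_def FactRing_def)
  qed
  show "I +>\<^bsub>free_algebra B\<^esub> 0 = \<one>\<^bsub>Q\<^esub>"
    by (simp add: Q_def graded_component_def FactRing_def coset_free_algebra)
qed

abbreviation pullback_words ::
  "('v \<Rightarrow> 'v) \<Rightarrow> (('v \<Rightarrow> 'f) list \<Rightarrow>\<^sub>0 'f::field) \<Rightarrow> (('v \<Rightarrow> 'f) list \<Rightarrow>\<^sub>0 'f)" where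
  "pullback_words \<alpha> \<equiv> free_algebra_map (\<lambda>\<phi> v. \<phi> (\<alpha> v))"

lemma additive_comp: "additive \<phi> \<Longrightarrow> additive \<alpha> \<Longrightarrow> additive (\<lambda>v. \<phi> (\<alpha> v))"
  by (simp add: additive_def)

lemma pullback_words_relations:
  fixes \<alpha> :: "'p::prime_card mod_ring ^ 'n \<Rightarrow> 'p mod_ring ^ 'n"
  assumes \<alpha>: "additive \<alpha>"
  shows "r \<in> exterior_relations dual \<Longrightarrow> pullback_words \<alpha> r \<in> exterior_relations dual"
    "r \<in> symmetric_relations dual \<Longrightarrow> pullback_words \<alpha> r \<in> symmetric_relations dual"
proof -
  have tensor: "pullback_words \<alpha> r \<in> tensor_relations dual" if "r \<in> tensor_relations dual" for r
    using that
  proof (cases rule: tensor_relations_cases)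
    case (add a b)
    then show ?thesis
      using free_gen_tensor_relation[OF additive_comp[OF add(1) \<alpha>] additive_comp[OF add(2) \<alpha>]]
      by (simp add: free_algebra_map_diff free_gen_def)
  next
    case (smult c a)
    then show ?thesis
      using free_gen_smult_relation[OF additive_comp[OF smult(1) \<alpha>], of c]
      by (simp add: free_algebra_map_diff free_gen_def free_scalar_def mult_single plus_list_def)
  qed
  show "pullback_words \<alpha> r \<in> exterior_relations dual" if "r \<in> exterior_relations dual"
    using that
  proof (cases rule: exterior_relations_cases)
    case (square a)
    let ?a = "\<lambda>v. a (\<alpha> v)"
    have "free_gen ?a * free_gen ?a \<in> exterior_relations dual"
      unfolding exterior_relations_def using additive_comp[OF square(1) \<alpha>]
      by (intro UnI2 CollectI exI[of _ ?a]) simp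
    then show ?thesis
      by (simp add: square free_gen_def mult_single plus_list_def)
  qed (use tensor relations_subset(1) in blast)
  show "pullback_words \<alpha> r \<in> symmetric_relations dual" if "r \<in> symmetric_relations dual"
    using that
  proof (cases rule: symmetric_relations_cases)
    case (commutator a b)
    let ?a = "\<lambda>v. a (\<alpha> v)" and ?b = "\<lambda>v. b (\<alpha> v)"
    have "free_gen ?a * free_gen ?b - free_gen ?b * free_gen ?a \<in> symmetric_relations dual"
      unfolding symmetric_relations_def
      using additive_comp[OF commutator(1) \<alpha>] additive_comp[OF commutator(2) \<alpha>]
      by (intro UnI2 CollectI exI[of _ ?a] exI[of _ ?b]) simp
    then show ?thesis
      by (simp add: commutator free_gen_def mult_single plus_list_def free_algebra_map_diff)
  qed (use tensor relations_subset(2) in blast)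
qed

lemma pullback_words_coset:
  assumes I: "\<And>\<alpha> x. additive \<alpha> \<Longrightarrow> x \<in> I \<Longrightarrow> pullback_words \<alpha> x \<in> I"
    and \<alpha>: "additive \<alpha>" and \<beta>: "additive \<beta>" and inv: "\<And>v. \<alpha> (\<beta> v) = v" "\<And>v. \<beta> (\<alpha> v) = v"
  shows "pullback_words \<alpha> ` (I +>\<^bsub>free_algebra B\<^esub> x) = I +>\<^bsub>free_algebra B\<^esub> pullback_words \<alpha> x"
proof -
  have inverse: "pullback_words \<alpha> (pullback_words \<beta> y) = y" for y
    unfolding free_algebra_map_comp by (rule free_algebra_map_ident[where B = UNIV]) (simp_all add: inv)
  have "pullback_words \<alpha> ` I = I"
  proof (intro equalityI subsetI)
    fix y assume "y \<in> I"
    then have "pullback_words \<beta> y \<in> I"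
      by (rule I[OF \<beta>])
    then show "y \<in> pullback_words \<alpha> ` I"
      by (metis imageI inverse)
  qed (use I[OF \<alpha>] in blast)
  then have "(\<lambda>i. i + pullback_words \<alpha> x) ` I = (\<lambda>i. i + pullback_words \<alpha> x) ` (pullback_words \<alpha> ` I)"
    by simp
  then show ?thesis
    by (simp add: coset_free_algebra image_image free_algebra_map_add)
qed

text \<open>Both ideals meet these hypotheses, so the actions on exterior and symmetric powers are
  treated together.\<close>

context
  fixes I :: "(('p::prime_card mod_ring ^ 'n \<Rightarrow> 'p mod_ring) list \<Rightarrow>\<^sub>0 'p mod_ring) set"
  assumes I: "ideal I (free_algebra {a. additive a})"
    and pullback: "\<And>\<alpha> x. additive \<alpha> \<Longrightarrow> x \<in> I \<Longrightarrow> pullback_words \<alpha> x \<in> I"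
begin

lemma dual_power_action_coset:
  assumes "invertible g"
  shows "dual_power_action g (I +>\<^bsub>free_algebra {a. additive a}\<^esub> x) =
    I +>\<^bsub>free_algebra {a. additive a}\<^esub> pullback_words ((*v) (matrix_inv g)) x"
  unfolding dual_power_action_def coset_map_def dual_action_def
  by (rule pullback_words_coset[where \<beta> = "(*v) g"])
    (simp_all add: pullback additive_def matrix_vector_right_distrib matrix_vector_mul_assoc
      invertible_matrix_inv assms)

lemma group_module_graded_component:
  "group_module general_linear_group (graded_component i (free_algebra {a. additive a} Quot I)) dual_power_action"
proof (rule group_module_image[where M = "homogeneous_group {a. additive a} i"
      and h = "\<lambda>x. I +>\<^bsub>free_algebra {a. additive a}\<^esub> x"
      and a = "\<lambda>g. pullback_words ((*v) (matrix_inv g))"])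
  fix g k :: "'p mod_ring ^ 'n ^ 'n" and x :: "('p mod_ring ^ 'n \<Rightarrow> 'p mod_ring) list \<Rightarrow>\<^sub>0 'p mod_ring"
  assume g: "g \<in> carrier general_linear_group" and x: "x \<in> carrier (homogeneous_group {a. additive a} i)"
  show "pullback_words ((*v) (matrix_inv g)) x \<in> carrier (homogeneous_group {a. additive a} i)"
    using x by (auto simp: additive_def matrix_vector_right_distrib
        intro!: keys_free_algebra_map[of x "{u \<in> lists {a. additive a}. length u = i}"] del: subsetI)
  show "dual_power_action g (I +>\<^bsub>free_algebra {a. additive a}\<^esub> x) =
      I +>\<^bsub>free_algebra {a. additive a}\<^esub> pullback_words ((*v) (matrix_inv g)) x"
    using g by (simp add: dual_power_action_coset)
  \<comment> \<open>Inversion and pullback each reverse the order of composition, which makes this a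
    left action.\<close>
  show "pullback_words ((*v) (matrix_inv (g \<otimes>\<^bsub>general_linear_group\<^esub> k))) x =
      pullback_words ((*v) (matrix_inv g)) (pullback_words ((*v) (matrix_inv k)) x)"
    if "k \<in> carrier general_linear_group"
    using g that by (simp add: matrix_inv_mult free_algebra_map_comp matrix_vector_mul_assoc)
next
  fix x :: "('p mod_ring ^ 'n \<Rightarrow> 'p mod_ring) list \<Rightarrow>\<^sub>0 'p mod_ring"
  show "pullback_words ((*v) (matrix_inv \<one>\<^bsub>general_linear_group\<^esub>)) x = x"
    by (rule free_algebra_map_ident[where B = UNIV]) (simp_all add: matrix_inv_mat_1)
qed (simp_all add: group_general_linear_group comm_group_homogeneous_group free_algebra_map_add
    graded_component_free_algebra[OF I] del: homogeneous_group_simps(1))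

end

lemma pullback_words_ideals:
  fixes \<alpha> :: "'p::prime_card mod_ring ^ 'n \<Rightarrow> 'p mod_ring ^ 'n"
  assumes "additive \<alpha>"
  shows "x \<in> exterior_ideal \<Longrightarrow> pullback_words \<alpha> x \<in> exterior_ideal"
    "x \<in> symmetric_ideal \<Longrightarrow> pullback_words \<alpha> x \<in> symmetric_ideal"
  by (rule free_algebra_map_Idl[OF relations_closed(1)];
      simp add: additive_comp[OF _ assms] pullback_words_relations[OF assms])
    (rule free_algebra_map_Idl[OF relations_closed(2)];
      simp add: additive_comp[OF _ assms] pullback_words_relations[OF assms])

lemma power_eq_graded_component:
  "exterior_power i dual = graded_component i (free_algebra {a. additive a} Quot exterior_ideal)"
  "symmetric_power i dual = graded_component i (free_algebra {a. additive a} Quot symmetric_ideal)"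
  by (simp_all add: exterior_power_def exterior_algebra_def symmetric_power_def symmetric_algebra_def)

lemma cohomology_action_class:
  fixes g :: "'p::prime_card mod_ring ^ 'n ^ 'n"
  assumes "invertible g"
  shows "cohomology_action 3 g (cohomology_class f) =
    cohomology_class (\<lambda>x y z. f (matrix_inv g *v x) (matrix_inv g *v y) (matrix_inv g *v z))"
  unfolding cohomology_action_def
  by (rule cohomology_pullback_class[where \<beta> = "(*v) g"])
    (simp_all add: additive_def matrix_vector_right_distrib matrix_vector_mul_assoc invertible_matrix_inv assms)

lemma group_module_cohomology_group:
  "group_module general_linear_group
    (cohomology_group 3 (additive_group :: ('p::prime_card mod_ring ^ 'n) monoid) (units :: 'k::field monoid))
    (cohomology_action 3)"
proof (rule group_module_image[where M = cocycle_group and h = cohomology_class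
      and a = "\<lambda>g f x y z. f (matrix_inv g *v x) (matrix_inv g *v y) (matrix_inv g *v z)"])
  fix g k :: "'p mod_ring ^ 'n ^ 'n" and f :: "'p mod_ring ^ 'n \<Rightarrow> 'p mod_ring ^ 'n \<Rightarrow> 'p mod_ring ^ 'n \<Rightarrow> 'k nonzero"
  assume g: "g \<in> carrier general_linear_group" and f: "f \<in> carrier cocycle_group"
  show "(\<lambda>x y z. f (matrix_inv g *v x) (matrix_inv g *v y) (matrix_inv g *v z)) \<in> carrier cocycle_group"
    using f by (simp add: cocycle3_def delta3_def matrix_vector_right_distrib)
  show "cohomology_action 3 g (cohomology_class f) =
      cohomology_class (\<lambda>x y z. f (matrix_inv g *v x) (matrix_inv g *v y) (matrix_inv g *v z))"
    using g by (simp add: cohomology_action_class)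
  show "(\<lambda>x y z. f (matrix_inv (g \<otimes>\<^bsub>general_linear_group\<^esub> k) *v x) (matrix_inv (g \<otimes>\<^bsub>general_linear_group\<^esub> k) *v y)
        (matrix_inv (g \<otimes>\<^bsub>general_linear_group\<^esub> k) *v z)) =
      (\<lambda>x y z. f (matrix_inv k *v (matrix_inv g *v x)) (matrix_inv k *v (matrix_inv g *v y))
        (matrix_inv k *v (matrix_inv g *v z)))"
    if "k \<in> carrier general_linear_group"
    using g that by (simp add: matrix_inv_mult matrix_vector_mul_assoc)
qed (simp_all add: group_general_linear_group comm_group_cocycle_group cohomology_group_3 matrix_inv_mat_1)

theorem proposition5p1:
  assumes "odd CARD('p::prime_card)"
  shows "group_module_isomorphic
    (general_linear_group :: ('p mod_ring ^ 'n ^ 'n) monoid)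
    (cohomology_group 3
      (additive_group :: ('p mod_ring ^ 'n) monoid)
      (multiplicative_group :: 'k::{alg_closed_field, field_char_0} monoid))
    (cohomology_action 3)
    (exterior_power 3 (dual_space :: (_, 'p mod_ring ^ 'n \<Rightarrow> _) module) \<times>\<times>
     symmetric_power 2 (dual_space :: (_, 'p mod_ring ^ 'n \<Rightarrow> _) module))
    (\<lambda>g. map_prod (dual_power_action g) (dual_power_action g))"
proof -
  obtain e :: "'p mod_ring \<Rightarrow> 'k nonzero" where "odd_torsion_embedding e"
    using exists_torsion_embedding[OF assms] by blast
  then interpret odd_torsion_embedding e .
  let ?G = "general_linear_group :: ('p mod_ring ^ 'n ^ 'n) monoid"
  let ?H = "cohomology_group 3 (additive_group :: ('p mod_ring ^ 'n) monoid) (units :: 'k monoid)"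
  let ?E = "exterior_power 3 (dual_space :: (_, 'p mod_ring ^ 'n \<Rightarrow> _) module)"
  let ?S = "symmetric_power 2 (dual_space :: (_, 'p mod_ring ^ 'n \<Rightarrow> _) module)"
  let ?F = "free_algebra {a :: 'p mod_ring ^ 'n \<Rightarrow> 'p mod_ring. additive a}"
  let ?B = "\<lambda>i. homogeneous_group {a :: 'p mod_ring ^ 'n \<Rightarrow> 'p mod_ring. additive a} i"
  note Ecomp = graded_component_free_algebra[OF exterior_ideal, folded power_eq_graded_component]
  note Scomp = graded_component_free_algebra[OF symmetric_ideal, folded power_eq_graded_component]
  define \<epsilon> where "\<epsilon> x = exterior_ideal +>\<^bsub>?F\<^esub> x" for x
  define \<sigma> where "\<sigma> x = symmetric_ideal +>\<^bsub>?F\<^esub> x" for x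
  have carE: "carrier ?E = \<epsilon> ` carrier (?B 3)" and carS: "carrier ?S = \<sigma> ` carrier (?B 2)"
    using Ecomp(1) Scomp(1) by (simp_all add: \<epsilon>_def \<sigma>_def)
  have multE: "\<epsilon> x \<otimes>\<^bsub>?E\<^esub> \<epsilon> y = \<epsilon> (x + y)" if "x \<in> carrier (?B 3)" "y \<in> carrier (?B 3)" for x y
    using Ecomp(2)[OF that] by (simp add: \<epsilon>_def)
  have multS: "\<sigma> x \<otimes>\<^bsub>?S\<^esub> \<sigma> y = \<sigma> (x + y)" if "x \<in> carrier (?B 2)" "y \<in> carrier (?B 2)" for x y
    using Scomp(2)[OF that] by (simp add: \<sigma>_def)
  have eqE: "\<epsilon> x = \<epsilon> y \<longleftrightarrow> x - y \<in> exterior_ideal" and eqS: "\<sigma> x = \<sigma> y \<longleftrightarrow> x - y \<in> symmetric_ideal" for x y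
    unfolding \<epsilon>_def \<sigma>_def
    by (rule coset_free_algebra_eq_iff[OF exterior_ideal], rule coset_free_algebra_eq_iff[OF symmetric_ideal])
  have modH: "group_module ?G ?H (cohomology_action 3)"
    by (rule group_module_cohomology_group)
  have modE: "group_module ?G ?E dual_power_action"
    unfolding power_eq_graded_component
    by (rule group_module_graded_component[OF exterior_ideal pullback_words_ideals(1)])
  have modS: "group_module ?G ?S dual_power_action"
    unfolding power_eq_graded_component
    by (rule group_module_graded_component[OF symmetric_ideal pullback_words_ideals(2)])
  let ?N = "?E \<times>\<times> ?S"
  let ?act = "\<lambda>g. map_prod (dual_power_action g) (dual_power_action g)"
  have modN: "group_module ?G ?N ?act"
    by (rule group_module_DirProd[OF modE modS])

  define cls where "cls x y = cohomology_class (\<lambda>u v w. ext_cocycle x u v w + sym_cocycle y u v w)"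
    for x y :: "('p mod_ring ^ 'n \<Rightarrow> 'p mod_ring) list \<Rightarrow>\<^sub>0 'p mod_ring"
  \<comment> \<open>Representatives of the cosets are chosen arbitrarily; the next fact shows
    independence of the choice, as the ideals go to coboundaries.\<close>
  define \<Psi> where "\<Psi> = (\<lambda>(X, Y). cls (SOME x. \<epsilon> x = X) (SOME y. \<sigma> y = Y))"
  have \<Psi>: "\<Psi> (\<epsilon> x, \<sigma> y) = cls x y" for x y
  proof -
    have "\<epsilon> (SOME x'. \<epsilon> x' = \<epsilon> x) = \<epsilon> x" "\<sigma> (SOME y'. \<sigma> y' = \<sigma> y) = \<sigma> y"
      by (rule someI, rule refl)+
    then have "coboundary3 (ext_cocycle ((SOME x'. \<epsilon> x' = \<epsilon> x) - x))"
      "coboundary3 (sym_cocycle ((SOME y'. \<sigma> y' = \<sigma> y) - y))"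
      by (simp_all add: eqE eqS coboundary3_ext_ideal coboundary3_sym_ideal)
    from coboundary3_add[OF this] show ?thesis
      by (simp add: \<Psi>_def cls_def cohomology_class_eq_iff ext_cocycle_diff sym_cocycle_diff algebra_simps)
  qed
  have cocycle: "cocycle3 (\<lambda>u v w. ext_cocycle x u v w + sym_cocycle y u v w)"
    if "x \<in> carrier (?B 3)" "y \<in> carrier (?B 2)" for x y
    using that by (intro cocycle3_add cocycle3_ext_cocycle cocycle3_sym_cocycle) auto
  have "\<Psi> \<in> iso ?N ?H"
    unfolding iso_def
  proof (intro CollectI conjI homI)
    show "\<Psi> P \<in> carrier ?H" if "P \<in> carrier ?N" for P
      using that cocycle by (auto simp: carE carS \<Psi> cls_def cohomology_group_3 simp del: homogeneous_group_simps)
    show "\<Psi> (P \<otimes>\<^bsub>?N\<^esub> Q) = \<Psi> P \<otimes>\<^bsub>?H\<^esub> \<Psi> Q" if PQ: "P \<in> carrier ?N" "Q \<in> carrier ?N" for P Q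
    proof -
      obtain x y x' y' where P: "P = (\<epsilon> x, \<sigma> y)" "Q = (\<epsilon> x', \<sigma> y')"
        and xy: "x \<in> carrier (?B 3)" "y \<in> carrier (?B 2)" "x' \<in> carrier (?B 3)" "y' \<in> carrier (?B 2)"
        using PQ by (auto simp: carE carS simp del: homogeneous_group_simps)
      show ?thesis
        unfolding P mult_DirProd multE[OF xy(1,3)] multS[OF xy(2,4)] \<Psi>
        by (simp add: cls_def cohomology_group_3 ext_cocycle_add sym_cocycle_add add_ac)
    qed
    show "bij_betw \<Psi> (carrier ?N) (carrier ?H)"
    proof (rule bij_betw_imageI)
      show "inj_on \<Psi> (carrier ?N)"
      proof (rule inj_onI)
        fix P Q assume PQ: "P \<in> carrier ?N" "Q \<in> carrier ?N" and eq: "\<Psi> P = \<Psi> Q"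
        obtain x y x' y' where P: "P = (\<epsilon> x, \<sigma> y)" "Q = (\<epsilon> x', \<sigma> y')"
          and xy: "x \<in> carrier (?B 3)" "y \<in> carrier (?B 2)" "x' \<in> carrier (?B 3)" "y' \<in> carrier (?B 2)"
          using PQ by (auto simp: carE carS simp del: homogeneous_group_simps)
        have cob: "coboundary3 (\<lambda>u v w. ext_cocycle (x - x') u v w + sym_cocycle (y - y') u v w)"
          using eq unfolding P \<Psi> cls_def cohomology_class_eq_iff
          by (simp add: ext_cocycle_diff sym_cocycle_diff algebra_simps)
        have keys: "Poly_Mapping.keys (x - x') \<subseteq> {u \<in> lists {\<phi>. additive \<phi>}. length u = 3}"
          "Poly_Mapping.keys (y - y') \<subseteq> {u \<in> lists {\<phi>. additive \<phi>}. length u = 2}"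
          using xy by (simp_all only: homogeneous_group_simps mem_Collect_eq keys_minus_subset)
        have "\<epsilon> x = \<epsilon> x'" "\<sigma> y = \<sigma> y'"
          unfolding eqE eqS by (rule kernel_in_ideals[OF keys cob])+
        then show "P = Q"
          by (simp add: P)
      qed
      show "\<Psi> ` carrier ?N = carrier ?H"
      proof (intro equalityI subsetI)
        fix X assume "X \<in> carrier ?H"
        then obtain f where f: "cocycle3 f" "X = cohomology_class f"
          by (auto simp: cohomology_group_3)
        obtain x y where "x \<in> carrier (?B 3)" "y \<in> carrier (?B 2)"
          and "coboundary3 (\<lambda>u v w. f u v w - (ext_cocycle x u v w + sym_cocycle y u v w))"
          using gen3_represented[OF gen3_of_cocycle3[OF f(1)]] by auto
        then have "X = \<Psi> (\<epsilon> x, \<sigma> y)" "(\<epsilon> x, \<sigma> y) \<in> carrier ?N"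
          by (simp_all add: \<Psi> f(2) cls_def cohomology_class_eq_iff carE carS del: homogeneous_group_simps)
        then show "X \<in> \<Psi> ` carrier ?N" by blast
      qed (use cocycle in \<open>auto simp: carE carS \<Psi> cls_def cohomology_group_3 simp del: homogeneous_group_simps\<close>)
    qed
  qed
  moreover have equiv: "\<Psi> (?act g P) = cohomology_action 3 g (\<Psi> P)"
    if G: "g \<in> carrier ?G" and N: "P \<in> carrier ?N" for g P
  proof -
    obtain x y where P: "P = (\<epsilon> x, \<sigma> y)"
      using N by (auto simp: carE carS)
    have g: "invertible g" using G by simp
    let ?p = "pullback_words ((*v) (matrix_inv g))"
    have "?act g P = (\<epsilon> (?p x), \<sigma> (?p y))"
      unfolding P \<epsilon>_def \<sigma>_def map_prod_simp prod.inject
      by (intro conjI dual_power_action_coset[OF exterior_ideal pullback_words_ideals(1) g]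
          dual_power_action_coset[OF symmetric_ideal pullback_words_ideals(2) g])
    then show ?thesis
      by (simp add: P \<Psi> cls_def cohomology_action_class[OF g] ext_cocycle_map sym_cocycle_map)
  qed
  ultimately have iso: "\<Psi> \<in> iso ?N ?H" by blast
  have N: "Group.group ?N"
    using modN by (simp add: group_module_def comm_group_def)
  interpret N: Group.group ?N by (rule N)
  \<comment> \<open>The statement asks for the map out of cohomology, so the isomorphism and its
    equivariance are inverted.\<close>
  let ?\<Phi> = "inv_into (carrier ?N) \<Psi>"
  have bij: "bij_betw \<Psi> (carrier ?N) (carrier ?H)"
    using iso by (simp add: iso_def)
  have "?\<Phi> (cohomology_action 3 g X) = ?act g (?\<Phi> X)" if g: "g \<in> carrier ?G" and X: "X \<in> carrier ?H" for g X
  proof -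
    obtain P where P: "P \<in> carrier ?N" "X = \<Psi> P"
      using X unfolding bij_betw_imp_surj_on[OF bij, symmetric] by blast
    have "?act g P \<in> carrier ?N"
      using modN g P(1) by (auto simp: group_module_def hom_def)
    then show ?thesis
      using bij P equiv[OF g P(1)] by (metis bij_betw_inv_into_left)
  qed
  then show ?thesis
    unfolding group_module_isomorphic_def using modH modN N.iso_set_sym[OF iso] by blast
qed

end
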